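(* Let $T$ be a tiling of a convex polygon $R$ whose associated bipartite graph $\mathcal{G}$ has all bounded faces of degree $4$. Fix all edges of $R$ except one boundary edge $b_0$, whose intercept is allowed to vary, and let $B_0=B_{int}\cup\{b_0\}$. Let $C_T\subset\mathbb{R}^{B_0}$ be the set of intercept vectors $(i_b)_{b\in B_0}$ of tilings combinatorially equivalent to $T$ with the same edge directions (with $R$ fixed except for the edge $b_0$), for $\sigma\in\{1,-1\}^W$ let $C_T(\sigma)\subset C_T$ be the subset of those tilings whose tile orientations are given by $\sigma$, and let $\Psi:C_T\to\mathbb{R}^W$ be the map sending intercepts to the vector of tile areas $(A_w)_{w\in W}$. Then $\Psi$ is a diffeomorphism from $C_T(\sigma)$ onto its image.
   Context: A tiling of a polygon $R\subset\mathbb{R}^2$ is a covering of $R$ by finitely many convex polygons (tiles) with pairwise disjoint interiors (not necessarily edge-to-edge); its tiles are assumed to have "T"-junctions at every tile vertex other than the convex corners of $R$. The associated bipartite planar graph $\mathcal{G}$ has a white vertex for each tile (the set $W$), a black vertex for each maximal line segment in the union of tile boundaries, and an edge $wb$ when tile $w$ has an edge contained in segment $b$; black vertices from segments on $\partial R$ are boundary vertices (each corresponding to an edge of $R$), the others form the set $B_{int}$ of interior black vertices. Two tilings are combinatorially equivalent if their associated graphs are isomorphic via a color-preserving isomorphism fixing boundary vertices; "same edge directions" means corresponding segments are parallel. The intercept $i_b$ of a segment $b$ is the signed distance from the origin to the line containing $b$ (for a line $ax+by=c$ it is $\pm c/\sqrt{a^2+b^2}$, with a fixed sign convention for each $b$).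 For a tile with original counterclockwise edge vectors $z_1,\dots,z_n$, a corresponding tile with edge vectors $a_1z_1,\dots,a_nz_n$ has orientation $+1$ if all $a_i>0$ and $-1$ if all $a_i<0$. *)

theory Defs
  imports "HOL-Analysis.Analysis"
begin

section \<open>Tilings of convex polygons\<close>

type_synonym plane = "real^2"

definition cross :: "plane \<Rightarrow> plane \<Rightarrow> real" where
  "cross x y = x $ 1 * y $ 2 - x $ 2 * y $ 1"

definition convex_polygon :: "plane set \<Rightarrow> bool" where
  "convex_polygon P \<longleftrightarrow> polytope P \<and> interior P \<noteq> {}"

definition skeleton :: "plane set set \<Rightarrow> plane set" where
  "skeleton W = (\<Union>w\<in>W. frontier w)"

definition segments :: "plane set set \<Rightarrow> plane set set" where
  "segments W = {s. (\<exists>a b. a \<noteq> b \<and> s = closed_segment a b) \<and> s \<subseteq> skeleton W \<and>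
     (\<forall>c d. s \<subseteq> closed_segment c d \<and> closed_segment c d \<subseteq> skeleton W
        \<longrightarrow> closed_segment c d = s)}"

text \<open>
  The last clause is the T-junction condition: exactly one maximal segment passes straight through
  a tile vertex that is not a corner of \<open>R\<close>; every other segment through that vertex ends there.
  Several segments may end at the same vertex.
\<close>

definition tiling :: "plane set \<Rightarrow> plane set set \<Rightarrow> bool" where
  "tiling R W \<longleftrightarrow>
     convex_polygon R \<and> finite W \<and> (\<forall>w\<in>W. convex_polygon w) \<and> \<Union>W = R \<and>
     pairwise (\<lambda>v w. interior v \<inter> interior w = {}) W \<and>
     (\<forall>w\<in>W. \<forall>v. v extreme_point_of w \<and> \<not> v extreme_point_of R
        \<longrightarrow> (\<exists>!s. s \<in> segments W \<and> v \<in> rel_interior s))"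

definition boundary_segments :: "plane set \<Rightarrow> plane set set \<Rightarrow> plane set set" where
  "boundary_segments R W = {s \<in> segments W. s \<subseteq> frontier R}"

definition interior_segments :: "plane set \<Rightarrow> plane set set \<Rightarrow> plane set set" where
  "interior_segments R W = segments W - boundary_segments R W"


section \<open>The bipartite plane graph of a tiling\<close>

definition incident :: "plane set \<Rightarrow> plane set \<Rightarrow> bool" where
  "incident w s \<longleftrightarrow> (\<exists>e. e edge_of w \<and> e \<subseteq> s)"

definition graph_edges :: "plane set set \<Rightarrow> (plane set \<times> plane set) set" where
  "graph_edges W = {(w, s). w \<in> W \<and> s \<in> segments W \<and> incident w s}"

text \<open>
  \<open>ccw_edge w s p q\<close>: the edge of the tile \<open>w\<close> contained in \<open>s\<close> runs from \<open>p\<close> to \<open>q\<close> when the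
  boundary of \<open>w\<close> is traversed counterclockwise, so its edge vector is \<open>q - p\<close>.
\<close>

definition ccw_edge :: "plane set \<Rightarrow> plane set \<Rightarrow> plane \<Rightarrow> plane \<Rightarrow> bool" where
  "ccw_edge w s p q \<longleftrightarrow>
     closed_segment p q edge_of w \<and> closed_segment p q \<subseteq> s \<and>
     (\<forall>x\<in>w. 0 \<le> cross (q - p) (x - p))"

text \<open>
  The plane embedding is recorded by its rotation system. At a white vertex \<open>w\<close> the graph edges are
  ordered as the sides of the tile, counterclockwise (\<open>white_next\<close>). At a black vertex \<open>s\<close> they are
  ordered counterclockwise around the segment \<open>s\<close> (\<open>black_next\<close>), i.e. against the direction of the
  edge vectors: from the tile \<open>w\<close> whose side starts at \<open>p\<close> one proceeds to the tile on the same side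
  of \<open>s\<close> whose side ends at \<open>p\<close>; if \<open>p\<close> is an endpoint of \<open>s\<close>, one turns around it to the tile on the
  other side of \<open>s\<close>. There is no other side if \<open>s\<close> lies on the boundary of \<open>R\<close>: then one goes
  around \<open>s\<close> through the exterior of \<open>R\<close> to the tile at the opposite endpoint of \<open>s\<close>.
\<close>

definition white_next :: "plane set \<Rightarrow> plane set \<Rightarrow> plane set \<Rightarrow> bool" where
  "white_next w s t \<longleftrightarrow> (\<exists>p q r. ccw_edge w s p q \<and> ccw_edge w t q r)"

definition black_next ::
    "plane set \<Rightarrow> plane set set \<Rightarrow> plane set \<Rightarrow> plane set \<Rightarrow> plane set \<Rightarrow> bool" where
  "black_next R W s w w' \<longleftrightarrow>
     (\<exists>p q p' q'. ccw_edge w s p q \<and> ccw_edge w' s p' q' \<and>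
        (if p \<in> rel_interior s then q' = p \<and> 0 < (q - p) \<bullet> (q' - p')
         else if s \<in> boundary_segments R W then q' \<notin> rel_interior s
         else q' = p \<and> (q - p) \<bullet> (q' - p') < 0))"

text \<open>
  The faces are the orbits on graph edges of a white rotation followed by a black one. One such step
  passes two sides of graph edges on the facial walk, hence the factor 2 in the degree.
  The unbounded face is the one containing the turns through the exterior of \<open>R\<close>; such a turn
  arrives at a tile whose side in a boundary segment \<open>s\<close> ends at an endpoint of \<open>s\<close>.
\<close>

definition face_step ::
    "plane set \<Rightarrow> plane set set \<Rightarrow> ((plane set \<times> plane set) \<times> (plane set \<times> plane set)) set" where
  "face_step R W =
     {((w, s), (w', t)). (w, s) \<in> graph_edges W \<and> (w', t) \<in> graph_edges W \<and>
        white_next w s t \<and> black_next R W t w w'}"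

definition faces :: "plane set \<Rightarrow> plane set set \<Rightarrow> (plane set \<times> plane set) set set" where
  "faces R W = {(face_step R W)\<^sup>* `` {e} | e. e \<in> graph_edges W}"

definition bounded_faces :: "plane set \<Rightarrow> plane set set \<Rightarrow> (plane set \<times> plane set) set set" where
  "bounded_faces R W =
     {F \<in> faces R W. \<not> (\<exists>(w, s)\<in>F. s \<in> boundary_segments R W \<and>
        (\<exists>p q. ccw_edge w s p q \<and> q \<notin> rel_interior s))}"

definition face_degree :: "(plane set \<times> plane set) set \<Rightarrow> nat" where
  "face_degree F = 2 * card F"


section \<open>Tilings equivalent to a given one, with one boundary edge free\<close>

definition graph_iso ::
    "plane set \<Rightarrow> plane set set \<Rightarrow> plane set \<Rightarrow> plane set set \<Rightarrow>
     (plane set \<Rightarrow> plane set) \<Rightarrow> (plane set \<Rightarrow> plane set) \<Rightarrow> bool" where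
  "graph_iso R W R' W' f g \<longleftrightarrow>
     bij_betw f W W' \<and> bij_betw g (segments W) (segments W') \<and>
     g ` boundary_segments R W = boundary_segments R' W' \<and>
     (\<forall>w\<in>W. \<forall>s\<in>segments W. incident w s \<longleftrightarrow> incident (f w) (g s))"

text \<open>
  The tiles \<open>f w\<close> and segments \<open>g s\<close> of a tiling of \<open>R'\<close> correspond to \<open>w\<close> and \<open>s\<close>. Boundary vertices
  are identified with the sides of the polygon; the last clause fixes the lines of all sides of the
  polygon except that of \<open>b0\<close>, which (by the clause before) may only move parallel to itself.
\<close>

definition equivalent_tiling ::
    "plane set \<Rightarrow> plane set set \<Rightarrow> plane set \<Rightarrow> plane set \<Rightarrow> plane set set \<Rightarrow>
     (plane set \<Rightarrow> plane set) \<Rightarrow> (plane set \<Rightarrow> plane set) \<Rightarrow> bool" where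
  "equivalent_tiling R W b0 R' W' f g \<longleftrightarrow>
     tiling R' W' \<and> graph_iso R W R' W' f g \<and>
     (\<forall>s\<in>segments W. affine_parallel (affine hull s) (affine hull (g s))) \<and>
     (\<forall>s\<in>boundary_segments R W - {b0}. affine hull (g s) = affine hull s)"

text \<open>
  A sign convention for the intercepts is a choice of unit normal for each segment of the original
  tiling; the corresponding (parallel) segment of another tiling uses the same normal.
\<close>

definition unit_normals :: "plane set set \<Rightarrow> (plane set \<Rightarrow> plane) \<Rightarrow> bool" where
  "unit_normals W \<nu> \<longleftrightarrow>
     (\<forall>s\<in>segments W. norm (\<nu> s) = 1 \<and> (\<forall>x\<in>s. \<forall>y\<in>s. \<nu> s \<bullet> (x - y) = 0))"

definition intercept :: "plane \<Rightarrow> plane set \<Rightarrow> real" where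
  "intercept n s = (THE c. \<forall>x\<in>s. n \<bullet> x = c)"

definition tile_orientation ::
    "plane set set \<Rightarrow> (plane set \<Rightarrow> plane set) \<Rightarrow> plane set \<Rightarrow> plane set \<Rightarrow> real \<Rightarrow> bool" where
  "tile_orientation W g w w' \<epsilon> \<longleftrightarrow>
     (\<forall>s\<in>segments W. \<forall>p q p' q'. ccw_edge w s p q \<and> ccw_edge w' (g s) p' q'
        \<longrightarrow> (\<exists>a>0. q' - p' = (\<epsilon> * a) *\<^sub>R (q - p)))"

text \<open>
  \<open>\<beta>\<close> and \<open>\<tau>\<close> enumerate the free segments and the tiles by finite index types, so that intercept
  vectors live in \<open>real^'b\<close> and area vectors in \<open>real^'w\<close>.
\<close>

definition has_intercepts ::
    "(plane set \<Rightarrow> plane) \<Rightarrow> ('b \<Rightarrow> plane set) \<Rightarrow> (plane set \<Rightarrow> plane set) \<Rightarrow> real^'b \<Rightarrow> bool" where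
  "has_intercepts \<nu> \<beta> g x \<longleftrightarrow> (\<forall>j. x $ j = intercept (\<nu> (\<beta> j)) (g (\<beta> j)))"

definition tiling_space ::
    "plane set \<Rightarrow> plane set set \<Rightarrow> plane set \<Rightarrow> (plane set \<Rightarrow> plane) \<Rightarrow>
     ('b \<Rightarrow> plane set) \<Rightarrow> (real^'b) set" where
  "tiling_space R W b0 \<nu> \<beta> =
     {x. \<exists>R' W' f g. equivalent_tiling R W b0 R' W' f g \<and> has_intercepts \<nu> \<beta> g x}"

definition oriented_tiling_space ::
    "plane set \<Rightarrow> plane set set \<Rightarrow> plane set \<Rightarrow> (plane set \<Rightarrow> plane) \<Rightarrow>
     ('b \<Rightarrow> plane set) \<Rightarrow> ('w \<Rightarrow> plane set) \<Rightarrow> ('w \<Rightarrow> real) \<Rightarrow> (real^'b) set" where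
  "oriented_tiling_space R W b0 \<nu> \<beta> \<tau> \<sigma> =
     {x \<in> tiling_space R W b0 \<nu> \<beta>.
        \<exists>R' W' f g. equivalent_tiling R W b0 R' W' f g \<and> has_intercepts \<nu> \<beta> g x \<and>
          (\<forall>k. tile_orientation W g (\<tau> k) (f (\<tau> k)) (\<sigma> k))}"

text \<open>
  A tile is determined by the lines containing its sides, so the choice below does not depend on the
  equivalent tiling; the value is meaningful on \<open>tiling_space R W b0 \<nu> \<beta>\<close>.
\<close>

definition area_map ::
    "plane set \<Rightarrow> plane set set \<Rightarrow> plane set \<Rightarrow> (plane set \<Rightarrow> plane) \<Rightarrow>
     ('b \<Rightarrow> plane set) \<Rightarrow> ('w \<Rightarrow> plane set) \<Rightarrow> real^'b \<Rightarrow> real^'w" where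
  "area_map R W b0 \<nu> \<beta> \<tau> x =
     (SOME A. \<exists>R' W' f g. equivalent_tiling R W b0 R' W' f g \<and> has_intercepts \<nu> \<beta> g x \<and>
        A = (\<chi> k. measure lebesgue (f (\<tau> k))))"


section \<open>Smooth maps and diffeomorphisms between subsets of normed spaces\<close>

primrec times_differentiable_on ::
    "nat \<Rightarrow> ('a::real_normed_vector \<Rightarrow> 'b::real_normed_vector) \<Rightarrow> 'a set \<Rightarrow> bool" where
  "times_differentiable_on 0 f U \<longleftrightarrow> continuous_on U f"
| "times_differentiable_on (Suc k) f U \<longleftrightarrow>
     (\<forall>x\<in>U. f differentiable (at x)) \<and>
     (\<forall>v. times_differentiable_on k (\<lambda>x. frechet_derivative f (at x) v) U)"

text \<open>
  A map on an arbitrary subset is smooth if near every point it agrees with a \<open>C\<^sup>\<infinity>\<close> map defined on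
  an open neighbourhood.
\<close>

definition smooth_map_on ::
    "'a::real_normed_vector set \<Rightarrow> ('a \<Rightarrow> 'b::real_normed_vector) \<Rightarrow> bool" where
  "smooth_map_on S f \<longleftrightarrow>
     (\<forall>x\<in>S. \<exists>U h. open U \<and> x \<in> U \<and> (\<forall>k. times_differentiable_on k h U) \<and>
        (\<forall>y\<in>S \<inter> U. h y = f y))"

definition diffeomorphism_onto_image ::
    "'a::real_normed_vector set \<Rightarrow> ('a \<Rightarrow> 'b::real_normed_vector) \<Rightarrow> bool" where
  "diffeomorphism_onto_image S f \<longleftrightarrow>
     inj_on f S \<and> smooth_map_on S f \<and> smooth_map_on (f ` S) (inv_into S f)"

end

theory Submission imports Defs begin

text \<open>
  With the edge directions fixed, the vertices of a tile are affine in the intercepts, so the areas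
  form a quadratic map \<open>A\<close>, and \<open>A x - A y = DA m (x - y)\<close> for the midpoint \<open>m\<close> of \<open>x\<close> and \<open>y\<close>. The ratio of an
  edge of the deformed tile to the original edge is affine in the intercepts as well, so the sign
  conditions given by \<open>\<sigma>\<close> cut out an open convex set, and it suffices that \<open>DA\<close> is invertible there.

  The entry of \<open>DA\<close> for a tile and a segment is, up to sign, the length of the corresponding edge.
  For \<open>v\<close> in the kernel, the sum of edge length times outward displacement therefore vanishes for every
  tile, with all edge lengths of a tile counted with the same sign. So the displacements of a
  tile, unless all zero, change sign at two or more corners, whereas for a generic linear functional
  only two corners of a tile are extremal. At a T-junction exactly one of the two corners is
  extremal, and at most one shows a sign change. Summing over all corners leaves no room for \<open>v \<noteq> 0\<close>,
  because at the lowest corner adjacent to a nonzero displacement every angle is extremal but not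
  every one shows a change. Charging each tile to the segment that ends at its highest corner shows
  that there are at most as many tiles as free intercepts, so \<open>DA\<close> is invertible. The inverse map
  is smooth by Cramer's rule.
\<close>

section \<open>Smooth maps\<close>

text \<open>Two obstacles shape the argument. An equivalent tiling is known only through incidences
  and lines, so neither the cyclic order of the sides of a deformed tile nor the cell of the line
  arrangement that it fills is given. For a tile whose edge vectors are all rescaled with one sign,
  the order is recovered from directions alone: the next side is the one whose direction comes next.
  The choice in \<open>area_map\<close> admits further tilings with the same intercepts; for these,
  a bounded convex cell is shown to be determined by the set of lines that carry its sides. The
  count of sign changes breaks down at the corners of \<open>R\<close>, where no T-junction pairs
  the corners of the tiles. There at most one tile has a non-extremal corner, and turning clockwise
  from tile to tile reaches a corner without sign change unless the turn ends on the free edge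
  \<open>b0\<close> at its start \<open>v0\<close>. The generic functional is therefore chosen with
  its maximum over \<open>R\<close> at \<open>v0\<close>: all tile corners there are extremal and
  need no counterpart.\<close>

lemma times_differentiable_on_SucI:
  fixes f :: "'a::real_normed_vector \<Rightarrow> 'b::real_normed_vector"
  assumes "open U" "\<And>x. x \<in> U \<Longrightarrow> (f has_derivative f' x) (at x)"
    and "\<And>v. times_differentiable_on k (\<lambda>x. f' x v) U"
    and cong: "\<And>(g::'a \<Rightarrow> 'b) h.
      (\<And>x. x \<in> U \<Longrightarrow> g x = h x) \<Longrightarrow> times_differentiable_on k g U \<Longrightarrow> times_differentiable_on k h U"
  shows "times_differentiable_on (Suc k) f U"
proof -
  have "frechet_derivative f (at x) = f' x" if "x \<in> U" for x
    using assms(2)[OF that] by (metis frechet_derivative_at)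
  then have "times_differentiable_on k (\<lambda>x. frechet_derivative f (at x) v) U" for v
    by (intro cong[of "\<lambda>x. f' x v" "\<lambda>x. frechet_derivative f (at x) v"] assms(3)) simp_all
  then show ?thesis using assms(2) by (auto simp: differentiable_def)
qed

text \<open>An induction that passes to the derivatives one level down. The preceding introduction
  rule takes congruence at level \<open>k\<close> as a premise so that it can serve in this
  induction, where only the induction hypothesis is at hand.\<close>

lemma times_differentiable_on_cong:
  assumes "open U" "\<And>x. x \<in> U \<Longrightarrow> f x = g x" "times_differentiable_on k f U"
  shows "times_differentiable_on k g U"
  using assms(2,3)
proof (induction k arbitrary: f g)
  case 0
  then show ?case using continuous_on_cong[of U U f g] by auto
next
  case (Suc k)
  have "(g has_derivative frechet_derivative f (at x)) (at x)" if "x \<in> U" for x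
  proof -
    have "(f has_derivative frechet_derivative f (at x)) (at x)"
      using Suc.prems(2) that frechet_derivative_works by auto
    then show ?thesis
      by (rule has_derivative_transform_within_open[OF _ assms(1) that]) (rule Suc.prems(1))
  qed
  then show ?case
    using Suc.prems(2) by (intro times_differentiable_on_SucI[OF assms(1) _ _ Suc.IH]) auto
qed

lemma times_differentiable_on_Suc:
  assumes "open U" "\<And>x. x \<in> U \<Longrightarrow> (f has_derivative f' x) (at x)"
    and "\<And>v. times_differentiable_on k (\<lambda>x. f' x v) U"
  shows "times_differentiable_on (Suc k) f U"
  using times_differentiable_on_SucI[OF assms times_differentiable_on_cong[OF assms(1)]] .

lemma times_differentiable_on_SucD:
  "times_differentiable_on (Suc k) f U \<Longrightarrow> times_differentiable_on k f U"
proof (induction k arbitrary: f)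
  case 0
  then show ?case
    by (auto intro!: continuous_at_imp_continuous_on differentiable_imp_continuous_within)
qed (metis times_differentiable_on.simps(2))

lemma times_differentiable_on_has_derivative:
  "times_differentiable_on (Suc k) f U \<Longrightarrow> x \<in> U \<Longrightarrow>
    (f has_derivative frechet_derivative f (at x)) (at x)"
  by (simp add: frechet_derivative_works[symmetric])

lemma times_differentiable_on_const: "open U \<Longrightarrow> times_differentiable_on k (\<lambda>x. c) U"
proof (induction k arbitrary: c)
  case (Suc k)
  show ?case
    by (rule times_differentiable_on_Suc[where f' = "\<lambda>x v. 0"]) (use Suc in auto)
qed auto

lemma times_differentiable_on_bounded_linear:
  assumes "bounded_linear L" "open U" "times_differentiable_on k f U"
  shows "times_differentiable_on k (\<lambda>x. L (f x)) U"
  using assms(3)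
proof (induction k arbitrary: f)
  case 0
  then show ?case using bounded_linear.continuous_on[OF assms(1)] by auto
next
  case (Suc k)
  show ?case
  proof (rule times_differentiable_on_Suc[where f' = "\<lambda>x v. L (frechet_derivative f (at x) v)"])
    show "((\<lambda>x. L (f x)) has_derivative (\<lambda>v. L (frechet_derivative f (at x) v))) (at x)"
      if "x \<in> U" for x
      using Suc.prems that
      by (intro bounded_linear.has_derivative[OF assms(1)] times_differentiable_on_has_derivative)
  qed (use Suc assms in auto)
qed

lemma times_differentiable_on_id: "open U \<Longrightarrow> times_differentiable_on k (\<lambda>x. x) U"
  by (cases k) (auto intro!: times_differentiable_on_Suc[where f' = "\<lambda>x v. v"]
      times_differentiable_on_const continuous_on_id)

lemma times_differentiable_on_add:
  assumes "open U" "times_differentiable_on k f U" "times_differentiable_on k g U"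
  shows "times_differentiable_on k (\<lambda>x. f x + g x) U"
  using assms(2,3)
proof (induction k arbitrary: f g)
  case 0
  then show ?case by (auto intro: continuous_on_add)
next
  case (Suc k)
  show ?case
  proof (rule times_differentiable_on_Suc[where f' = "\<lambda>x v. frechet_derivative f (at x) v
        + frechet_derivative g (at x) v"])
    show "((\<lambda>x. f x + g x) has_derivative (\<lambda>v. frechet_derivative f (at x) v
        + frechet_derivative g (at x) v)) (at x)" if "x \<in> U" for x
      using Suc.prems that by (intro has_derivative_add times_differentiable_on_has_derivative)
  qed (use Suc assms in auto)
qed

lemma times_differentiable_on_bilinear:
  assumes "bounded_bilinear B" "open U" "times_differentiable_on k f U" "times_differentiable_on k g U"
  shows "times_differentiable_on k (\<lambda>x. B (f x) (g x)) U"
  using assms(3,4)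
proof (induction k arbitrary: f g)
  case 0
  then show ?case using bounded_bilinear.continuous_on[OF assms(1)] by auto
next
  case (Suc k)
  show ?case
  proof (rule times_differentiable_on_Suc[where f' = "\<lambda>x v. B (f x) (frechet_derivative g (at x) v)
        + B (frechet_derivative f (at x) v) (g x)"])
    show "((\<lambda>x. B (f x) (g x)) has_derivative (\<lambda>v. B (f x) (frechet_derivative g (at x) v)
        + B (frechet_derivative f (at x) v) (g x))) (at x)" if "x \<in> U" for x
      using Suc.prems that
      by (intro bounded_bilinear.FDERIV[OF assms(1)] times_differentiable_on_has_derivative)
    show "times_differentiable_on k (\<lambda>x. B (f x) (frechet_derivative g (at x) v)
        + B (frechet_derivative f (at x) v) (g x)) U" for v
      using Suc.prems times_differentiable_on_SucD[of k f U] times_differentiable_on_SucD[of k g U]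
      by (intro times_differentiable_on_add Suc.IH assms) auto
  qed (use assms in auto)
qed

lemmas times_differentiable_on_mult =
  times_differentiable_on_bilinear[OF bounded_bilinear_mult]

lemma times_differentiable_on_sum:
  assumes "open U" "\<And>i. i \<in> I \<Longrightarrow> times_differentiable_on k (f i) U"
  shows "times_differentiable_on k (\<lambda>x. \<Sum>i\<in>I. f i x) U"
  using assms(2)
proof (induction I rule: infinite_finite_induct)
  case (insert i I)
  then show ?case by (simp add: times_differentiable_on_add assms(1))
qed (simp_all add: times_differentiable_on_const assms(1))

lemma times_differentiable_on_prod:
  fixes f :: "'i \<Rightarrow> 'a::real_normed_vector \<Rightarrow> 'b::{real_normed_algebra_1, comm_monoid_mult}"
  assumes "open U" "\<And>i. i \<in> I \<Longrightarrow> times_differentiable_on k (f i) U"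
  shows "times_differentiable_on k (\<lambda>x. \<Prod>i\<in>I. f i x) U"
  using assms(2)
proof (induction I rule: infinite_finite_induct)
  case (insert i I)
  then show ?case by (simp add: times_differentiable_on_mult assms(1))
qed (simp_all add: times_differentiable_on_const assms(1))

text \<open>The derivative of the reciprocal contains the reciprocal itself, so the induction
  hypothesis at level \<open>k\<close> supplies the factors \<open>inverse (f x)\<close> of the
  derivative.\<close>

lemma times_differentiable_on_inverse:
  fixes f :: "'a::real_normed_vector \<Rightarrow> real"
  assumes "open U" "\<And>x. x \<in> U \<Longrightarrow> f x \<noteq> 0" "times_differentiable_on k f U"
  shows "times_differentiable_on k (\<lambda>x. inverse (f x)) U"
  using assms(3)
proof (induction k)
  case 0
  then show ?case using assms(2) by (auto intro: continuous_on_inverse)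
next
  case (Suc k)
  show ?case
  proof (rule times_differentiable_on_Suc[where
        f' = "\<lambda>x v. (-1) * (inverse (f x) * (frechet_derivative f (at x) v * inverse (f x)))"])
    show "((\<lambda>x. inverse (f x)) has_derivative
        (\<lambda>v. (-1) * (inverse (f x) * (frechet_derivative f (at x) v * inverse (f x))))) (at x)"
      if "x \<in> U" for x
      using Deriv.has_derivative_inverse[of f x, OF assms(2)[OF that]
          times_differentiable_on_has_derivative[OF Suc.prems that]]
      by (simp add: mult.assoc)
    show "times_differentiable_on k
        (\<lambda>x. (-1) * (inverse (f x) * (frechet_derivative f (at x) v * inverse (f x)))) U" for v
      using Suc times_differentiable_on_SucD[of k f U]
      by (intro times_differentiable_on_mult times_differentiable_on_const assms) auto
  qed (use assms in auto)
qed

lemma times_differentiable_on_vec: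
  fixes f :: "'a::real_normed_vector \<Rightarrow> real^'n"
  assumes "open U" "\<And>i. times_differentiable_on k (\<lambda>x. f x $ i) U"
  shows "times_differentiable_on k f U"
proof -
  have "times_differentiable_on k (\<lambda>x. \<Sum>i\<in>UNIV. (f x $ i) *\<^sub>R axis i 1) U"
    by (intro times_differentiable_on_sum assms(1)
        times_differentiable_on_bilinear[OF bounded_bilinear_scaleR] assms(2)
        times_differentiable_on_const)
  moreover have "(\<Sum>i\<in>UNIV. (f x $ i) *\<^sub>R (axis i 1 :: real^'n)) = f x" for x
    by (simp add: vec_eq_iff axis_def if_distrib cong: if_cong)
  ultimately show ?thesis by (rule times_differentiable_on_cong[OF assms(1), rotated])
qed

lemma times_differentiable_on_det:
  fixes A :: "'a::real_normed_vector \<Rightarrow> real^'n^'n"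
  assumes "open U" "\<And>i j. times_differentiable_on k (\<lambda>x. A x $ i $ j) U"
  shows "times_differentiable_on k (\<lambda>x. det (A x)) U"
  unfolding det_def
  by (intro times_differentiable_on_sum times_differentiable_on_mult times_differentiable_on_prod
      times_differentiable_on_const assms)

text \<open>The set \<open>T\<close> may have any shape; smoothness of the inverse on its image
  comes from the inverse on the open image of \<open>S\<close>. A derivative with trivial kernel
  gives one inequality between the dimensions and \<open>card_le\<close> the other, so invariance of
  domain applies and the derivative is bijective.\<close>

lemma quadratic_map_diffeomorphism_onto_image:
  fixes l :: "real^'b::finite \<Rightarrow> real^'w::finite" and B :: "real^'b \<Rightarrow> real^'b \<Rightarrow> real^'w"
  assumes l: "bounded_linear l" and B: "bounded_bilinear B" and sym: "\<And>x y. B x y = B y x"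
    and F: "\<And>x. F x = c + l x + B x x"
    and S: "open S" "convex S"
    and regular: "\<And>x v. x \<in> S \<Longrightarrow> l v + 2 *\<^sub>R B x v = 0 \<Longrightarrow> v = 0"
    and card_le: "CARD('w) \<le> CARD('b)"
    and T: "T \<subseteq> S" "\<And>x. x \<in> T \<Longrightarrow> f x = F x"
  shows "diffeomorphism_onto_image T f"
proof (cases "S = {}")
  case True
  then show ?thesis
    using T(1) by (simp add: diffeomorphism_onto_image_def smooth_map_on_def)
next
  case False
  interpret l: bounded_linear l by fact
  interpret B: bounded_bilinear B by fact
  define D where "D x v = l v + 2 *\<^sub>R B x v" for x v
  have linD: "bounded_linear (D x)" for x
    unfolding D_def
    by (intro bounded_linear_add l bounded_linear_const_scaleR B.bounded_linear_right)
  have injD: "inj (D x)" if "x \<in> S" for x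
    using regular[OF that] linD[of x] linear_inj_iff_eq_0[of "D x"]
    by (auto simp: D_def bounded_linear.linear)
  obtain x0 where "x0 \<in> S" using False by blast
  have "dim (range (D x0)) = dim (UNIV :: (real^'b) set)"
    using injD[OF \<open>x0 \<in> S\<close>] by (intro dim_image_eq bounded_linear.linear[OF linD]) auto
  then have card: "CARD('w) = CARD('b)"
    using dim_subset_UNIV[of "range (D x0)"] card_le by simp
  have injF: "inj_on F S"
  proof (rule inj_onI)
    fix x y assume xy: "x \<in> S" "y \<in> S" "F x = F y"
    \<comment> \<open>The mixed terms \<open>B x y\<close> and \<open>B y x\<close> cancel by
      symmetry, which makes the midpoint formula exact.\<close>
    have "D ((1/2) *\<^sub>R x + (1/2) *\<^sub>R y) (x - y) = F x - F y"
      using sym[of x y]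
      by (simp add: D_def F l.diff B.add_left B.add_right B.diff_right B.scaleR_left
          scaleR_add_right scaleR_diff_right)
    moreover have "(1/2) *\<^sub>R x + (1/2) *\<^sub>R y \<in> S"
      using xy S(2) by (intro convexD) auto
    ultimately show "x = y" using regular xy(3) by (force simp: D_def)
  qed
  have derF: "(F has_derivative D x) (at x)" for x
  proof -
    have "((\<lambda>x. c + l x + B x x) has_derivative (\<lambda>v. 0 + l v + (B x v + B v x))) (at x)"
      by (intro has_derivative_add has_derivative_const B.FDERIV has_derivative_ident
          l.has_derivative)
    also have "(\<lambda>v. 0 + l v + (B x v + B v x)) = D x"
      using sym by (auto simp: D_def scaleR_2)
    finally show ?thesis using F by presburger
  qed
  have smoothF: "times_differentiable_on k F UNIV" for k
  proof -
    have "times_differentiable_on k (\<lambda>x. c + l x + B x x) UNIV"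
      by (intro times_differentiable_on_add times_differentiable_on_const open_UNIV
          times_differentiable_on_bounded_linear[OF l] times_differentiable_on_bilinear[OF B]
          times_differentiable_on_id)
    then show ?thesis using F by presburger
  qed
  have contF: "continuous_on S F"
    using smoothF[of 0] continuous_on_subset by auto
  define V where "V = F ` S"
  define g where "g = inv_into S F"
  have gF: "g (F x) = x" if "x \<in> S" for x using injF that by (simp add: g_def)
  have dim: "DIM(real^'w) \<le> DIM(real^'b)" using card by simp
  have openV: "open V"
    unfolding V_def by (rule invariance_of_domain_gen[OF S(1) contF injF dim])
  have contg: "continuous_on V g"
    unfolding V_def by (rule continuous_on_inverse_open[OF S(1) contF dim gF])
  have g: "g y \<in> S" "F (g y) = y" if "y \<in> V" for y
    using that gF by (auto simp: V_def)
  have "\<exists>G. linear G \<and> G \<circ> D (g y) = id" if "y \<in> V" for y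
    using linear_injective_left_inverse[OF bounded_linear.linear[OF linD] injD[OF g(1)[OF that]]] .
  then obtain G where linG: "\<And>y. y \<in> V \<Longrightarrow> linear (G y)"
    and GD: "\<And>y. y \<in> V \<Longrightarrow> G y \<circ> D (g y) = id" by metis
  have derg: "(g has_derivative G y) (at y)" if "y \<in> V" for y
    using that openV contg
    by (intro has_derivative_inverse_basic[where f = F and f' = "D (g y)" and T = V])
      (auto simp: g linear_conv_bounded_linear[symmetric] linG GD derF continuous_on_eq_continuous_at)
  \<comment> \<open>So far \<open>G y\<close> is only a left inverse of the derivative;
    differentiating \<open>F (g y) = y\<close> shows that it is a right inverse too.\<close>
  have DG: "D (g y) (G y v) = v" if "y \<in> V" for y v
  proof -
    have "(F \<circ> g has_derivative D (g y) \<circ> G y) (at y)"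
      using diff_chain_at[OF derg[OF that] derF] .
    then have "((\<lambda>z. z) has_derivative D (g y) \<circ> G y) (at y)"
      by (rule has_derivative_transform_within_open[OF _ openV that]) (auto simp: g)
    then have "D (g y) \<circ> G y = (\<lambda>v. v)"
      using has_derivative_unique[OF _ has_derivative_ident] by blast
    then show ?thesis by (metis comp_apply)
  qed
  obtain e :: "'b \<Rightarrow> 'w" where e: "bij e"
    using card by (metis finite_class.finite_UNIV finite_same_card_bij)
  \<comment> \<open>The two index types have equal size but are different; the bijection
    \<open>e\<close> relabels the rows to give a square matrix, for which Cramer's rule is
    available.\<close>
  define A :: "real^'w \<Rightarrow> real^'b^'b" where "A y = (\<chi> i j. D (g y) (axis j 1) $ e i)" for y
  have A: "A y *v x = (\<chi> i. D (g y) x $ e i)" for x y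
  proof -
    have "D (g y) x = D (g y) (\<Sum>j\<in>UNIV. x $ j *\<^sub>R axis j 1)"
      using basis_expansion[of x] by (simp add: scalar_mult_eq_scaleR)
    also have "\<dots> = (\<Sum>j\<in>UNIV. x $ j *\<^sub>R D (g y) (axis j 1))"
      by (simp add: linear_sum[OF bounded_linear.linear[OF linD]]
          linear_scale[OF bounded_linear.linear[OF linD]])
    finally show ?thesis
      by (simp add: A_def matrix_vector_mult_def vec_eq_iff mult.commute)
  qed
  have detA: "det (A y) \<noteq> 0" if "y \<in> V" for y
  proof -
    have "x = 0" if "A y *v x = 0" for x
    proof -
      have "D (g y) x = 0"
        using that e unfolding A by (metis (no_types, lifting) bij_pointE vec_eq_iff vec_lambda_beta zero_index)
      then show ?thesis using regular g(1)[OF \<open>y \<in> V\<close>] by (auto simp: D_def)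
    qed
    then show ?thesis
      by (simp add: invertible_det_nz[symmetric] invertible_left_inverse matrix_left_invertible_ker)
  qed
  have G: "G y v = (\<chi> k. det (\<chi> i j. if j = k then v $ e i else A y $ i $ j) * inverse (det (A y)))"
    if "y \<in> V" for y v
  proof -
    have "A y *v G y v = (\<chi> i. v $ e i)" by (simp add: A DG that)
    then show ?thesis by (simp add: cramer[OF detA[OF that]] divide_inverse cong: if_cong)
  qed
  \<comment> \<open>Bootstrapping: the entries of \<open>A y\<close> depend on \<open>y\<close> only
    through \<open>g\<close>, and affinely. If \<open>g\<close> is differentiable \<open>k\<close>
    times, so is its derivative \<open>G\<close> by Cramer's rule, and \<open>g\<close> gains one
    order.\<close>
  have smoothg: "times_differentiable_on k g V" for k
  proof (induction k)
    case 0
    then show ?case using contg by simp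
  next
    case (Suc k)
    have smoothA: "times_differentiable_on k (\<lambda>y. A y $ i $ j) V" for i j
    proof -
      have "bounded_linear (\<lambda>a. B a (axis j 1) $ e i)"
        by (rule bounded_linear_compose[OF bounded_linear_vec_nth B.bounded_linear_left])
      then have "times_differentiable_on k (\<lambda>y. l (axis j 1) $ e i + 2 * B (g y) (axis j 1) $ e i) V"
        by (intro times_differentiable_on_add openV times_differentiable_on_const
            times_differentiable_on_mult times_differentiable_on_bounded_linear[OF _ openV Suc.IH])
      then show ?thesis by (simp add: A_def D_def)
    qed
    have entry: "times_differentiable_on k (\<lambda>y. if b then z else A y $ i $ j) V" for b z i j
      by (cases b) (simp_all add: smoothA times_differentiable_on_const openV)
    have "times_differentiable_on k (\<lambda>y. det (\<chi> i j. if j = n then v $ e i else A y $ i $ j)) V"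
      for n v
      by (rule times_differentiable_on_det[OF openV]) (simp add: entry)
    moreover have "times_differentiable_on k (\<lambda>y. inverse (det (A y))) V"
      by (rule times_differentiable_on_inverse[OF openV detA])
        (simp_all add: times_differentiable_on_det[OF openV smoothA])
    ultimately have "times_differentiable_on k (\<lambda>y. \<chi> n. det (\<chi> i j. if j = n then v $ e i
        else A y $ i $ j) * inverse (det (A y))) V" for v
      by (intro times_differentiable_on_vec[OF openV])
        (simp add: times_differentiable_on_mult[OF openV])
    then have "times_differentiable_on k (\<lambda>y. G y v) V" for v
      by (rule times_differentiable_on_cong[OF openV, rotated]) (rule G[symmetric])
    then show ?case
      using openV derg by (intro times_differentiable_on_Suc[where f' = G and f = g])
  qed
  have imT: "f ` T \<subseteq> V" using T by (auto simp: V_def)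
  have injf: "inj_on f T"
    using injF T by (auto simp: inj_on_def subset_iff)
  have "smooth_map_on T f"
    unfolding smooth_map_on_def
    by (intro ballI exI[of _ UNIV] exI[of _ F]) (auto simp: smoothF T(2))
  moreover have inv: "g y = inv_into T f y" if "y \<in> f ` T" for y
  proof -
    from that obtain x where "x \<in> T" "y = f x" by (rule imageE)
    then show ?thesis using T gF[of x] inv_into_f_f[OF injf, of x] by auto
  qed
  have "smooth_map_on (f ` T) (inv_into T f)"
    unfolding smooth_map_on_def using imT
    by (intro ballI exI[of _ V] exI[of _ g]) (auto simp: smoothg openV inv)
  ultimately show ?thesis using injf by (simp add: diffeomorphism_onto_image_def)
qed

section \<open>Convex polygons\<close>

lemma bounded_bilinear_cross: "bounded_bilinear cross"
proof
  fix a a' b b' :: plane and r :: real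
  show "cross (a + a') b = cross a b + cross a' b" "cross a (b + b') = cross a b + cross a b'"
    "cross (r *\<^sub>R a) b = r *\<^sub>R cross a b" "cross a (r *\<^sub>R b) = r *\<^sub>R cross a b"
    by (simp_all add: cross_def algebra_simps)
  have "norm (cross a b) \<le> norm a * norm b * 2" for a b :: plane
  proof -
    have "\<bar>a $ 1 * b $ 2\<bar> \<le> norm a * norm b" "\<bar>a $ 2 * b $ 1\<bar> \<le> norm a * norm b"
      by (simp_all add: abs_mult mult_mono component_le_norm_cart)
    then show ?thesis by (simp add: cross_def)
  qed
  then show "\<exists>K. \<forall>a b. norm (cross a b) \<le> norm a * norm b * K" by blast
qed

lemmas cross_simps =
  bounded_bilinear.add_left[OF bounded_bilinear_cross]
  bounded_bilinear.add_right[OF bounded_bilinear_cross]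
  bounded_bilinear.diff_left[OF bounded_bilinear_cross]
  bounded_bilinear.diff_right[OF bounded_bilinear_cross]
  bounded_bilinear.minus_left[OF bounded_bilinear_cross]
  bounded_bilinear.minus_right[OF bounded_bilinear_cross]
  bounded_bilinear.scaleR_left[OF bounded_bilinear_cross]
  bounded_bilinear.scaleR_right[OF bounded_bilinear_cross]
  bounded_bilinear.zero_left[OF bounded_bilinear_cross]
  bounded_bilinear.zero_right[OF bounded_bilinear_cross]

lemmas continuous_on_cross[continuous_intros] =
  bounded_bilinear.continuous_on[OF bounded_bilinear_cross]

lemma cross_self[simp]: "cross x x = 0"
  by (simp add: cross_def)

lemma cross_commute: "cross x y = - cross y x"
  by (simp add: cross_def)

lemma cross_decompose:
  assumes "cross d1 d2 \<noteq> 0"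
  shows "x = (cross x d2 / cross d1 d2) *\<^sub>R d1 + (cross d1 x / cross d1 d2) *\<^sub>R d2"
proof -
  have "cross d1 d2 *\<^sub>R x = cross x d2 *\<^sub>R d1 + cross d1 x *\<^sub>R d2"
    by (simp add: vec_eq_iff forall_2 cross_def algebra_simps)
  then have "inverse (cross d1 d2) *\<^sub>R (cross d1 d2 *\<^sub>R x)
      = inverse (cross d1 d2) *\<^sub>R (cross x d2 *\<^sub>R d1 + cross d1 x *\<^sub>R d2)" by simp
  then show ?thesis using assms by (simp add: scaleR_add_right divide_inverse mult.commute)
qed

lemma cross_eq_0_parallel:
  assumes "d \<noteq> 0" "cross d x = 0"
  shows "x = ((x \<bullet> d) / (d \<bullet> d)) *\<^sub>R d"
proof -
  have "(d \<bullet> d) *\<^sub>R x = (x \<bullet> d) *\<^sub>R d"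
    using assms(2) by (simp add: vec_eq_iff forall_2 cross_def inner_vec_def sum_2) algebra
  then have "inverse (d \<bullet> d) *\<^sub>R ((d \<bullet> d) *\<^sub>R x) = inverse (d \<bullet> d) *\<^sub>R ((x \<bullet> d) *\<^sub>R d)" by simp
  then show ?thesis using assms by (simp add: divide_inverse mult.commute)
qed

lemma cross_eq_0_parallelE:
  assumes "d \<noteq> 0" "cross d x = 0"
  obtains c where "x = c *\<^sub>R d"
  using cross_eq_0_parallel[OF assms] by blast

lemma closed_segment_iff:
  fixes p q :: "'a::real_vector"
  shows "x \<in> closed_segment p q \<longleftrightarrow> (\<exists>u. 0 \<le> u \<and> u \<le> 1 \<and> x = p + u *\<^sub>R (q - p))"
  by (auto simp: closed_segment_def algebra_simps)

lemma open_segment_iff: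
  fixes p q :: "'a::real_vector"
  shows "x \<in> open_segment p q \<longleftrightarrow> p \<noteq> q \<and> (\<exists>u. 0 < u \<and> u < 1 \<and> x = p + u *\<^sub>R (q - p))"
  by (auto simp: in_segment algebra_simps)

lemma interior_push:
  fixes x m :: "'a::real_normed_vector"
  assumes "x \<in> interior S"
  shows "\<forall>\<^sub>F k in at_right 0. x + k *\<^sub>R m \<in> interior S"
proof -
  have "((\<lambda>k. x + k *\<^sub>R m) \<longlongrightarrow> x + 0 *\<^sub>R m) (at_right 0)"
    by (intro tendsto_intros)
  then show ?thesis
    using assms by (intro topological_tendstoD) auto
qed

section \<open>Oriented sides and half-planes of a convex polygon\<close>

definition side :: "plane set \<Rightarrow> plane \<Rightarrow> plane \<Rightarrow> bool" where
  "side P p q \<longleftrightarrow> closed_segment p q edge_of P \<and> (\<forall>x\<in>P. 0 \<le> cross (q - p) (x - p))"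

lemma ccw_edge_iff: "ccw_edge w s p q \<longleftrightarrow> side w p q \<and> closed_segment p q \<subseteq> s"
  by (auto simp: ccw_edge_def side_def)

context
  fixes P :: "plane set"
  assumes polygon: "convex_polygon P"
begin

lemma polygon_polyhedron: "polyhedron P"
  using polygon by (simp add: convex_polygon_def polytope_imp_polyhedron)

lemma polygon_compact: "compact P" and polygon_convex: "convex P" and polygon_closed: "closed P"
  using polygon
  by (simp_all add: convex_polygon_def polytope_imp_compact polytope_imp_convex polytope_imp_closed)

lemma polygon_interior: obtains c where "c \<in> interior P"
  using polygon by (auto simp: convex_polygon_def)

lemma polygon_aff_dim: "aff_dim P = 2"
  using aff_dim_nonempty_interior[of P] polygon by (simp add: convex_polygon_def)

lemma polygon_facet_iff: "e facet_of P \<longleftrightarrow> e edge_of P"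
  using polygon_aff_dim by (auto simp: facet_of_def edge_of_def)

lemma side_neq: "side P p q \<Longrightarrow> p \<noteq> q"
  by (auto simp: side_def edge_of_def)

lemma side_subset: "side P p q \<Longrightarrow> closed_segment p q \<subseteq> P"
  by (auto simp: side_def dest: edge_of_imp_subset)

lemma side_endpoints: "side P p q \<Longrightarrow> p \<in> P" "side P p q \<Longrightarrow> q \<in> P"
  using side_subset by auto

lemma side_face: "side P p q \<Longrightarrow> closed_segment p q face_of P"
  by (simp add: side_def edge_of_def)

text \<open>A functional supporting \<open>P\<close> along the edge vanishes on the edge direction
  \<open>d\<close> and is thus a multiple of \<open>cross d\<close>; the sign of the factor decides
  which orientation of the edge is counterclockwise.\<close>

lemma edge_side:
  assumes "e edge_of P"
  obtains p q where "e = closed_segment p q" "side P p q"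
proof -
  have f: "e face_of P" "aff_dim e = 1" using assms by (auto simp: edge_of_def)
  have "e \<noteq> {}" using f by auto
  moreover have "compact e" "convex e"
    using f face_of_imp_compact polygon_compact polygon_convex face_of_imp_convex by blast+
  moreover have "collinear e" using f by (simp add: collinear_aff_dim)
  ultimately obtain p q where e: "e = closed_segment p q"
    using compact_convex_collinear_segment by blast
  have pq: "p \<noteq> q" using f e by auto
  obtain a b where ab: "P \<subseteq> {x. a \<bullet> x \<le> b}" "e = P \<inter> {x. a \<bullet> x = b}"
    using f(1) unfolding exposed_face_of_polyhedron[OF polygon_polyhedron, symmetric]
    by (auto simp: exposed_face_of_def)
  have "a \<noteq> 0"
  proof
    assume "a = 0"
    then have "e = P" using ab \<open>e \<noteq> {}\<close> by auto
    then show False using f polygon_aff_dim by simp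
  qed
  have apq: "a \<bullet> p = b" "a \<bullet> q = b" using ab(2) e by auto
  define d where "d = q - p"
  have "d \<noteq> 0" "a \<bullet> d = 0" using pq apq by (auto simp: d_def inner_diff_right)
  have ak: "(d \<bullet> d) * (a \<bullet> y) = (a $ 2 * d $ 1 - a $ 1 * d $ 2) * cross d y" for y
    using \<open>a \<bullet> d = 0\<close> by (simp add: cross_def inner_vec_def sum_2) algebra
  let ?\<kappa> = "a $ 2 * d $ 1 - a $ 1 * d $ 2"
  have dd: "d \<bullet> d > 0" using \<open>d \<noteq> 0\<close> by simp
  have "?\<kappa> \<noteq> 0"
  proof
    assume "?\<kappa> = 0"
    then have "a \<bullet> a = 0" using ak[of a] dd by simp
    then show False using \<open>a \<noteq> 0\<close> by simp
  qed
  have le: "?\<kappa> * cross d (x - p) \<le> 0" if "x \<in> P" for x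
  proof -
    have "a \<bullet> (x - p) \<le> 0" using that ab(1) apq by (auto simp: inner_diff_right)
    then show ?thesis using ak[of "x - p"] dd by (metis mult_nonneg_nonpos less_eq_real_def)
  qed
  show thesis
  proof (cases "?\<kappa> < 0")
    case True
    then have "0 \<le> cross (q - p) (x - p)" if "x \<in> P" for x
      using le[OF that] by (simp add: d_def mult_le_0_iff)
    then have "side P p q" using assms unfolding side_def e by blast
    then show thesis using e by (intro that)
  next
    case False
    have "0 \<le> cross (p - q) (x - q)" if "x \<in> P" for x
    proof -
      have "cross (p - q) (x - q) = - cross d (x - p)"
        by (simp add: d_def cross_def algebra_simps)
      then show ?thesis using le[OF that] False \<open>?\<kappa> \<noteq> 0\<close> by (simp add: mult_le_0_iff)
    qed
    then have "side P q p" using assms unfolding side_def e closed_segment_commute[of q p] by blast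
    moreover have "e = closed_segment q p" unfolding e by (rule closed_segment_commute)
    ultimately show thesis by (intro that)
  qed
qed

lemma side_line:
  assumes "side P p q" "x \<in> P" "cross (q - p) (x - p) = 0"
  shows "x \<in> closed_segment p q"
proof -
  obtain a b where ab: "closed_segment p q = P \<inter> {x. a \<bullet> x = b}"
    using side_face[OF assms(1)]
    unfolding exposed_face_of_polyhedron[OF polygon_polyhedron, symmetric]
    by (auto simp: exposed_face_of_def)
  obtain c where "x - p = c *\<^sub>R (q - p)"
    using cross_eq_0_parallelE[OF _ assms(3)] side_neq[OF assms(1)] by auto
  then have "a \<bullet> (x - p) = c * (a \<bullet> q - a \<bullet> p)" by (simp add: inner_diff_right)
  moreover have "a \<bullet> p = b" "a \<bullet> q = b" using ab by auto
  ultimately have "a \<bullet> x = b" by (simp add: inner_diff_right)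
  then show ?thesis using ab assms(2) by simp
qed

lemma side_interior:
  assumes "side P p q" "x \<in> interior P"
  shows "0 < cross (q - p) (x - p)"
proof -
  have "x \<in> P" using assms(2) interior_subset by auto
  then have "0 \<le> cross (q - p) (x - p)" using assms(1) by (simp add: side_def)
  moreover have "cross (q - p) (x - p) \<noteq> 0"
  proof
    \<comment> \<open>A small step along the outward normal of the side, started at an interior
      point on its line, would stay in \<open>P\<close> and yet leave the half-plane that contains
      \<open>P\<close>.\<close>
    assume *: "cross (q - p) (x - p) = 0"
    have "\<forall>\<^sub>F k in at_right 0. x + k *\<^sub>R vector [(q - p) $ 2, - (q - p) $ 1] \<in> interior P \<and> k > 0"
      by (intro eventually_conj interior_push assms eventually_at_right_less)
    then obtain k where k: "x + k *\<^sub>R vector [(q - p) $ 2, - (q - p) $ 1] \<in> P" "k > (0::real)"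
      using eventually_happens'[OF trivial_limit_at_right_real] interior_subset by blast
    have "0 \<le> cross (q - p) (x + k *\<^sub>R vector [(q - p) $ 2, - (q - p) $ 1] - p)"
      using k(1) assms(1) by (simp add: side_def)
    also have "\<dots> = cross (q - p) (x - p) - k * ((q - p) \<bullet> (q - p))"
      by (simp add: cross_def inner_vec_def sum_2 algebra_simps)
    finally have "k * ((q - p) \<bullet> (q - p)) \<le> 0" using * by simp
    moreover have "0 < (q - p) \<bullet> (q - p)" using side_neq[OF assms(1)] by simp
    ultimately show False using mult_pos_pos[OF k(2), of "(q - p) \<bullet> (q - p)"] by linarith
  qed
  ultimately show ?thesis by simp
qed

lemma side_unique:
  assumes "side P p q" "side P p' q'" "closed_segment p q = closed_segment p' q'"
  shows "p = p' \<and> q = q'"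
proof (rule ccontr)
  assume neg: "\<not> ?thesis"
  have "p = p' \<or> p = q'" "q = p' \<or> q = q'"
    using extreme_point_of_segment[of p p q] extreme_point_of_segment[of q p q] assms(3)
      extreme_point_of_segment[of _ p' q'] by auto
  then have "p' = q" "q' = p" using neg side_neq assms(1,2) by blast+
  moreover obtain c where "c \<in> interior P" by (rule polygon_interior)
  ultimately have "0 < cross (q - p) (c - p)" "0 < cross (p - q) (c - q)"
    using side_interior assms by auto
  then show False by (simp add: cross_def algebra_simps)
qed

lemma side_unique_on_line:
  assumes "side P p q" "side P p' q'" "cross (q - p) (p' - p) = 0" "cross (q - p) (q' - p) = 0"
  shows "p = p' \<and> q = q'"
proof -
  have 1: "p' \<in> closed_segment p q" "q' \<in> closed_segment p q"
    using side_line assms side_endpoints by auto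
  obtain u v where uv: "p' = p + u *\<^sub>R (q - p)" "q' = p + v *\<^sub>R (q - p)"
    using 1 by (auto simp: closed_segment_iff)
  have "cross (q' - p') (p - p') = 0" "cross (q' - p') (q - p') = 0"
    by (simp_all add: uv cross_def algebra_simps)
  then have "p \<in> closed_segment p' q'" "q \<in> closed_segment p' q'"
    using side_line assms side_endpoints by auto
  with 1 have "closed_segment p q = closed_segment p' q'"
    by (intro subset_antisym closed_segment_subset convex_closed_segment)
  then show ?thesis by (rule side_unique[OF assms(1,2)])
qed

lemma finite_sides: "finite {(p, q). side P p q}"
proof (rule finite_imageD)
  have "(\<lambda>(p, q). closed_segment p q) ` {(p, q). side P p q} \<subseteq> {F. F face_of P}"
    using side_face by auto
  then show "finite ((\<lambda>(p, q). closed_segment p q) ` {(p, q). side P p q})"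
    using finite_polytope_faces[of P] polygon finite_subset by (auto simp: convex_polygon_def)
  show "inj_on (\<lambda>(p, q). closed_segment p q) {(p, q). side P p q}"
    by (rule inj_onI) (auto simp del: closed_segment_eq dest: side_unique)
qed

lemma frontier_sides: "x \<in> frontier P \<longleftrightarrow> (\<exists>p q. side P p q \<and> x \<in> closed_segment p q)"
proof -
  have "frontier P = \<Union>{F. F facet_of P}"
    using rel_frontier_of_polyhedron[OF polygon_polyhedron] polygon
    by (simp add: convex_polygon_def rel_frontier_nonempty_interior)
  then have "frontier P = \<Union>{F. F edge_of P}" by (simp add: polygon_facet_iff)
  then have *: "x \<in> frontier P \<longleftrightarrow> (\<exists>e. e edge_of P \<and> x \<in> e)" by blast
  show ?thesis
  proof
    assume "x \<in> frontier P"
    then obtain e where e: "e edge_of P" "x \<in> e" using * by blast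
    obtain p q where "e = closed_segment p q" "side P p q" by (rule edge_side[OF e(1)])
    then show "\<exists>p q. side P p q \<and> x \<in> closed_segment p q" using e(2) by blast
  next
    assume "\<exists>p q. side P p q \<and> x \<in> closed_segment p q"
    then show "x \<in> frontier P" unfolding * side_def by blast
  qed
qed

lemma side_vertex:
  assumes "side P p q" "side P a b" "z \<in> {p, q}" "z \<in> closed_segment a b"
  shows "z = a \<or> z = b"
proof (rule ccontr)
  assume neg: "\<not> (z = a \<or> z = b)"
  then have z: "z \<in> open_segment a b" using assms(4) by (auto simp: open_segment_def)
  have "z \<in> closed_segment p q" using assms(3) by auto
  then have "a \<in> closed_segment p q" "b \<in> closed_segment p q"
    using face_ofD[OF side_face[OF assms(1)] z] side_endpoints[OF assms(2)] by auto
  then obtain u v where uv: "a = p + u *\<^sub>R (q - p)" "b = p + v *\<^sub>R (q - p)"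
    by (auto simp: closed_segment_iff)
  have "p = a \<and> q = b"
    by (rule side_unique_on_line[OF assms(1,2)]) (simp_all add: uv cross_simps)
  then show False using neg assms(3) by auto
qed

lemma side_start_unique:
  assumes "side P q r" "side P q r'"
  shows "r = r'"
proof -
  have "0 \<le> cross (r - q) (r' - q)" "0 \<le> cross (r' - q) (r - q)"
    using assms side_endpoints(2)[OF assms(1)] side_endpoints(2)[OF assms(2)]
    by (simp_all add: side_def)
  then have "cross (r - q) (r' - q) = 0" using cross_commute[of "r - q"] by simp
  then show ?thesis using side_unique_on_line[OF assms] by (simp add: cross_simps)
qed

lemma side_end_unique:
  assumes "side P p q" "side P p' q"
  shows "p = p'"
proof -
  have "0 \<le> cross (q - p) (p' - p)" "0 \<le> cross (q - p') (p - p')"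
    using assms side_endpoints(1)[OF assms(1)] side_endpoints(1)[OF assms(2)]
    by (simp_all add: side_def)
  moreover have "cross (q - p) (p' - p) = - cross (q - p') (p - p')"
    by (simp add: cross_def algebra_simps)
  ultimately have "cross (q - p) (p' - p) = 0" by simp
  then show ?thesis using side_unique_on_line[OF assms] by simp
qed

text \<open>If \<open>p q\<close> were the only side through \<open>q\<close>, the frontier near
  \<open>q\<close> would lie on its line. A short segment from an interior point near
  \<open>q\<close> to a point of that line beyond \<open>q\<close> must meet the frontier, but only
  its last point is on the line, and that point is outside \<open>P\<close>.\<close>

lemma side_next:
  assumes pq: "side P p q"
  obtains r where "side P q r"
proof -
  have "\<exists>a b. side P a b \<and> (a, b) \<noteq> (p, q) \<and> q \<in> closed_segment a b"
  proof (rule ccontr)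
    assume neg: "\<not> ?thesis"
    define C where "C = (\<Union>(a, b)\<in>{(a, b). side P a b} - {(p, q)}. closed_segment a b)"
    have "closed C" unfolding C_def using finite_sides by (intro closed_UN) auto
    moreover have "q \<notin> C" using neg by (auto simp: C_def)
    ultimately obtain \<delta> where \<delta>: "\<delta> > 0" "ball q \<delta> \<inter> C = {}"
      by (metis open_Compl openE disjoint_eq_subset_Compl ComplI)
    obtain c where c: "c \<in> interior P" by (rule polygon_interior)
    have "((\<lambda>k. q + k *\<^sub>R (c - q)) \<longlongrightarrow> q + 0 *\<^sub>R (c - q)) (at_right (0::real))"
      "((\<lambda>k. q + k *\<^sub>R (q - p)) \<longlongrightarrow> q + 0 *\<^sub>R (q - p)) (at_right (0::real))"
      by (intro tendsto_intros)+
    then have "\<forall>\<^sub>F k in at_right (0::real). q + k *\<^sub>R (c - q) \<in> ball q \<delta>"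
      "\<forall>\<^sub>F k in at_right (0::real). q + k *\<^sub>R (q - p) \<in> ball q \<delta>"
      using \<delta>(1) tendstoD[of _ q "at_right (0::real)" \<delta>] by (auto simp: dist_commute)
    moreover have "\<forall>\<^sub>F k in at_right (0::real). 0 < k \<and> k < 1"
      by (auto simp: eventually_at_right[of 0 1] intro!: exI[of _ 1])
    ultimately have "\<forall>\<^sub>F k in at_right (0::real). q + k *\<^sub>R (c - q) \<in> ball q \<delta>
        \<and> q + k *\<^sub>R (q - p) \<in> ball q \<delta> \<and> 0 < k \<and> k < 1"
      by eventually_elim simp
    then obtain k where k: "q + k *\<^sub>R (c - q) \<in> ball q \<delta>" "q + k *\<^sub>R (q - p) \<in> ball q \<delta>"
      "0 < k" "k < (1::real)"
      using eventually_happens'[OF trivial_limit_at_right_real] by blast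
    define x y where "x = q + k *\<^sub>R (c - q)" and "y = q + k *\<^sub>R (q - p)"
    have x: "x \<in> interior P"
      using mem_interior_convex_shrink[OF polygon_convex c, of q k] k side_endpoints[OF pq]
      by (simp add: x_def algebra_simps)
    have y0: "cross (q - p) (y - p) = 0" by (simp add: y_def cross_def algebra_simps)
    have y: "y \<notin> P"
    proof
      assume "y \<in> P"
      then have "y \<in> closed_segment p q" using side_line[OF pq] y0 by auto
      then obtain u where u: "u \<le> 1" "y = p + u *\<^sub>R (q - p)" by (auto simp: closed_segment_iff)
      have "(1 + k - u) *\<^sub>R (q - p) = 0" using u(2) by (simp add: y_def algebra_simps)
      then show False using u(1) k side_neq[OF pq] by simp
    qed
    have "closed_segment x y \<inter> frontier P \<noteq> {}"
      using x y interior_subset[of P] by (intro connected_Int_frontier) auto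
    then obtain z where z: "z \<in> closed_segment x y" "z \<in> frontier P" by blast
    then obtain a b where ab: "side P a b" "z \<in> closed_segment a b"
      using frontier_sides[of z] by blast
    have "z \<in> ball q \<delta>"
      using z(1) k(1,2) closed_segment_subset[of x "ball q \<delta>" y] by (auto simp: x_def y_def)
    then have "z \<notin> C" using \<delta>(2) by blast
    then have "(a, b) = (p, q)" using ab by (auto simp: C_def)
    then obtain v where "z = p + v *\<^sub>R (q - p)" using ab(2) by (auto simp: closed_segment_iff)
    then have z0: "cross (q - p) (z - p) = 0" by (simp add: cross_simps)
    obtain u where u: "0 \<le> u" "u \<le> 1" "z = x + u *\<^sub>R (y - x)"
      using z(1) by (auto simp: closed_segment_iff)
    have "cross (q - p) (z - p) = (1 - u) * cross (q - p) (x - p) + u * cross (q - p) (y - p)"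
      unfolding u(3) by (simp add: cross_simps algebra_simps)
    then have "u = 1" using z0 y0 side_interior[OF pq x] by simp
    then have "z = y" using u by simp
    then show False using y z(2) polygon_closed frontier_subset_closed by blast
  qed
  then obtain a b where ab: "side P a b" "(a, b) \<noteq> (p, q)" "q \<in> closed_segment a b" by blast
  then consider "q = a" | "q = b" using side_vertex[OF pq, of a b q] by blast
  then show thesis
  proof cases
    case 1
    then show ?thesis using ab(1) by (intro that) simp
  next
    case 2
    then show ?thesis using side_end_unique[OF pq, of a] ab(1,2) by simp
  qed
qed

text \<open>The successor map on the finite set of sides is injective, because only one side ends at
  a given vertex, and hence it is onto.\<close>

lemma side_prev:
  assumes "side P q r"
  obtains p where "side P p q"
proof -
  define E where "E = {(p, q). side P p q}"
  define f :: "plane \<times> plane \<Rightarrow> plane \<times> plane" where "f = (\<lambda>(p, q). (q, SOME r. side P q r))"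
  have f: "f (p, q) = (q, r)" if "side P p q" "side P q r" for p q r
    using some_equality[of "side P q" r, OF that(2)] side_start_unique[OF _ that(2)]
    by (simp add: f_def)
  have "f ` E \<subseteq> E"
  proof (clarsimp simp: E_def)
    fix a b c d assume *: "side P a b" "(c, d) = f (a, b)"
    obtain r where "side P b r" using side_next[OF *(1)] .
    then show "side P c d" using f[OF *(1)] *(2) by simp
  qed
  moreover have "inj_on f E"
  proof (rule inj_onI, clarsimp simp: E_def)
    fix a b c d assume *: "side P a b" "side P c d" "f (a, b) = f (c, d)"
    then have "b = d" by (simp add: f_def)
    then show "a = c \<and> b = d" using side_end_unique[of a b c] * by simp
  qed
  ultimately have "f ` E = E"
    using finite_sides by (intro endo_inj_surj) (auto simp: E_def)
  then have "(q, r) \<in> f ` E" using assms by (simp add: E_def)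
  then obtain p q' where "side P p q'" "(q, r) = f (p, q')" by (auto simp: E_def)
  then have "side P p q" by (simp add: f_def)
  then show thesis by (rule that)
qed

lemma corner_cross:
  assumes "side P p q" "side P q r"
  shows "0 < cross (q - p) (r - q)"
proof -
  have "cross (q - p) (r - q) = cross (q - p) (r - p)"
    by (simp add: cross_def algebra_simps)
  moreover have "0 \<le> cross (q - p) (r - p)"
    using side_endpoints(2)[OF assms(2)] assms(1) by (simp add: side_def)
  moreover have "cross (q - p) (r - p) \<noteq> 0"
  proof
    assume "cross (q - p) (r - p) = 0"
    then have "p = q" using side_unique_on_line[OF assms] by simp
    then show False using side_neq[OF assms(1)] by simp
  qed
  ultimately show ?thesis by linarith
qed

text \<open>The segment from an interior point to a point outside \<open>P\<close> crosses the
  frontier on some side. The functional of this side is positive at the inner end and zero at the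
  crossing, hence negative at the outer end.\<close>

lemma polygon_halfplanes: "x \<in> P \<longleftrightarrow> (\<forall>p q. side P p q \<longrightarrow> 0 \<le> cross (q - p) (x - p))"
proof
  assume R: "\<forall>p q. side P p q \<longrightarrow> 0 \<le> cross (q - p) (x - p)"
  show "x \<in> P"
  proof (rule ccontr)
    assume x: "x \<notin> P"
    obtain c where c: "c \<in> interior P" by (rule polygon_interior)
    then have "closed_segment c x \<inter> frontier P \<noteq> {}"
      using x interior_subset[of P] by (intro connected_Int_frontier) auto
    then obtain z p q where z: "z \<in> closed_segment c x" "side P p q" "z \<in> closed_segment p q"
      using frontier_sides by blast
    obtain u where u: "0 \<le> u" "u \<le> 1" "z = c + u *\<^sub>R (x - c)"
      using z(1) unfolding closed_segment_iff by blast
    obtain v where v: "z = p + v *\<^sub>R (q - p)"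
      using z(3) unfolding closed_segment_iff by blast
    have "cross (q - p) (z - p) = 0" unfolding v by (simp add: cross_simps)
    moreover have "cross (q - p) (z - p)
        = (1 - u) * cross (q - p) (c - p) + u * cross (q - p) (x - p)"
      unfolding u(3) by (simp add: cross_simps algebra_simps)
    moreover have "0 < cross (q - p) (c - p)" using side_interior[OF z(2) c] .
    moreover have "u \<noteq> 1" using u(3) z(3) x side_subset[OF z(2)] by auto
    ultimately show False
      using R z(2) u(1,2) by (smt (verit) mult_nonneg_nonneg mult_pos_pos)
  qed
qed (auto simp: side_def)

lemma polygon_interior_halfplanes:
  "x \<in> interior P \<longleftrightarrow> (\<forall>p q. side P p q \<longrightarrow> 0 < cross (q - p) (x - p))"
proof
  assume R: "\<forall>p q. side P p q \<longrightarrow> 0 < cross (q - p) (x - p)"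
  define U where "U = (\<Inter>(p, q)\<in>{(p, q). side P p q}. {x. 0 < cross (q - p) (x - p)})"
  have "open {x. 0 < cross (q - p) (x - p)}" for p q
    by (intro open_Collect_less continuous_intros)
  then have "open U"
    unfolding U_def using finite_sides by (intro open_INT) auto
  moreover have "U \<subseteq> P" using polygon_halfplanes by (auto simp: U_def less_imp_le)
  moreover have "x \<in> U" using R by (auto simp: U_def)
  ultimately show "x \<in> interior P" using interior_maximal by blast
qed (simp add: side_interior)

text \<open>Sides not through \<open>x\<close> hold strictly there and continue to do so for small
  steps, so only the sides through \<open>x\<close> constrain the direction \<open>m\<close>. Such
  steps serve to show that two tiles share an interior point and therefore coincide.\<close>

lemma eventually_interior:
  assumes "x \<in> P" "\<And>p q. side P p q \<Longrightarrow> x \<in> closed_segment p q \<Longrightarrow> 0 < cross (q - p) m"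
  shows "\<forall>\<^sub>F k in at_right 0. x + k *\<^sub>R m \<in> interior P"
proof -
  have "\<forall>\<^sub>F k in at_right 0. 0 < cross (q - p) (x + k *\<^sub>R m - p)" if "side P p q" for p q
  proof (cases "cross (q - p) (x - p) = 0")
    case True
    then have "0 < cross (q - p) m" using assms(2)[OF that side_line[OF that assms(1)]] by simp
    moreover have "\<forall>\<^sub>F k in at_right (0::real). 0 < k" by (rule eventually_at_right_less)
    ultimately show ?thesis
      using True by (auto elim!: eventually_mono simp: cross_simps algebra_simps)
  next
    case False
    moreover have "0 \<le> cross (q - p) (x - p)" using assms(1) that by (simp add: side_def)
    moreover have "((\<lambda>k. cross (q - p) (x - p) + k * cross (q - p) m) \<longlongrightarrow>
        cross (q - p) (x - p) + 0 * cross (q - p) m) (at_right 0)"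
      by (intro tendsto_intros)
    ultimately have "\<forall>\<^sub>F k in at_right 0. 0 < cross (q - p) (x - p) + k * cross (q - p) m"
      by (intro order_tendstoD(1)) auto
    then show ?thesis by (simp add: cross_simps algebra_simps)
  qed
  then have "\<forall>\<^sub>F k in at_right 0. \<forall>(p, q)\<in>{(p, q). side P p q}.
      0 < cross (q - p) (x + k *\<^sub>R m - p)"
    using finite_sides by (intro eventually_ball_finite) auto
  then show ?thesis
    by (rule eventually_mono) (auto simp: polygon_interior_halfplanes)
qed

lemma eventually_interior_side:
  assumes "side P p q" "z \<in> open_segment p q" "0 < cross (q - p) m"
  shows "\<forall>\<^sub>F k in at_right 0. z + k *\<^sub>R m \<in> interior P"
proof (rule eventually_interior)
  show "z \<in> P" using side_subset assms(1,2) open_closed_segment by blast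
  fix a b assume ab: "side P a b" "z \<in> closed_segment a b"
  then have "p \<in> closed_segment a b" "q \<in> closed_segment a b"
    using face_ofD[OF side_face[OF ab(1)] assms(2)] side_endpoints[OF assms(1)] by auto
  then obtain u v where uv: "p = a + u *\<^sub>R (b - a)" "q = a + v *\<^sub>R (b - a)"
    by (auto simp: closed_segment_iff)
  have "a = p \<and> b = q"
    by (rule side_unique_on_line[OF ab(1) assms(1)]) (simp_all add: uv cross_simps)
  then show "0 < cross (b - a) m" using assms(3) by simp
qed

lemma eventually_interior_corner:
  assumes "side P p q" "side P q r" "0 < cross (q - p) m" "0 < cross (r - q) m"
  shows "\<forall>\<^sub>F k in at_right 0. q + k *\<^sub>R m \<in> interior P"
proof (rule eventually_interior)
  show "q \<in> P" using side_endpoints(2)[OF assms(1)] .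
  fix a b assume ab: "side P a b" "q \<in> closed_segment a b"
  then consider "q = a" | "q = b" using side_vertex[OF assms(1)] by blast
  then show "0 < cross (b - a) m"
  proof cases
    case 1
    then show ?thesis using side_start_unique[OF assms(2), of b] ab(1) assms(4) by simp
  next
    case 2
    then show ?thesis using side_end_unique[OF assms(1), of a] ab(1) assms(3) by simp
  qed
qed

text \<open>All of \<open>P\<close> lies in the cone at \<open>q\<close> spanned by
  \<open>p - q\<close> and \<open>r - q\<close>, and the functional decreases along both generators.
  A local maximum among neighbours is thus a strict global one.\<close>

lemma corner_max:
  assumes "side P p q" "side P q r" "cross p e < cross q e" "cross r e < cross q e"
    and "x \<in> P" "x \<noteq> q"
  shows "cross x e < cross q e"
proof -
  let ?D = "cross (q - p) (r - q)"
  define \<alpha> where "\<alpha> = cross (x - q) (r - q) / ?D"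
  define \<beta> where "\<beta> = cross (q - p) (x - q) / ?D"
  have D: "0 < ?D" using corner_cross[OF assms(1,2)] .
  have x: "x - q = \<alpha> *\<^sub>R (q - p) + \<beta> *\<^sub>R (r - q)"
    using cross_decompose[of "q - p" "r - q" "x - q"] D by (simp add: \<alpha>_def \<beta>_def)
  have "0 \<le> cross (r - q) (x - q)" "0 \<le> cross (q - p) (x - p)"
    using assms(1,2,5) by (simp_all add: side_def)
  moreover have "cross (q - p) (x - p) = cross (q - p) (x - q)"
    by (simp add: cross_def algebra_simps)
  ultimately have ab: "\<alpha> \<le> 0" "0 \<le> \<beta>"
    using D cross_commute[of "x - q" "r - q"] by (simp_all add: \<alpha>_def \<beta>_def divide_nonpos_pos)
  have "\<alpha> \<noteq> 0 \<or> \<beta> \<noteq> 0" using x assms(6) by auto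
  moreover have "cross (x - q) e = \<alpha> * (cross q e - cross p e) + \<beta> * (cross r e - cross q e)"
    unfolding x by (simp add: cross_simps)
  moreover have "\<alpha> * (cross q e - cross p e) \<le> 0" "\<beta> * (cross r e - cross q e) \<le> 0"
    "\<alpha> \<noteq> 0 \<Longrightarrow> \<alpha> * (cross q e - cross p e) \<noteq> 0" "\<beta> \<noteq> 0 \<Longrightarrow> \<beta> * (cross r e - cross q e) \<noteq> 0"
    using ab assms(3,4) by (simp_all add: mult_le_0_iff)
  ultimately have "cross (x - q) e < 0" by linarith
  then show ?thesis by (simp add: cross_simps)
qed

end

section \<open>The boundary cycle, the area and the order of side directions\<close>

lemma finite_max_obtain:
  fixes f :: "'a \<Rightarrow> real"
  assumes "finite A" "A \<noteq> {}"
  obtains a where "a \<in> A" "\<And>b. b \<in> A \<Longrightarrow> f b \<le> f a"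
proof -
  have "Max (f ` A) \<in> f ` A" using assms by (intro Max_in) auto
  then obtain a where "a \<in> A" "f a = Max (f ` A)" by auto
  then show thesis using that assms(1) by (metis Max_ge finite_imageI imageI)
qed

context
  fixes P :: "plane set"
  assumes polygon: "convex_polygon P"
begin

text \<open>The successor map is packaged as an injection on sides, so that sums can be reindexed
  and closure properties transferred without numbering the vertices.\<close>

lemma sides_shift:
  "\<exists>f. inj_on f {(p, q). side P p q} \<and>
    (\<forall>p q. side P p q \<longrightarrow> fst (f (p, q)) = q \<and> side P q (snd (f (p, q))))"
proof -
  define f :: "plane \<times> plane \<Rightarrow> plane \<times> plane" where "f = (\<lambda>(p, q). (q, SOME r. side P q r))"
  have "inj_on f {(p, q). side P p q}"
    by (rule inj_onI) (auto simp: f_def dest: side_end_unique[OF polygon])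
  moreover have "side P q (snd (f (p, q)))" if "side P p q" for p q
    using side_next[OF polygon that] someI_ex[of "side P q"] by (auto simp: f_def)
  ultimately show ?thesis by (intro exI[of _ f]) (simp add: f_def)
qed

lemma sides_nonempty: "\<exists>p q. side P p q"
  using polygon_halfplanes[OF polygon] polygon_compact[OF polygon]
  by (metis UNIV_eq_I compact_imp_bounded not_bounded_UNIV)

lemma sum_sides_shift:
  fixes g :: "plane \<Rightarrow> 'a::comm_monoid_add"
  shows "(\<Sum>(p, q)\<in>{(p, q). side P p q}. g q) = (\<Sum>(p, q)\<in>{(p, q). side P p q}. g p)"
proof -
  let ?E = "{(p, q). side P p q}"
  obtain f where f: "inj_on f ?E" "\<And>p q. side P p q \<Longrightarrow> fst (f (p, q)) = q"
    "\<And>p q. side P p q \<Longrightarrow> side P q (snd (f (p, q)))" using sides_shift by blast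
  have "f x \<in> ?E" if "x \<in> ?E" for x
  proof -
    from that obtain p q where x: "x = (p, q)" "side P p q" by blast
    have "f x = (q, snd (f (p, q)))" using f(2)[OF x(2)] x(1) by (metis prod.collapse)
    then show ?thesis using f(3)[OF x(2)] by simp
  qed
  then have im: "f ` ?E = ?E"
    using f(1) finite_sides[OF polygon] by (intro endo_inj_surj image_subsetI)
  have "(\<Sum>(p, q)\<in>?E. g q) = (\<Sum>x\<in>?E. g (fst (f x)))"
    using f(2) by (intro sum.cong) auto
  also have "\<dots> = (\<Sum>x\<in>f ` ?E. g (fst x))"
    using f(1) by (simp add: sum.reindex)
  also have "\<dots> = (\<Sum>(p, q)\<in>?E. g p)" unfolding im by (simp add: case_prod_unfold)
  finally show ?thesis .
qed

text \<open>The injective successor map sends the finite set \<open>X\<close> into itself, hence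
  onto itself, so the predecessor of a member is a member.\<close>

lemma sides_closed_prev:
  assumes X: "X \<subseteq> {(p, q). side P p q}" "\<forall>p q r. (p, q) \<in> X \<longrightarrow> side P q r \<longrightarrow> (q, r) \<in> X"
    and qr: "(q, r) \<in> X" and pq: "side P p q"
  shows "(p, q) \<in> X"
proof -
  obtain f where f: "inj_on f {(p, q). side P p q}" "\<And>p q. side P p q \<Longrightarrow> fst (f (p, q)) = q"
    "\<And>p q. side P p q \<Longrightarrow> side P q (snd (f (p, q)))" using sides_shift by blast
  have "f x \<in> X" if "x \<in> X" for x
  proof -
    obtain a b where x: "x = (a, b)" "side P a b" using \<open>x \<in> X\<close> X(1) by auto
    have "f x = (b, snd (f (a, b)))" using f(2)[OF x(2)] x(1) by (metis prod.collapse)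
    moreover have "(b, snd (f (a, b))) \<in> X"
      using X(2) f(3)[OF x(2)] \<open>x \<in> X\<close> x(1) by blast
    ultimately show ?thesis by simp
  qed
  moreover have "finite X" using X(1) finite_sides[OF polygon] finite_subset by auto
  ultimately have "f ` X = X"
    using inj_on_subset[OF f(1) X(1)] by (intro endo_inj_surj) auto
  then obtain x where x: "x \<in> X" "(q, r) = f x" using qr by (metis imageE)
  then obtain a b where ab: "x = (a, b)" "side P a b" using X(1) by auto
  have "b = q" using f(2)[OF ab(2)] x(2) ab(1) by (metis fst_conv)
  then have "a = p" using side_end_unique[OF polygon pq, of a] ab(2) by simp
  then show ?thesis using x(1) ab(1) \<open>b = q\<close> by simp
qed

text \<open>The highest end point of a side in \<open>X\<close> is at least as high as its two
  neighbours, since these are end points of sides in \<open>X\<close> as well;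
  \<open>corner_max\<close> turns this into a global maximum.\<close>

lemma sides_closed_max:
  assumes generic: "\<forall>p q. side P p q \<longrightarrow> cross p e \<noteq> cross q e"
    and X: "X \<subseteq> {(p, q). side P p q}" "\<forall>p q r. (p, q) \<in> X \<longrightarrow> side P q r \<longrightarrow> (q, r) \<in> X"
    and ne: "X \<noteq> {}"
  shows "\<exists>p q. (p, q) \<in> X \<and> (\<forall>x\<in>P. x \<noteq> q \<longrightarrow> cross x e < cross q e)"
proof -
  have fin: "finite X" using X(1) finite_sides[OF polygon] finite_subset by auto
  obtain s where s: "s \<in> X" "\<And>t. t \<in> X \<Longrightarrow> cross (snd t) e \<le> cross (snd s) e"
    using finite_max_obtain[OF fin ne, of "\<lambda>s. cross (snd s) e"] by blast
  obtain p q where pq: "s = (p, q)" by (cases s)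
  then have side: "side P p q" using s(1) X(1) by auto
  obtain r where r: "side P q r" using side_next[OF polygon side] .
  obtain a where a: "side P a p" using side_prev[OF polygon side] .
  have "(q, r) \<in> X" using X(2) s(1) pq r by blast
  moreover have "(a, p) \<in> X"
    by (rule sides_closed_prev[OF X _ a]) (use s(1) pq in simp_all)
  ultimately have "cross r e \<le> cross q e" "cross p e \<le> cross q e" using s(2) pq by fastforce+
  then have "cross r e < cross q e" "cross p e < cross q e"
    using generic side r by fastforce+
  then show ?thesis
    using s(1) pq corner_max[OF polygon side r] by blast
qed

text \<open>The sides form a single cycle: \<open>X\<close> contains the side that ends at the
  unique maximum of the functional over \<open>P\<close>, and the complement of \<open>X\<close>,
  which is also closed under successors, would contain the same side if it were nonempty.\<close>

lemma sides_cycle: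
  assumes generic: "\<forall>p q. side P p q \<longrightarrow> cross p e \<noteq> cross q e"
    and X: "X \<subseteq> {(p, q). side P p q}" "\<forall>p q r. (p, q) \<in> X \<longrightarrow> side P q r \<longrightarrow> (q, r) \<in> X"
    and ne: "X \<noteq> {}"
  shows "X = {(p, q). side P p q}"
proof (rule ccontr)
  assume neg: "X \<noteq> {(p, q). side P p q}"
  define Y where "Y = {(p, q). side P p q} - X"
  have Y: "Y \<subseteq> {(p, q). side P p q}" "Y \<noteq> {}" using neg X(1) by (auto simp: Y_def)
  have Y2: "\<forall>p q r. (p, q) \<in> Y \<longrightarrow> side P q r \<longrightarrow> (q, r) \<in> Y"
  proof (intro allI impI)
    fix p q r assume that: "(p, q) \<in> Y" "side P q r"
    have "(q, r) \<notin> X"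
    proof
      assume "(q, r) \<in> X"
      moreover have "side P p q" using that by (simp add: Y_def)
      ultimately have "(p, q) \<in> X"
        by (rule sides_closed_prev[OF X])
      then show False using that by (simp add: Y_def)
    qed
    then show "(q, r) \<in> Y" using that by (simp add: Y_def)
  qed
  obtain p q where pq: "(p, q) \<in> X" "\<And>x. x \<in> P \<Longrightarrow> x \<noteq> q \<Longrightarrow> cross x e < cross q e"
    using sides_closed_max[OF generic X ne] by blast
  obtain a b where ab: "(a, b) \<in> Y" "\<And>x. x \<in> P \<Longrightarrow> x \<noteq> b \<Longrightarrow> cross x e < cross b e"
    using sides_closed_max[OF generic Y(1) Y2 Y(2)] by blast
  have s: "side P p q" "side P a b" using pq ab X(1) Y(1) by auto
  have "q = b"
    using pq(2)[OF side_endpoints(2)[OF polygon s(2)]] ab(2)[OF side_endpoints(2)[OF polygon s(1)]]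
    by fastforce
  then have "a = p" using side_end_unique[OF polygon s(1), of a] s(2) by simp
  then show False using \<open>q = b\<close> pq(1) ab(1) by (simp add: Y_def)
qed

lemma sides_change:
  assumes generic: "\<forall>p q. side P p q \<longrightarrow> cross p e \<noteq> cross q e"
    and "side P a b" "g a b" "side P c d" "\<not> g c d"
  obtains p q r where "side P p q" "side P q r" "g p q" "\<not> g q r"
proof (rule ccontr)
  assume neg: "\<not> thesis"
  have "{(p, q). side P p q \<and> g p q} = {(p, q). side P p q}"
    by (rule sides_cycle[OF generic]) (use neg that assms(2,3) in auto)
  then show False using assms(4,5) by auto
qed

lemma side_open_unique:
  assumes "side P p q" "z \<in> open_segment p q" "side P a b" "z \<in> closed_segment a b"
  shows "a = p \<and> b = q"
proof -
  have "p \<in> closed_segment a b" "q \<in> closed_segment a b"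
    using face_ofD[OF side_face[OF polygon assms(3)] assms(2)] side_endpoints[OF polygon assms(1)]
      assms(4) by auto
  then obtain u v where uv: "p = a + u *\<^sub>R (b - a)" "q = a + v *\<^sub>R (b - a)"
    by (auto simp: closed_segment_iff)
  show ?thesis
    by (rule side_unique_on_line[OF polygon assms(3,1)]) (simp_all add: uv cross_simps)
qed

lemma polygon_radial:
  assumes c: "c \<in> interior P" and x: "x \<in> P" "x \<noteq> c"
  obtains z s where "z \<in> frontier P" "0 < s" "s \<le> 1" "x = c + s *\<^sub>R (z - c)"
proof -
  obtain d where d: "0 < d" "c + d *\<^sub>R (x - c) \<in> frontier P"
    using ray_to_frontier[of P c "x - c"] c x(2) compact_imp_bounded[OF polygon_compact[OF polygon]]
    by auto
  have "1 \<le> d"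
  proof (rule ccontr)
    assume "\<not> 1 \<le> d"
    then have "x - (1 - d) *\<^sub>R (x - c) \<in> interior P"
      using d(1) by (intro mem_interior_convex_shrink[OF polygon_convex[OF polygon] c x(1)]) auto
    moreover have "x - (1 - d) *\<^sub>R (x - c) = c + d *\<^sub>R (x - c)" by (simp add: algebra_simps)
    ultimately show False using d(2) by (simp add: frontier_def)
  qed
  then show thesis using d by (intro that[of "c + d *\<^sub>R (x - c)" "1 / d"]) auto
qed

lemma polygon_radial_unique:
  assumes c: "c \<in> interior P" and z: "z \<in> frontier P" "z' \<in> frontier P"
    and s: "0 < s" "0 < s'" "s *\<^sub>R (z - c) = s' *\<^sub>R (z' - c)"
  shows "z = z'"
proof -
  have False if "s < s'" "z \<in> frontier P" "z' \<in> frontier P" "0 < s"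
    "s *\<^sub>R (z - c) = s' *\<^sub>R (z' - c)" for s s' z z'
  proof -
    have "z' - c = inverse s' *\<^sub>R (s' *\<^sub>R (z' - c))" using that by simp
    also have "\<dots> = (s / s') *\<^sub>R (z - c)"
      unfolding that(5)[symmetric] by (simp add: divide_inverse mult.commute)
    finally have "z' = z - (1 - s / s') *\<^sub>R (z - c)" by (simp add: algebra_simps)
    moreover have "z - (1 - s / s') *\<^sub>R (z - c) \<in> interior P"
      using that frontier_subset_closed[OF polygon_closed[OF polygon]]
      by (intro mem_interior_convex_shrink[OF polygon_convex[OF polygon] c]) auto
    ultimately show False using that(3) by (simp add: frontier_def)
  qed
  from this[of s s' z z'] this[of s' s z' z] have "s = s'" using z s by force
  then show ?thesis using s by simp
qed

lemma negligible_closed_segment: "negligible (closed_segment a (b::plane))"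
proof -
  have "interior (closed_segment a b) = {}" by (simp add: interior_closed_segment_ge2)
  then show ?thesis
    by (metis convex_closed_segment negligible_convex_interior)
qed

text \<open>The shoelace formula. The triangles spanned by an interior point \<open>c\<close> and
  the sides cover \<open>P\<close> and overlap only in segments from \<open>c\<close>; the terms
  with \<open>c\<close> cancel around the boundary.\<close>

lemma polygon_area:
  "measure lebesgue P = (\<Sum>(p, q)\<in>{(p, q). side P p q}. cross p q) / 2"
proof -
  let ?E = "{(p, q). side P p q}"
  obtain c where c: "c \<in> interior P" by (rule polygon_interior[OF polygon])
  have cP: "c \<in> P" using c interior_subset by auto
  define T where "T = (\<lambda>(p, q). convex hull {c, p, q})"
  have T: "x \<in> T (p, q) \<longleftrightarrow> (\<exists>s z. 0 \<le> s \<and> s \<le> 1 \<and> z \<in> closed_segment p q \<and> x = c + s *\<^sub>R (z - c))"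
    for x p q
    unfolding T_def prod.case convex_hull_insert_segments segment_convex_hull[symmetric]
    by (auto simp: closed_segment_iff[of x c])
  have TP: "T (p, q) \<subseteq> P" if "side P p q" for p q
    unfolding T_def prod.case
    using side_endpoints[OF polygon that] cP by (intro hull_minimal polygon_convex[OF polygon]) auto
  have "P = \<Union> (T ` ?E)"
  proof
    show "\<Union> (T ` ?E) \<subseteq> P" using TP by auto
    show "P \<subseteq> \<Union> (T ` ?E)"
    proof
      fix x assume x: "x \<in> P"
      show "x \<in> \<Union> (T ` ?E)"
      proof (cases "x = c")
        case True
        obtain p q where "side P p q" using sides_nonempty by blast
        moreover have "x \<in> T (p, q)" unfolding T_def prod.case True by (rule hull_inc) simp
        ultimately show ?thesis by blast
      next
        case False
        obtain z s where z: "z \<in> frontier P" "0 < s" "s \<le> 1" "x = c + s *\<^sub>R (z - c)"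
          by (rule polygon_radial[OF c x False])
        then obtain p q where "side P p q" "z \<in> closed_segment p q"
          using frontier_sides[OF polygon] by blast
        then have "x \<in> T (p, q)" using z unfolding T by (intro exI[of _ s] exI[of _ z]) simp
        then show ?thesis using \<open>side P p q\<close> by blast
      qed
    qed
  qed
  moreover have "measure lebesgue (\<Union> (T ` ?E)) = (\<Sum>x\<in>?E. measure lebesgue (T x))"
  proof (rule measure_negligible_finite_Union_image)
    show "finite ?E" by (rule finite_sides[OF polygon])
    show "T x \<in> lmeasurable" for x
      unfolding T_def by (cases x) (simp add: lmeasurable_compact compact_convex_hull)
    show "pairwise (\<lambda>x y. negligible (T x \<inter> T y)) ?E"
    proof (rule pairwiseI)
      fix x y assume xy: "x \<in> ?E" "y \<in> ?E" "x \<noteq> y"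
      obtain p q a b where pq: "x = (p, q)" "side P p q" and ab: "y = (a, b)" "side P a b"
        using xy by auto
      have "T x \<inter> T y \<subseteq> closed_segment c p \<union> closed_segment c q"
      proof
        fix w assume "w \<in> T x \<inter> T y"
        then have "w \<in> T (p, q)" "w \<in> T (a, b)" using pq ab by auto
        then obtain s z s' z' where z: "0 \<le> s" "s \<le> 1" "z \<in> closed_segment p q"
            "w = c + s *\<^sub>R (z - c)"
          and z': "0 \<le> s'" "z' \<in> closed_segment a b" "w = c + s' *\<^sub>R (z' - c)"
          unfolding T by blast
        show "w \<in> closed_segment c p \<union> closed_segment c q"
        proof (cases "w = c")
          case False
          have "s \<noteq> 0" "s' \<noteq> 0" using z(4) z'(3) False by auto
          then have "0 < s" "0 < s'" using z(1) z'(1) by simp_all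
          moreover have "z \<in> frontier P" "z' \<in> frontier P"
            using frontier_sides[OF polygon] pq(2) ab(2) z(3) z'(2) by blast+
          ultimately have "z = z'"
            using polygon_radial_unique[OF c, of z z' s s'] z(4) z'(3) by simp
          then have "z \<notin> open_segment p q"
            using side_open_unique[OF pq(2) _ ab(2)] z'(2) xy(3) pq(1) ab(1) by blast
          then have "z = p \<or> z = q" using z(3) by (auto simp: open_segment_def)
          then show ?thesis using z(1,2,4) unfolding Un_iff closed_segment_iff by blast
        qed simp
      qed
      then show "negligible (T x \<inter> T y)"
        by (rule negligible_subset[rotated]) (intro negligible_Un negligible_closed_segment)
    qed
  qed
  ultimately have "measure lebesgue P = (\<Sum>x\<in>?E. measure lebesgue (T x))" by simp
  also have "\<dots> = (\<Sum>(p, q)\<in>?E. (cross p q + cross c p - cross c q) / 2)"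
  proof (rule sum.cong, simp, clarify)
    fix p q assume pq: "side P p q"
    have "measure lebesgue (T (p, q)) = measure lborel (T (p, q))"
      unfolding T_def prod.case
      by (intro measure_completion) (simp add: borel_compact compact_convex_hull)
    also have "\<dots> = \<bar>cross (p - c) (q - c)\<bar> / 2"
      unfolding T_def prod.case content_triangle
      by (simp add: cross_def algebra_simps)
    also have "cross (p - c) (q - c) = cross (q - p) (c - p)"
      by (simp add: cross_def algebra_simps)
    also have "\<bar>cross (q - p) (c - p)\<bar> = cross (q - p) (c - p)"
      using side_interior[OF polygon pq c] by simp
    also have "\<dots> = cross p q + cross c p - cross c q"
      by (simp add: cross_def algebra_simps)
    finally show "measure lebesgue (T (p, q)) = (cross p q + cross c p - cross c q) / 2" .
  qed
  also have "\<dots> = ((\<Sum>(p, q)\<in>?E. cross p q) + (\<Sum>(p, q)\<in>?E. cross c p) - (\<Sum>(p, q)\<in>?E. cross c q)) / 2"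
    by (simp add: case_prod_unfold sum_divide_distrib[symmetric] sum.distrib sum_subtractf)
  also have "(\<Sum>(p, q)\<in>?E. cross c q) = (\<Sum>(p, q)\<in>?E. cross c p)"
    by (rule sum_sides_shift)
  finally show ?thesis by simp
qed

text \<open>With the direction of \<open>a b\<close> strictly between those of the two sides at
  \<open>q\<close>, the functional \<open>cross (b - a)\<close> would attain its minimum over
  \<open>P\<close> at \<open>q\<close> alone, whereas it is minimal at both \<open>a\<close> and
  \<open>b\<close>.\<close>

lemma corner_no_between:
  assumes "side P p q" "side P q r" "side P a b"
    and "0 < cross (q - p) (b - a)" "0 < cross (b - a) (r - q)"
  shows False
proof -
  let ?D = "cross (q - p) (r - q)"
  have D: "0 < ?D" using corner_cross[OF polygon assms(1,2)] .
  have pos: "0 < cross (b - a) (x - q)" if "x \<in> P" "x \<noteq> q" for x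
  proof -
    define \<alpha> where "\<alpha> = cross (x - q) (r - q) / ?D"
    define \<beta> where "\<beta> = cross (q - p) (x - q) / ?D"
    have x: "x - q = \<alpha> *\<^sub>R (q - p) + \<beta> *\<^sub>R (r - q)"
      using cross_decompose[of "q - p" "r - q" "x - q"] D by (simp add: \<alpha>_def \<beta>_def)
    have "0 \<le> cross (r - q) (x - q)" "0 \<le> cross (q - p) (x - p)"
      using assms(1,2) that(1) by (simp_all add: side_def)
    moreover have "cross (q - p) (x - p) = cross (q - p) (x - q)"
      by (simp add: cross_def algebra_simps)
    ultimately have ab: "\<alpha> \<le> 0" "0 \<le> \<beta>"
      using D cross_commute[of "x - q" "r - q"] by (simp_all add: \<alpha>_def \<beta>_def divide_nonpos_pos)
    have "\<alpha> \<noteq> 0 \<or> \<beta> \<noteq> 0" using x \<open>x \<noteq> q\<close> by auto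
    then have "\<alpha> < 0 \<or> 0 < \<beta>" using ab by linarith
    moreover have "cross (b - a) (x - q) = (- \<alpha>) * cross (q - p) (b - a) + \<beta> * cross (b - a) (r - q)"
      unfolding x using cross_commute[of "b - a" "q - p"]
      by (simp only: cross_simps(2,8)) simp
    moreover have "0 \<le> (- \<alpha>) * cross (q - p) (b - a)" "0 \<le> \<beta> * cross (b - a) (r - q)"
      using ab assms(4,5) by (simp_all add: mult_nonpos_nonneg)
    moreover have "\<alpha> < 0 \<Longrightarrow> 0 < (- \<alpha>) * cross (q - p) (b - a)"
      "0 < \<beta> \<Longrightarrow> 0 < \<beta> * cross (b - a) (r - q)"
      using assms(4,5) by (simp_all add: mult_neg_pos)
    ultimately show ?thesis by linarith
  qed
  have "0 \<le> cross (b - a) (q - a)"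
    using assms(3) side_endpoints(2)[OF polygon assms(1)] by (simp add: side_def)
  then have "a = q"
    using pos[OF side_endpoints(1)[OF polygon assms(3)]] cross_simps(6)[of "b - a" "q - a"]
    by fastforce
  moreover have "b \<noteq> q" using \<open>a = q\<close> side_neq[OF polygon assms(3)] by simp
  ultimately show False using pos[OF side_endpoints(2)[OF polygon assms(3)]] by simp
qed

lemma side_direction_unique:
  assumes "side P p q" "side P a b" "b - a = k *\<^sub>R (q - p)" "0 < k"
  shows "p = a \<and> q = b"
proof -
  have "0 \<le> cross (q - p) (a - p)" "0 \<le> cross (b - a) (p - a)"
    using assms(1,2) side_endpoints(1)[OF polygon assms(1)] side_endpoints(1)[OF polygon assms(2)]
    by (simp_all add: side_def)
  moreover have "cross (b - a) (p - a) = - (k * cross (q - p) (a - p))"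
    unfolding assms(3) by (simp add: cross_def algebra_simps)
  ultimately have a: "cross (q - p) (a - p) = 0"
    using assms(4) by (smt (verit) mult_pos_pos)
  have "b - p = (a - p) + k *\<^sub>R (q - p)" unfolding assms(3)[symmetric] by simp
  then have "cross (q - p) (b - p) = 0" using a by (simp only: cross_simps(2,8)) simp
  then show ?thesis using side_unique_on_line[OF polygon assms(1,2) a] by simp
qed

text \<open>The successor of a side is recognised from directions alone, as the side that turns left
  with no other direction in between. In this form adjacency can be transported to a deformed
  tile.\<close>

lemma adjacent_unique:
  assumes "side P p q" "side P q r" "side P a b" "0 < cross (q - p) (b - a)"
    and between: "\<And>c d. side P c d \<Longrightarrow> \<not> (0 < cross (q - p) (d - c) \<and> 0 < cross (d - c) (b - a))"
  shows "a = q \<and> b = r"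
proof -
  have qr: "0 < cross (q - p) (r - q)" using corner_cross[OF polygon assms(1,2)] .
  have "\<not> 0 < cross (r - q) (b - a)" using between[OF assms(2)] qr by blast
  moreover have "\<not> 0 < cross (b - a) (r - q)"
    using corner_no_between[OF assms(1,2,3,4)] by blast
  ultimately have "cross (r - q) (b - a) = 0" using cross_commute[of "r - q" "b - a"] by linarith
  moreover have "r - q \<noteq> 0" using side_neq[OF polygon assms(2)] by simp
  ultimately obtain k where k: "b - a = k *\<^sub>R (r - q)"
    using cross_eq_0_parallelE by blast
  have "0 < k * cross (q - p) (r - q)" using assms(4) unfolding k by (simp add: cross_simps(8))
  then have "0 < k" using qr by (simp add: zero_less_mult_iff)
  then show ?thesis using side_direction_unique[OF assms(2,3) k] by simp
qed

end

text \<open>A graph isomorphism does not record the cyclic order of the sides of a tile. But if all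
  edge vectors are rescaled with the common sign \<sigma>, the sign of \<open>cross\<close> of any
  two is kept, and with it the description of successors by directions.\<close>

lemma adjacent_transfer:
  assumes P: "convex_polygon P" and P': "convex_polygon P'" and \<sigma>: "\<sigma> \<in> {1, -1::real}"
    and side: "\<And>p q. side P p q \<Longrightarrow> side P' (s p q) (t p q)"
    and surj: "\<And>a b. side P' a b \<Longrightarrow> \<exists>p q. side P p q \<and> a = s p q \<and> b = t p q"
    and dir: "\<And>p q. side P p q \<Longrightarrow> \<exists>k>0. t p q - s p q = (\<sigma> * k) *\<^sub>R (q - p)"
    and pq: "side P p q" and qr: "side P q r"
  shows "t p q = s q r"
proof -
  have sgn: "0 < cross (t p q - s p q) (t a b - s a b) \<longleftrightarrow> 0 < cross (q - p) (b - a)"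
    if "side P p q" "side P a b" for p q a b
  proof -
    obtain k l where "0 < k" "0 < l" "t p q - s p q = (\<sigma> * k) *\<^sub>R (q - p)"
      "t a b - s a b = (\<sigma> * l) *\<^sub>R (b - a)" using dir \<open>side P p q\<close> \<open>side P a b\<close> by blast
    moreover have "\<sigma> * \<sigma> = 1" using \<sigma> by auto
    ultimately have "cross (t p q - s p q) (t a b - s a b) = (k * l) * cross (q - p) (b - a)"
      by (simp add: cross_simps(7,8))
    moreover have "0 < k * l" using \<open>0 < k\<close> \<open>0 < l\<close> by simp
    ultimately show ?thesis by (metis mult_pos_pos zero_less_mult_pos)
  qed
  obtain r' where r': "side P' (t p q) r'" using side_next[OF P' side[OF pq]] .
  have "s q r = t p q \<and> t q r = r'"
  proof (rule adjacent_unique[OF P' side[OF pq] r' side[OF qr]])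
    show "0 < cross (t p q - s p q) (t q r - s q r)"
      using sgn[OF pq qr] corner_cross[OF P pq qr] by simp
    fix c d assume "side P' c d"
    then obtain a b where ab: "side P a b" "c = s a b" "d = t a b" using surj by blast
    show "\<not> (0 < cross (t p q - s p q) (d - c) \<and> 0 < cross (d - c) (t q r - s q r))"
      unfolding ab(2,3) sgn[OF pq ab(1)] sgn[OF ab(1) qr]
      using corner_no_between[OF P pq qr ab(1)] by blast
  qed
  then show ?thesis by simp
qed

section \<open>A convex polygon is determined by the lines of its sides\<close>

lemma affine_positive_right:
  fixes A B :: real
  assumes "0 < A" "A + B * y < 0" "y < 0" "0 \<le> z"
  shows "0 < A + B * z"
proof -
  have "0 < B" using assms by (smt (verit) mult_nonpos_nonpos)
  then show ?thesis using assms by (smt (verit) mult_nonneg_nonneg)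
qed

text \<open>An affine function with values of weakly opposite sign at two negative points has a
  negative root \<open>- A / B\<close>.\<close>

lemma affine_root_sign:
  fixes A B :: real
  assumes "(A + B * y1) * (A + B * y2) \<le> 0" "y1 < 0" "y2 < 0" "A \<noteq> 0 \<or> B \<noteq> 0"
  shows "0 < A * B"
proof (rule ccontr)
  assume "\<not> 0 < A * B"
  then consider "0 \<le> A" "B \<le> 0" | "A \<le> 0" "0 \<le> B" by (metis linorder_not_le mult_pos_pos mult_neg_neg less_eq_real_def nle_le)
  then show False
  proof cases
    case 1
    then have "0 \<le> B * y1" "0 \<le> B * y2" "B \<noteq> 0 \<Longrightarrow> 0 < B * y1" "B \<noteq> 0 \<Longrightarrow> 0 < B * y2"
      using assms(2,3) by (auto simp: mult_nonpos_nonpos mult_neg_neg)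
    then have "0 < A + B * y1" "0 < A + B * y2" using 1 assms(4) by (cases "B = 0"; fastforce)+
    then show False using assms(1) mult_pos_pos[of "A + B * y1" "A + B * y2"] by linarith
  next
    case 2
    then have "B * y1 \<le> 0" "B * y2 \<le> 0" "B \<noteq> 0 \<Longrightarrow> B * y1 < 0" "B \<noteq> 0 \<Longrightarrow> B * y2 < 0"
      using assms(2,3) by (auto simp: mult_nonneg_nonpos mult_pos_neg)
    then have "A + B * y1 < 0" "A + B * y2 < 0" using 2 assms(4) by (cases "B = 0"; fastforce)+
    then show False using assms(1) mult_neg_neg[of "A + B * y1" "A + B * y2"] by linarith
  qed
qed

text \<open>Two bounded cells, \<open>P\<close> below and \<open>Q\<close> above the line y = 0, are
  cut out by the same further lines, line \<open>i\<close> being \<open>t = ev i y\<close>.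
  \<open>PL i\<close> says that line \<open>i\<close> bounds \<open>P\<close> from the right, that
  is, towards large \<open>t\<close>, and \<open>QL i\<close> says the same for \<open>Q\<close>.
  Each line touches both cells off the base. By \<open>noRL\<close> there are at most three types of
  lines, each type turns out to be a single line, and closing both cells forces incompatible
  crossings among these lines.\<close>

lemma opposite_cells_aux:
  fixes \<alpha> \<kappa> :: "'i \<Rightarrow> real" and PL QL :: "'i \<Rightarrow> bool"
  defines "ev \<equiv> \<lambda>i y. \<alpha> i + \<kappa> i * y"
  assumes P: "\<And>t y. P t y \<longleftrightarrow> y \<le> 0 \<and> (\<forall>i\<in>I. if PL i then t \<le> ev i y else ev i y \<le> t)"
    and Q: "\<And>t y. Q t y \<longleftrightarrow> 0 \<le> y \<and> (\<forall>i\<in>I. if QL i then t \<le> ev i y else ev i y \<le> t)"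
    and touchP: "\<And>i. i \<in> I \<Longrightarrow> \<exists>y<0. P (ev i y) y"
    and touchQ: "\<And>i. i \<in> I \<Longrightarrow> \<exists>y>0. Q (ev i y) y"
    and baseP: "P t1 0" "P t2 0" "t1 < t2" and baseQ: "Q s1 0" "Q s2 0" "s1 < s2"
    and bndP: "\<And>t y. P t y \<Longrightarrow> \<bar>t\<bar> \<le> K \<and> \<bar>y\<bar> \<le> K"
    and bndQ: "\<And>t y. Q t y \<Longrightarrow> \<bar>t\<bar> \<le> K \<and> \<bar>y\<bar> \<le> K"
    and noRL: "\<And>i. i \<in> I \<Longrightarrow> PL i \<or> \<not> QL i"
  shows False
proof -
  \<comment> \<open>Each of two lines of one type touches \<open>P\<close> at a point that the other
    does not cut off, so they cross below the base; with \<open>Q\<close> they also cross above it.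
    An affine function with two roots vanishes.\<close>
  have same: "ev i y = ev j y" if ij: "i \<in> I" "j \<in> I" "PL i = PL j" "QL i = QL j" for i j y
  proof (rule ccontr)
    assume ne: "ev i y \<noteq> ev j y"
    define A B where "A = \<alpha> i - \<alpha> j" and "B = \<kappa> i - \<kappa> j"
    have AB: "ev i y - ev j y = A + B * y" for y by (simp add: ev_def A_def B_def algebra_simps)
    have nz: "A \<noteq> 0 \<or> B \<noteq> 0" using ne AB[of y] by auto
    obtain y1 y2 where y1: "y1 < 0" "P (ev i y1) y1" and y2: "y2 < 0" "P (ev j y2) y2"
      using touchP[OF ij(1)] touchP[OF ij(2)] by blast
    obtain y3 y4 where y3: "0 < y3" "Q (ev i y3) y3" and y4: "0 < y4" "Q (ev j y4) y4"
      using touchQ[OF ij(1)] touchQ[OF ij(2)] by blast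
    have "(A + B * y1) * (A + B * y2) \<le> 0"
      using y1(2) y2(2) that unfolding AB[symmetric] P
      by (auto simp: mult_le_0_iff split: if_splits)
    then have "0 < A * B" using affine_root_sign y1(1) y2(1) nz by blast
    moreover have "(A + (- B) * (- y3)) * (A + (- B) * (- y4)) \<le> 0"
      using y3(2) y4(2) that unfolding minus_mult_minus AB[symmetric] Q
      by (auto simp: mult_le_0_iff split: if_splits)
    then have "0 < A * (- B)"
      using affine_root_sign[of A "- B" "- y3" "- y4"] y3(1) y4(1) nz by simp
    ultimately show False by simp
  qed
  have sepP: "ev j 0 < ev i 0" if "i \<in> I" "j \<in> I" "PL i" "\<not> PL j" for i j
  proof -
    have "t2 \<le> ev i 0" "ev j 0 \<le> t1" using baseP(1,2) that unfolding P by auto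
    then show ?thesis using baseP(3) by linarith
  qed
  have sepQ: "ev j 0 < ev i 0" if "i \<in> I" "j \<in> I" "QL i" "\<not> QL j" for i j
  proof -
    have "s2 \<le> ev i 0" "ev j 0 \<le> s1" using baseQ(1,2) that unfolding Q by auto
    then show ?thesis using baseQ(3) by linarith
  qed
  \<comment> \<open>Without a line bounding \<open>P\<close> from the left, the base of
    \<open>P\<close> would extend beyond the bound \<open>K\<close>.\<close>
  have "\<exists>d\<in>I. \<not> PL d"
  proof (rule ccontr)
    assume "\<not> ?thesis"
    then have "P (min t1 (- K - 1)) 0" using baseP(1) unfolding P by (auto simp: min_le_iff_disj)
    then show False using bndP by fastforce
  qed
  then obtain d where d: "d \<in> I" "\<not> PL d" "\<not> QL d" using noRL by blast
  have "\<exists>a\<in>I. QL a"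
  proof (rule ccontr)
    assume "\<not> ?thesis"
    then have "Q (max s1 (K + 1)) 0" using baseQ(1) unfolding Q by (auto simp: le_max_iff_disj)
    then show False using bndQ by fastforce
  qed
  then obtain a where a: "a \<in> I" "QL a" "PL a" using noRL by blast
  \<comment> \<open>If no right bound ever came to the left of \<open>d\<close> below the base, the
    whole downward ray of the line \<open>d\<close> would belong to \<open>P\<close>, which is
    bounded.\<close>
  have "\<exists>y<0. \<exists>l\<in>I. PL l \<and> ev l y < ev d y"
  proof (rule ccontr)
    assume neg: "\<not> ?thesis"
    have "P (ev d y) y" if "y < 0" for y
      unfolding P
    proof (intro conjI ballI)
      fix i assume i: "i \<in> I"
      show "if PL i then ev d y \<le> ev i y else ev i y \<le> ev d y"
      proof (cases "PL i")
        case True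
        then have "\<not> ev i y < ev d y" using neg that i by blast
        then show ?thesis using True by simp
      next
        case False
        then show ?thesis using same[OF i d(1), of y] noRL[OF i] d by simp
      qed
    qed (use that in auto)
    from this[of "- \<bar>K\<bar> - 1"] show False using bndP by fastforce
  qed
  then obtain y l where l: "y < 0" "l \<in> I" "PL l" "ev l y < ev d y" by blast
  have "\<exists>y>0. \<exists>l\<in>I. \<not> QL l \<and> ev a y < ev l y"
  proof (rule ccontr)
    assume neg: "\<not> ?thesis"
    have "Q (ev a y) y" if "0 < y" for y
      unfolding Q
    proof (intro conjI ballI)
      fix i assume i: "i \<in> I"
      show "if QL i then ev a y \<le> ev i y else ev i y \<le> ev a y"
      proof (cases "QL i")
        case True
        then show ?thesis using same[OF i a(1), of y] noRL[OF i] a by simp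
      next
        case False
        then have "\<not> ev a y < ev i y" using neg that i by blast
        then show ?thesis using False by simp
      qed
    qed (use that in auto)
    from this[of "\<bar>K\<bar> + 1"] show False using bndQ by fastforce
  qed
  then obtain z m where m: "0 < z" "m \<in> I" "\<not> QL m" "ev a z < ev m z" by blast
  \<comment> \<open>The line \<open>l\<close> is to the right of \<open>d\<close> on the base and to
    its left at a negative \<open>y\<close>, so it stays to the right for all nonnegative
    \<open>y\<close>.\<close>
  have right: "ev d w < ev l w" if "0 \<le> w" for w
    using affine_positive_right[of "\<alpha> l - \<alpha> d" "\<kappa> l - \<kappa> d" y w] sepP[OF l(2) d(1) l(3) d(2)] l that
    by (simp add: ev_def algebra_simps)
  show False
  proof (cases "QL l")
    case True
    \<comment> \<open>Here \<open>l\<close> and \<open>a\<close> are the same line. The line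
      \<open>m\<close> that closes \<open>Q\<close> crosses \<open>a\<close> above the base, hence
      lies to the left of \<open>a\<close> below it and would cut off the point where
      \<open>a\<close> touches \<open>P\<close>.\<close>
    then have la: "ev l w = ev a w" for w using same[OF l(2) a(1)] l(3) a by simp
    have "PL m"
    proof (rule ccontr)
      assume "\<not> PL m"
      then have "ev m z = ev d z" using same[OF m(2) d(1)] m(3) d by simp
      then show False using right[of z] m(1,4) la[of z] by simp
    qed
    obtain v where v: "v < 0" "P (ev a v) v" using touchP[OF a(1)] by blast
    then have "ev a v \<le> ev m v" using \<open>PL m\<close> m(2) unfolding P by (metis (full_types))
    moreover have "ev m v < ev a v"
      using affine_positive_right[of "\<alpha> a - \<alpha> m" "- (\<kappa> a - \<kappa> m)" "- z" "- v"]
        sepQ[OF a(1) m(2) a(2) m(3)] m v(1)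
      by (simp add: ev_def algebra_simps)
    ultimately show False by simp
  next
    case False
    \<comment> \<open>Now \<open>l\<close> bounds \<open>Q\<close> from the left, as
      \<open>d\<close> does, but lies to the right of \<open>d\<close> above the base, so
      \<open>d\<close> cannot touch \<open>Q\<close>.\<close>
    obtain v where v: "0 < v" "Q (ev d v) v" using touchQ[OF d(1)] by blast
    then have "ev l v \<le> ev d v" using False l(2) unfolding Q by (metis (full_types))
    then show False using right[of v] v(1) by simp
  qed
qed

text \<open>Lines of the two mixed types cannot both occur, since the base intervals of
  \<open>P\<close> and \<open>Q\<close> would order their base points in opposite ways. If the type
  excluded in \<open>opposite_cells_aux\<close> is the one that occurs, the reflection of
  \<open>t\<close> exchanges the two.\<close>

lemma opposite_cells:
  fixes \<alpha> \<kappa> :: "'i \<Rightarrow> real" and PL QL :: "'i \<Rightarrow> bool"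
  assumes P: "\<And>t y. P t y \<longleftrightarrow> y \<le> 0 \<and>
      (\<forall>i\<in>I. if PL i then t \<le> \<alpha> i + \<kappa> i * y else \<alpha> i + \<kappa> i * y \<le> t)"
    and Q: "\<And>t y. Q t y \<longleftrightarrow> 0 \<le> y \<and>
      (\<forall>i\<in>I. if QL i then t \<le> \<alpha> i + \<kappa> i * y else \<alpha> i + \<kappa> i * y \<le> t)"
    and touchP: "\<And>i. i \<in> I \<Longrightarrow> \<exists>y<0. P (\<alpha> i + \<kappa> i * y) y"
    and touchQ: "\<And>i. i \<in> I \<Longrightarrow> \<exists>y>0. Q (\<alpha> i + \<kappa> i * y) y"
    and baseP: "P t1 0" "P t2 0" "t1 < t2" and baseQ: "Q s1 0" "Q s2 0" "s1 < s2"
    and bndP: "\<And>t y. P t y \<Longrightarrow> \<bar>t\<bar> \<le> K \<and> \<bar>y\<bar> \<le> K"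
    and bndQ: "\<And>t y. Q t y \<Longrightarrow> \<bar>t\<bar> \<le> K \<and> \<bar>y\<bar> \<le> K"
  shows False
proof (cases "\<exists>i\<in>I. \<not> PL i \<and> QL i")
  case False
  then show False
    using opposite_cells_aux[OF P Q touchP touchQ baseP baseQ bndP bndQ] by blast
next
  case True
  then obtain c where c: "c \<in> I" "\<not> PL c" "QL c" by blast
  have no: "\<not> PL i \<or> QL i" if "i \<in> I" for i
  proof (rule ccontr)
    assume neg: "\<not> (\<not> PL i \<or> QL i)"
    have "t2 \<le> \<alpha> i" "\<alpha> c \<le> t1" using baseP(1,2) that c neg unfolding P by auto
    moreover have "s2 \<le> \<alpha> c" "\<alpha> i \<le> s1" using baseQ(1,2) that c neg unfolding Q by auto
    ultimately show False using baseP(3) baseQ(3) by linarith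
  qed
  show False
  proof (rule opposite_cells_aux[of "\<lambda>t. P (- t)" I "\<lambda>i. \<not> PL i" "\<lambda>i. - \<alpha> i" "\<lambda>i. - \<kappa> i"
        "\<lambda>t. Q (- t)" "\<lambda>i. \<not> QL i" "- t2" "- t1" "- s2" "- s1" K])
    fix t y
    show "P (- t) y \<longleftrightarrow> y \<le> 0 \<and>
      (\<forall>i\<in>I. if \<not> PL i then t \<le> - \<alpha> i + - \<kappa> i * y else - \<alpha> i + - \<kappa> i * y \<le> t)"
      unfolding P by (intro conj_cong refl ball_cong) (auto simp: algebra_simps)
    show "Q (- t) y \<longleftrightarrow> 0 \<le> y \<and>
      (\<forall>i\<in>I. if \<not> QL i then t \<le> - \<alpha> i + - \<kappa> i * y else - \<alpha> i + - \<kappa> i * y \<le> t)"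
      unfolding Q by (intro conj_cong refl ball_cong) (auto simp: algebra_simps)
    show "P (- t) y \<Longrightarrow> \<bar>t\<bar> \<le> K \<and> \<bar>y\<bar> \<le> K" using bndP[of "- t" y] by simp
    show "Q (- t) y \<Longrightarrow> \<bar>t\<bar> \<le> K \<and> \<bar>y\<bar> \<le> K" using bndQ[of "- t" y] by simp
  next
    fix i assume i: "i \<in> I"
    have eq: "- (- \<alpha> i + - \<kappa> i * y) = \<alpha> i + \<kappa> i * y" for y by (simp add: algebra_simps)
    show "\<exists>y<0. P (- (- \<alpha> i + - \<kappa> i * y)) y" unfolding eq using touchP[OF i] .
    show "\<exists>y>0. Q (- (- \<alpha> i + - \<kappa> i * y)) y" unfolding eq using touchQ[OF i] .
    show "\<not> PL i \<or> \<not> \<not> QL i" using no[OF i] by simp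
  qed (use baseP baseQ in auto)
qed

definition same_line :: "plane \<Rightarrow> plane \<Rightarrow> plane \<Rightarrow> plane \<Rightarrow> bool" where
  "same_line p q p' q' \<longleftrightarrow> cross (q - p) (p' - p) = 0 \<and> cross (q - p) (q' - p) = 0"

lemma same_line_cross:
  assumes "same_line p q p' q'" "p \<noteq> q" "p' \<noteq> q'"
  obtains c where "c \<noteq> 0" "q' - p' = c *\<^sub>R (q - p)"
    "\<And>x. cross (q' - p') (x - p') = c * cross (q - p) (x - p)"
proof -
  obtain u v where u: "p' - p = u *\<^sub>R (q - p)" and v: "q' - p = v *\<^sub>R (q - p)"
    using assms cross_eq_0_parallelE[of "q - p"] unfolding same_line_def by (metis right_minus_eq)
  have d: "q' - p' = (v - u) *\<^sub>R (q - p)"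
    using u v by (simp add: scaleR_diff_left) (metis diff_diff_eq2 diff_add_cancel add_diff_cancel)
  have "cross (q' - p') (x - p') = (v - u) * cross (q - p) (x - p)" for x
  proof -
    have "cross (q - p) (x - p') = cross (q - p) ((x - p) - (p' - p))" by simp
    also have "\<dots> = cross (q - p) (x - p)"
      using assms(1) by (simp only: cross_simps(4) same_line_def)
    finally show ?thesis unfolding d by (simp only: cross_simps(7)) simp
  qed
  moreover have "v - u \<noteq> 0" using d assms(3) by auto
  ultimately show thesis using that d by blast
qed

lemma same_line_sym:
  assumes "same_line p q p' q'" "p \<noteq> q" "p' \<noteq> q'"
  shows "same_line p' q' p q"
proof -
  obtain c where "\<And>x. cross (q' - p') (x - p') = c * cross (q - p) (x - p)"
    using same_line_cross[OF assms] by blast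
  then show ?thesis unfolding same_line_def by (simp add: cross_simps(10))
qed

text \<open>The negative factor \<open>c\<close> says that \<open>P\<close> and \<open>Q\<close> lie
  on opposite sides of a common line. With \<open>t\<close> along that line and \<open>y\<close>
  along the outward normal of \<open>P\<close>, the cells are in the position of
  \<open>opposite_cells\<close>.\<close>

lemma polygon_opposite_sides:
  assumes P: "convex_polygon P" and Q: "convex_polygon Q"
    and PQ: "\<And>p q. side P p q \<Longrightarrow> \<exists>p' q'. side Q p' q' \<and> same_line p q p' q'"
    and QP: "\<And>p q. side Q p q \<Longrightarrow> \<exists>p' q'. side P p' q' \<and> same_line p q p' q'"
    and ab: "side P a b" and ab': "side Q a' b'" and line: "same_line a b a' b'"
    and c: "b' - a' = c *\<^sub>R (b - a)" "c < 0"
      "\<And>x. cross (b' - a') (x - a') = c * cross (b - a) (x - a)"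
  shows False
proof -
  define d where "d = b - a"
  define n where "n = (vector [d $ 2, - d $ 1] :: plane)"
  define D where "D = d \<bullet> d"
  define pt where "pt t y = a + t *\<^sub>R d + y *\<^sub>R n" for t y
  define tt where "tt x = (d \<bullet> (x - a)) / D" for x
  define yy where "yy x = - cross d (x - a) / D" for x
  have D: "0 < D" using side_neq[OF P ab] by (simp add: D_def d_def)
  have dn: "cross d n = - D" "d \<bullet> n = 0"
    by (simp_all add: n_def D_def cross_def inner_vec_def sum_2 algebra_simps)
  have pt: "pt (tt x) (yy x) = x" for x
  proof -
    have "D *\<^sub>R (x - a) = (d \<bullet> (x - a)) *\<^sub>R d - cross d (x - a) *\<^sub>R n"
      by (simp add: vec_eq_iff forall_2 D_def n_def cross_def inner_vec_def sum_2 algebra_simps)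
    then have "inverse D *\<^sub>R D *\<^sub>R (x - a)
        = inverse D *\<^sub>R ((d \<bullet> (x - a)) *\<^sub>R d - cross d (x - a) *\<^sub>R n)" by simp
    then have "x - a = tt x *\<^sub>R d + yy x *\<^sub>R n"
      using D by (simp add: tt_def yy_def scaleR_diff_right divide_inverse mult.commute)
    then show ?thesis unfolding pt_def by (metis add.assoc add.commute diff_add_cancel)
  qed
  have cross_pt: "cross d (pt t y - a) = - y * D" for t y
    unfolding pt_def by (simp add: cross_simps dn(1))
  have tt_pt: "tt (pt t y) = t" and yy_pt: "yy (pt t y) = y" for t y
    using D dn by (simp_all add: tt_def yy_def cross_pt) (simp add: pt_def inner_add_right D_def)
  define I where "I = {(p, q). side P p q} - {(a, b)}"
  have sideI: "side P (fst i) (snd i)" "i \<noteq> (a, b)" if "i \<in> I" for i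
    using that by (auto simp: I_def)
  define k where "k i = cross (snd i - fst i) d" for i
  define \<alpha> where "\<alpha> i = - cross (snd i - fst i) (a - fst i) / k i" for i
  define \<kappa> where "\<kappa> i = - cross (snd i - fst i) n / k i" for i
  have "\<forall>i\<in>I. \<exists>j. side Q (fst j) (snd j) \<and> same_line (fst i) (snd i) (fst j) (snd j)"
    using PQ[OF sideI(1)] by fastforce
  then obtain pr where pr: "\<And>i. i \<in> I \<Longrightarrow> side Q (fst (pr i)) (snd (pr i))"
    and pr_line: "\<And>i. i \<in> I \<Longrightarrow> same_line (fst i) (snd i) (fst (pr i)) (snd (pr i))"
    by metis
  have "\<forall>i\<in>I. \<exists>e. e \<noteq> 0 \<and> (\<forall>x. cross (snd (pr i) - fst (pr i)) (x - fst (pr i))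
      = e * cross (snd i - fst i) (x - fst i))"
    using same_line_cross[OF pr_line side_neq[OF P sideI(1)] side_neq[OF Q pr]] by metis
  then obtain e where e: "\<And>i. i \<in> I \<Longrightarrow> e i \<noteq> 0"
    and e_cross: "\<And>i x. i \<in> I \<Longrightarrow> cross (snd (pr i) - fst (pr i)) (x - fst (pr i))
      = e i * cross (snd i - fst i) (x - fst i)" by metis
  have posP: "0 \<le> cross d (x - a)" if "x \<in> P" for x
    using ab that by (simp add: side_def d_def)
  have negQ: "cross d (x - a) \<le> 0" if "x \<in> Q" for x
  proof -
    have "0 \<le> c * cross d (x - a)" using ab' that unfolding side_def c(3) d_def by blast
    then show ?thesis using c(2) by (simp add: zero_le_mult_iff)
  qed
  have onP: "\<exists>x\<in>P. cross (snd i - fst i) (x - fst i) = 0 \<and> 0 < cross d (x - a)" if i: "i \<in> I" for i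
  proof -
    have "\<not> (cross d (fst i - a) = 0 \<and> cross d (snd i - a) = 0)"
      using side_unique_on_line[OF P ab sideI(1)[OF i]] sideI(2)[OF i] by (auto simp: d_def)
    moreover have "fst i \<in> P" "snd i \<in> P" using side_endpoints[OF P sideI(1)[OF i]] .
    ultimately show ?thesis
      using posP[of "fst i"] posP[of "snd i"]
      by (cases "cross d (fst i - a) = 0")
        (intro bexI[of _ "snd i"] bexI[of _ "fst i"]; simp add: cross_simps(9,10))+
  qed
  have onQ: "\<exists>x\<in>Q. cross (snd i - fst i) (x - fst i) = 0 \<and> cross d (x - a) < 0" if i: "i \<in> I" for i
  proof -
    let ?p = "fst (pr i)" and ?q = "snd (pr i)"
    have "\<not> (cross d (?p - a) = 0 \<and> cross d (?q - a) = 0)"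
    proof
      assume "cross d (?p - a) = 0 \<and> cross d (?q - a) = 0"
      then have "a' = ?p \<and> b' = ?q"
        by (intro side_unique_on_line[OF Q ab' pr[OF i]]) (simp_all add: c(3) d_def)
      then have "same_line (fst i) (snd i) a' b'" using pr_line[OF i] by simp
      then have "same_line a' b' (fst i) (snd i)"
        by (rule same_line_sym[OF _ side_neq[OF P sideI(1)[OF i]] side_neq[OF Q ab']])
      then have "cross (b - a) (fst i - a) = 0" "cross (b - a) (snd i - a) = 0"
        using c(2) by (simp_all add: same_line_def c(3))
      then show False
        using side_unique_on_line[OF P ab sideI(1)[OF i]] sideI(2)[OF i] by auto
    qed
    moreover have "?p \<in> Q" "?q \<in> Q" using side_endpoints[OF Q pr[OF i]] .
    moreover have "cross (snd i - fst i) (?p - fst i) = 0" "cross (snd i - fst i) (?q - fst i) = 0"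
      using pr_line[OF i] by (simp_all add: same_line_def)
    ultimately show ?thesis using negQ[of ?p] negQ[of ?q] by (meson order_less_le)
  qed
  \<comment> \<open>Every other line has a point of \<open>P\<close> strictly below and one of
    \<open>Q\<close> strictly above the common line, so it is not parallel to it and is the graph of
    an affine function of \<open>y\<close>.\<close>
  have k: "k i \<noteq> 0" if i: "i \<in> I" for i
  proof
    assume k0: "k i = 0"
    obtain x x' where x: "cross (snd i - fst i) (x - fst i) = 0" "0 < cross d (x - a)"
      and x': "cross (snd i - fst i) (x' - fst i) = 0" "cross d (x' - a) < 0"
      using onP[OF i] onQ[OF i] by blast
    have "snd i - fst i \<noteq> 0" using side_neq[OF P sideI(1)[OF i]] by simp
    moreover have "cross (snd i - fst i) (x - x') = 0"
      using x(1) x'(1) by (simp add: cross_simps)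
    ultimately obtain u where "x - x' = u *\<^sub>R (snd i - fst i)" using cross_eq_0_parallelE by blast
    then have "cross d (x - x') = 0"
      using k0 cross_commute[of d "snd i - fst i"] by (simp add: k_def cross_simps(8))
    then show False using x(2) x'(2) by (simp add: cross_simps)
  qed
  have line_pt: "cross (snd i - fst i) (pt t y - fst i) = k i * (t - (\<alpha> i + \<kappa> i * y))"
    if "i \<in> I" for i t y
  proof -
    have "pt t y - fst i = (a - fst i) + t *\<^sub>R d + y *\<^sub>R n" by (simp add: pt_def)
    then have "cross (snd i - fst i) (pt t y - fst i) = cross (snd i - fst i) (a - fst i)
        + t * k i + y * cross (snd i - fst i) n"
      by (simp only: cross_simps(2,8) k_def) simp
    then show ?thesis using k[OF that] by (simp add: \<alpha>_def \<kappa>_def field_simps)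
  qed
  have on_line: "tt x = \<alpha> i + \<kappa> i * yy x" if "i \<in> I" "cross (snd i - fst i) (x - fst i) = 0" for i x
    using line_pt[OF that(1), of "tt x" "yy x"] that k[OF that(1)] by (simp add: pt)
  have "compact (P \<union> Q)"
    using polygon_compact P Q by blast
  moreover have "continuous_on (P \<union> Q) (\<lambda>x. \<bar>tt x\<bar> + \<bar>yy x\<bar>)"
    unfolding tt_def yy_def using D by (intro continuous_intros) auto
  ultimately have "bounded ((\<lambda>x. \<bar>tt x\<bar> + \<bar>yy x\<bar>) ` (P \<union> Q))"
    by (intro compact_imp_bounded compact_continuous_image)
  then obtain K where K: "\<And>x. x \<in> P \<union> Q \<Longrightarrow> \<bar>\<bar>tt x\<bar> + \<bar>yy x\<bar>\<bar> \<le> K"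
    unfolding bounded_iff by (metis image_eqI real_norm_def)
  have bnd: "\<bar>t\<bar> \<le> K \<and> \<bar>y\<bar> \<le> K" if "pt t y \<in> P \<union> Q" for t y
    using K[OF that] by (simp add: tt_pt yy_pt) linarith
  have ptP: "pt t y \<in> P \<longleftrightarrow> y \<le> 0 \<and>
      (\<forall>i\<in>I. if k i < 0 then t \<le> \<alpha> i + \<kappa> i * y else \<alpha> i + \<kappa> i * y \<le> t)" for t y
  proof -
    have "pt t y \<in> P \<longleftrightarrow> 0 \<le> cross (b - a) (pt t y - a) \<and>
        (\<forall>i\<in>I. 0 \<le> cross (snd i - fst i) (pt t y - fst i))"
      (is "_ \<longleftrightarrow> ?R")
    proof
      assume R: ?R
      show "pt t y \<in> P" unfolding polygon_halfplanes[OF P]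
      proof (intro allI impI)
        fix p q assume s: "side P p q"
        show "0 \<le> cross (q - p) (pt t y - p)"
        proof (cases "(p, q) = (a, b)")
          case False
          then have "(p, q) \<in> I" using s by (simp add: I_def)
          then show ?thesis using R by force
        qed (use R in simp)
      qed
    qed (use polygon_halfplanes[OF P, of "pt t y"] ab sideI(1) in blast)
    also have "0 \<le> cross (b - a) (pt t y - a) \<longleftrightarrow> y \<le> 0"
      using cross_pt[of t y] D by (simp add: d_def mult_le_0_iff)
    also have "(\<forall>i\<in>I. 0 \<le> cross (snd i - fst i) (pt t y - fst i)) \<longleftrightarrow>
        (\<forall>i\<in>I. if k i < 0 then t \<le> \<alpha> i + \<kappa> i * y else \<alpha> i + \<kappa> i * y \<le> t)"
      using k by (intro ball_cong refl) (auto simp: line_pt zero_le_mult_iff)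
    finally show ?thesis .
  qed
  have ptQ: "pt t y \<in> Q \<longleftrightarrow> 0 \<le> y \<and>
      (\<forall>i\<in>I. if e i * k i < 0 then t \<le> \<alpha> i + \<kappa> i * y else \<alpha> i + \<kappa> i * y \<le> t)" for t y
  proof -
    have "pt t y \<in> Q \<longleftrightarrow> 0 \<le> cross (b' - a') (pt t y - a') \<and>
        (\<forall>i\<in>I. 0 \<le> cross (snd (pr i) - fst (pr i)) (pt t y - fst (pr i)))" (is "_ \<longleftrightarrow> ?R")
    proof
      assume R: ?R
      show "pt t y \<in> Q"
        unfolding polygon_halfplanes[OF Q]
      proof (intro allI impI)
        fix p' q' assume s': "side Q p' q'"
        obtain p q where s: "side P p q" "same_line p' q' p q" using QP[OF s'] by blast
        have l: "same_line p q p' q'"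
          by (rule same_line_sym[OF s(2) side_neq[OF Q s'] side_neq[OF P s(1)]])
        show "0 \<le> cross (q' - p') (pt t y - p')"
        proof (cases "(p, q) = (a, b)")
          case True
          then have "a' = p' \<and> b' = q'"
            using l by (intro side_unique_on_line[OF Q ab' s']) (simp_all add: c(3) same_line_def)
          then show ?thesis using R by simp
        next
          case False
          then have i: "(p, q) \<in> I" using s(1) by (simp add: I_def)
          have "fst (pr (p, q)) = p' \<and> snd (pr (p, q)) = q'"
            using l by (intro side_unique_on_line[OF Q pr[OF i] s'])
              (simp_all add: e_cross[OF i] same_line_def)
          then show ?thesis using R i by force
        qed
      qed
    qed (use polygon_halfplanes[OF Q, of "pt t y"] ab' pr in blast)
    also have "0 \<le> cross (b' - a') (pt t y - a') \<longleftrightarrow> 0 \<le> y"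
      unfolding c(3) using cross_pt[of t y] D c(2) by (auto simp: d_def mult_le_0_iff zero_le_mult_iff)
    also have "(\<forall>i\<in>I. 0 \<le> cross (snd (pr i) - fst (pr i)) (pt t y - fst (pr i))) \<longleftrightarrow>
        (\<forall>i\<in>I. 0 \<le> (e i * k i) * (t - (\<alpha> i + \<kappa> i * y)))"
      by (intro ball_cong refl) (simp add: e_cross line_pt mult.assoc)
    also have "\<dots> \<longleftrightarrow>
        (\<forall>i\<in>I. if e i * k i < 0 then t \<le> \<alpha> i + \<kappa> i * y else \<alpha> i + \<kappa> i * y \<le> t)"
    proof (intro ball_cong refl)
      fix i assume i: "i \<in> I"
      have "e i * k i \<noteq> 0" using e[OF i] k[OF i] by simp
      then show "0 \<le> (e i * k i) * (t - (\<alpha> i + \<kappa> i * y)) \<longleftrightarrow>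
          (if e i * k i < 0 then t \<le> \<alpha> i + \<kappa> i * y else \<alpha> i + \<kappa> i * y \<le> t)"
        by (subst zero_le_mult_iff) auto
    qed
    finally show ?thesis .
  qed
  obtain u where u: "a' - a = u *\<^sub>R d"
    using line cross_eq_0_parallelE[of d "a' - a"] D by (auto simp: same_line_def d_def D_def)
  have base: "pt 0 0 = a" "pt 1 0 = b" "pt u 0 = a'" "pt (u + c) 0 = b'"
  proof -
    have "a' = a + u *\<^sub>R d" "b' = a' + c *\<^sub>R d"
      using u c(1) by (metis d_def add.commute diff_add_cancel)+
    then show "pt u 0 = a'" "pt (u + c) 0 = b'" by (simp_all add: pt_def scaleR_add_left)
  qed (simp_all add: pt_def d_def)
  show False
  proof (rule opposite_cells[of "\<lambda>t y. pt t y \<in> P" I "\<lambda>i. k i < 0" \<alpha> \<kappa>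
        "\<lambda>t y. pt t y \<in> Q" "\<lambda>i. e i * k i < 0" 0 1 "u + c" u K])
    show "pt 0 0 \<in> P" "pt 1 0 \<in> P" "pt (u + c) 0 \<in> Q" "pt u 0 \<in> Q" "u + c < u" "(0::real) < 1"
      unfolding base using side_endpoints[OF P ab] side_endpoints[OF Q ab'] c(2) by simp_all
    fix i assume i: "i \<in> I"
    obtain x where x: "x \<in> P" "cross (snd i - fst i) (x - fst i) = 0" "0 < cross d (x - a)"
      using onP[OF i] by blast
    then show "\<exists>y<0. pt (\<alpha> i + \<kappa> i * y) y \<in> P"
      using D pt[of x] on_line[OF i x(2)] by (intro exI[of _ "yy x"]) (simp add: yy_def)
    obtain x where x: "x \<in> Q" "cross (snd i - fst i) (x - fst i) = 0" "cross d (x - a) < 0"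
      using onQ[OF i] by blast
    then show "\<exists>y>0. pt (\<alpha> i + \<kappa> i * y) y \<in> Q"
      using D pt[of x] on_line[OF i x(2)] by (intro exI[of _ "yy x"]) (simp add: yy_def divide_neg_pos)
  qed (use bnd ptP ptQ in blast)+
qed

text \<open>By \<open>polygon_opposite_sides\<close> the two polygons lie on the same side of each
  common line, so they are intersections of the same half-planes. This makes the tiles of an
  equivalent tiling functions of the intercepts.\<close>

theorem polygon_lines_unique:
  assumes P: "convex_polygon P" and Q: "convex_polygon Q"
    and PQ: "\<And>p q. side P p q \<Longrightarrow> \<exists>p' q'. side Q p' q' \<and> same_line p q p' q'"
    and QP: "\<And>p q. side Q p q \<Longrightarrow> \<exists>p' q'. side P p' q' \<and> same_line p q p' q'"
  shows "P = Q"
proof -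
  have main: "\<exists>c>0. \<forall>x. cross (q' - p') (x - p') = c * cross (q - p) (x - p)"
    if s: "side P p q" "side Q p' q'" "same_line p q p' q'" for p q p' q'
  proof -
    obtain c where c: "c \<noteq> 0" "q' - p' = c *\<^sub>R (q - p)"
      "\<And>x. cross (q' - p') (x - p') = c * cross (q - p) (x - p)"
      using same_line_cross[OF s(3) side_neq[OF P s(1)] side_neq[OF Q s(2)]] by blast
    have "\<not> c < 0" using polygon_opposite_sides[OF P Q PQ QP s c(2) _ c(3)] by blast
    then have "0 < c" using c(1) by simp
    then show ?thesis using c(3) by blast
  qed
  show ?thesis
  proof
    show "P \<subseteq> Q"
    proof
      fix x assume x: "x \<in> P"
      show "x \<in> Q" unfolding polygon_halfplanes[OF Q]
      proof (intro allI impI)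
        fix p' q' assume s': "side Q p' q'"
        obtain p q where s: "side P p q" "same_line p' q' p q" using QP[OF s'] by blast
        have "same_line p q p' q'"
          by (rule same_line_sym[OF s(2) side_neq[OF Q s'] side_neq[OF P s(1)]])
        then obtain c where "0 < c" "cross (q' - p') (x - p') = c * cross (q - p) (x - p)"
          using main[OF s(1) s'] by blast
        moreover have "0 \<le> cross (q - p) (x - p)" using s(1) x by (simp add: side_def)
        ultimately show "0 \<le> cross (q' - p') (x - p')" by simp
      qed
    qed
    show "Q \<subseteq> P"
    proof
      fix x assume x: "x \<in> Q"
      show "x \<in> P" unfolding polygon_halfplanes[OF P]
      proof (intro allI impI)
        fix p q assume s: "side P p q"
        obtain p' q' where s': "side Q p' q'" "same_line p q p' q'" using PQ[OF s] by blast
        obtain c where "0 < c" "cross (q' - p') (x - p') = c * cross (q - p) (x - p)"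
          using main[OF s s'] by blast
        moreover have "0 \<le> cross (q' - p') (x - p')" using s'(1) x by (simp add: side_def)
        ultimately show "0 \<le> cross (q - p) (x - p)" by (simp add: zero_le_mult_iff)
      qed
    qed
  qed
qed

section \<open>Segments and tiles\<close>

lemma closed_segment_line_image:
  fixes a d :: "'a::real_vector"
  shows "closed_segment (a + u *\<^sub>R d) (a + v *\<^sub>R d) = (\<lambda>x. a + x *\<^sub>R d) ` closed_segment u v"
proof -
  have "a + u *\<^sub>R d + t *\<^sub>R (a + v *\<^sub>R d - (a + u *\<^sub>R d)) = a + (u + t *\<^sub>R (v - u)) *\<^sub>R d" for t :: real
    by (simp add: algebra_simps)
  then have "closed_segment (a + u *\<^sub>R d) (a + v *\<^sub>R d)
      = (\<lambda>t. a + (u + t *\<^sub>R (v - u)) *\<^sub>R d) ` {0..1}"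
    unfolding segment_image_interval(1) by (intro image_cong refl) (simp add: algebra_simps)
  moreover have "closed_segment u v = (\<lambda>t. u + t *\<^sub>R (v - u)) ` {0..1}"
    unfolding segment_image_interval(1) by (intro image_cong refl) (simp add: algebra_simps)
  ultimately show ?thesis by (simp add: image_image)
qed

text \<open>The parameter is normalised to 0 at \<open>p\<close> and 1 at \<open>q\<close>,
  whichever way \<open>a\<close> and \<open>b\<close> are ordered, so that segments containing
  \<open>p q\<close> can be compared as real intervals.\<close>

lemma closed_segment_subsegment:
  fixes p q :: "'a::real_vector"
  assumes "p \<noteq> q" "closed_segment p q \<subseteq> closed_segment a b"
  obtains u v where "u \<le> 0" "1 \<le> v" "closed_segment a b = (\<lambda>x. p + x *\<^sub>R (q - p)) ` {u..v}"
proof -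
  have "p \<in> closed_segment a b" "q \<in> closed_segment a b" using assms(2) by auto
  then obtain s t where st: "0 \<le> s" "s \<le> 1" "0 \<le> t" "t \<le> 1"
      "p = a + s *\<^sub>R (b - a)" "q = a + t *\<^sub>R (b - a)"
    unfolding closed_segment_iff by blast
  have ne: "t - s \<noteq> 0" using st(5,6) assms(1) by auto
  have d: "q - p = (t - s) *\<^sub>R (b - a)" unfolding st(5,6) by (simp add: scaleR_diff_left)
  define u v where "u = - s / (t - s)" and "v = (1 - s) / (t - s)"
  have uv: "u *\<^sub>R (q - p) = - s *\<^sub>R (b - a)" "v *\<^sub>R (q - p) = (1 - s) *\<^sub>R (b - a)"
    using ne by (simp_all add: d u_def v_def)
  have ab: "a = p + u *\<^sub>R (q - p)" "b = p + v *\<^sub>R (q - p)"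
    by (simp_all only: uv, simp_all add: st(5) algebra_simps)
  have eq: "closed_segment a b = (\<lambda>x. p + x *\<^sub>R (q - p)) ` closed_segment u v"
    using closed_segment_line_image[of p u "q - p" v] ab by simp
  show thesis
  proof (cases "s < t")
    case True
    then have "u \<le> 0" "1 \<le> v" using st by (simp_all add: u_def v_def)
    then show thesis using that[of u v] eq by (simp add: closed_segment_eq_real_ivl)
  next
    case False
    then have "v \<le> 0" "1 \<le> u" using st ne by (simp_all add: u_def v_def divide_nonneg_neg field_simps)
    then show thesis using that[of v u] eq by (simp add: closed_segment_eq_real_ivl)
  qed
qed

lemma rel_interior_segment:
  fixes a b :: plane
  assumes "a \<noteq> b"
  shows "rel_interior (closed_segment a b) = open_segment a b"
  using assms by (simp add: rel_interior_closed_segment)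

section \<open>Maximal segments and the tiles along them\<close>

locale polygon_tiling =
  fixes R :: "plane set" and W :: "plane set set"
  assumes tiling: "tiling R W"
begin

lemma R_polygon: "convex_polygon R" and finite_W: "finite W" and Union_W: "\<Union>W = R"
  and tile_polygon: "w \<in> W \<Longrightarrow> convex_polygon w"
  and tile_disjoint: "v \<in> W \<Longrightarrow> w \<in> W \<Longrightarrow> v \<noteq> w \<Longrightarrow> interior v \<inter> interior w = {}"
  using tiling by (auto simp: tiling_def pairwise_def)

lemma tile_subset: "w \<in> W \<Longrightarrow> w \<subseteq> R"
  using Union_W by auto

lemma tile_eq_of_interior: "v \<in> W \<Longrightarrow> w \<in> W \<Longrightarrow> x \<in> interior v \<Longrightarrow> x \<in> interior w \<Longrightarrow> v = w"
  using tile_disjoint by blast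

lemma skeleton_subset: "skeleton W \<subseteq> R"
  unfolding skeleton_def
  using tile_subset frontier_subset_closed[OF polygon_closed[OF tile_polygon]] by blast

lemma closed_skeleton: "closed (skeleton W)"
  unfolding skeleton_def using finite_W by (intro closed_UN) auto

lemma interior_not_skeleton:
  assumes w: "w \<in> W" "x \<in> interior w"
  shows "x \<notin> skeleton W"
proof
  assume "x \<in> skeleton W"
  then obtain v where v: "v \<in> W" "x \<in> frontier v" by (auto simp: skeleton_def)
  have "v \<noteq> w" using v(2) w(2) by (auto simp: frontier_def)
  have "closure (interior v) = closure v"
    using tile_polygon[OF v(1)] polygon_convex[OF tile_polygon[OF v(1)]]
    by (intro convex_closure_interior) (auto simp: convex_polygon_def)
  then have "x \<in> interior w \<inter> closure (interior v)" using v(2) w(2) by (simp add: frontier_def)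
  then have "interior w \<inter> interior v \<noteq> {}"
    using open_Int_closure_eq_empty[of "interior w" "interior v"] by auto
  then show False using tile_disjoint[OF v(1) w(1) \<open>v \<noteq> w\<close>] by blast
qed

lemma side_skeleton:
  assumes "w \<in> W" "side w p q"
  shows "closed_segment p q \<subseteq> skeleton W"
proof
  fix x assume "x \<in> closed_segment p q"
  then have "x \<in> frontier w" using frontier_sides[OF tile_polygon[OF assms(1)]] assms(2) by blast
  then show "x \<in> skeleton W" using assms(1) by (auto simp: skeleton_def)
qed

lemma frontier_R_skeleton: "frontier R \<subseteq> skeleton W"
proof
  fix x assume x: "x \<in> frontier R"
  then have "x \<in> R" using frontier_subset_closed[OF polygon_closed[OF R_polygon]] by blast
  then obtain w where w: "w \<in> W" "x \<in> w" using Union_W by auto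
  have "x \<notin> interior w" using interior_mono[OF tile_subset[OF w(1)]] x by (auto simp: frontier_def)
  then have "x \<in> frontier w" using w(2) closure_subset by (auto simp: frontier_def)
  then show "x \<in> skeleton W" using w(1) by (auto simp: skeleton_def)
qed

lemma segmentsE:
  assumes "s \<in> segments W"
  obtains a b where "a \<noteq> b" "s = closed_segment a b" "s \<subseteq> skeleton W"
  using assms by (auto simp: segments_def)

lemma segments_maximal:
  "s \<in> segments W \<Longrightarrow> s \<subseteq> closed_segment c d \<Longrightarrow> closed_segment c d \<subseteq> skeleton W
    \<Longrightarrow> closed_segment c d = s"
  by (auto simp: segments_def)

lemma segment_subset_R: "s \<in> segments W \<Longrightarrow> s \<subseteq> R"
  using segmentsE skeleton_subset by (metis subset_trans)

text \<open>The segments in the skeleton that contain \<open>p q\<close> correspond to a compact set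
  of parameter pairs; a pair of maximal length gives a maximal segment.\<close>

lemma segment_exists:
  assumes "p \<noteq> q" "closed_segment p q \<subseteq> skeleton W"
  obtains s where "s \<in> segments W" "closed_segment p q \<subseteq> s"
proof -
  define d where "d = q - p"
  have d: "d \<noteq> 0" using assms(1) by (simp add: d_def)
  define f where "f x = p + x *\<^sub>R d" for x
  \<comment> \<open>Containment in the skeleton is expressed through convex combinations of
    \<open>u\<close> and \<open>v\<close>, which makes \<open>C\<close> an intersection of preimages
    of a closed set.\<close>
  define C where "C = {(u, v). u \<le> 0 \<and> 1 \<le> v \<and> (\<forall>t\<in>{0..1}. f ((1 - t) * u + t * v) \<in> skeleton W)}"
  have img: "f ` {u..v} = closed_segment (f u) (f v)" if "u \<le> v" for u v
    using closed_segment_line_image[of p u d v] that by (simp add: f_def closed_segment_eq_real_ivl)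
  have C_iff: "(u, v) \<in> C \<longleftrightarrow> u \<le> 0 \<and> 1 \<le> v \<and> f ` {u..v} \<subseteq> skeleton W" for u v
  proof -
    have "(\<forall>t\<in>{0..1}. f ((1 - t) * u + t * v) \<in> skeleton W) \<longleftrightarrow> f ` {u..v} \<subseteq> skeleton W"
      if "u \<le> 0" "1 \<le> v"
    proof -
      have "{u..v} = closed_segment u v" using that by (simp add: closed_segment_eq_real_ivl)
      then have "{u..v} = (\<lambda>t. (1 - t) * u + t * v) ` {0..1}"
        by (simp add: segment_image_interval)
      then show ?thesis by auto
    qed
    then show ?thesis unfolding C_def by auto
  qed
  have "closed C"
  proof -
    have "closed {z::real\<times>real. f ((1 - t) * fst z + t * snd z) \<in> skeleton W}" for t
    proof -
      have "closed ((\<lambda>z::real\<times>real. f ((1 - t) * fst z + t * snd z)) -` skeleton W)"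
        unfolding f_def by (intro closed_vimage closed_skeleton continuous_intros)
      then show ?thesis by (simp add: vimage_def)
    qed
    then have "closed ({z::real\<times>real. fst z \<le> 0} \<inter> {z. 1 \<le> snd z} \<inter>
        (\<Inter>t\<in>{0..1}. {z. f ((1 - t) * fst z + t * snd z) \<in> skeleton W}))"
      by (intro closed_Int closed_INT closed_Collect_le continuous_intros) auto
    moreover have "C = {z::real\<times>real. fst z \<le> 0} \<inter> {z. 1 \<le> snd z} \<inter>
        (\<Inter>t\<in>{0..1}. {z. f ((1 - t) * fst z + t * snd z) \<in> skeleton W})"
      by (auto simp: C_def)
    ultimately show ?thesis by simp
  qed
  moreover have "bounded C"
  proof -
    have "bounded (skeleton W)"
      using skeleton_subset compact_imp_bounded[OF polygon_compact[OF R_polygon]] bounded_subset by blast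
    then obtain B where B: "\<And>x. x \<in> skeleton W \<Longrightarrow> norm x \<le> B" by (auto simp: bounded_iff)
    have bd: "\<bar>u\<bar> \<le> (B + norm p) / norm d" if "f u \<in> skeleton W" for u
    proof -
      have "\<bar>u\<bar> * norm d = norm (f u - p)" by (simp add: f_def)
      also have "\<dots> \<le> B + norm p" using norm_triangle_ineq4[of "f u" p] B[OF that] by linarith
      finally show ?thesis using d by (simp add: field_simps)
    qed
    have "C \<subseteq> {- ((B + norm p) / norm d)..(B + norm p) / norm d} \<times>
        {- ((B + norm p) / norm d)..(B + norm p) / norm d}"
    proof
      fix z assume z: "z \<in> C"
      obtain u v where uv: "z = (u, v)" by (cases z)
      have "f u \<in> skeleton W" "f v \<in> skeleton W" using z unfolding uv C_iff by auto
      then show "z \<in> {- ((B + norm p) / norm d)..(B + norm p) / norm d} \<times>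
          {- ((B + norm p) / norm d)..(B + norm p) / norm d}"
        using bd[of u] bd[of v] unfolding uv abs_le_iff by (simp add: minus_le_iff)
    qed
    then show ?thesis using bounded_Times bounded_closed_interval bounded_subset by metis
  qed
  ultimately have compact: "compact C" by (simp add: compact_eq_bounded_closed)
  have f01: "f 0 = p" "f 1 = q" by (simp_all add: f_def d_def)
  have "(0, 1) \<in> C" using img[of 0 1] assms(2) f01 by (simp add: C_iff)
  then have ne: "C \<noteq> {}" by auto
  have cont: "continuous_on C (\<lambda>z. snd z - fst z)" by (intro continuous_intros)
  obtain z where z: "z \<in> C" "\<And>y. y \<in> C \<Longrightarrow> snd y - fst y \<le> snd z - fst z"
    using continuous_attains_sup[OF compact ne cont] by blast
  obtain u v where uv: "z = (u, v)" by (cases z)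
  have C: "u \<le> 0" "1 \<le> v" "f ` {u..v} \<subseteq> skeleton W" using z(1) unfolding uv C_iff by auto
  have inj: "f x = f y \<Longrightarrow> x = y" for x y using d by (simp add: f_def)
  have "closed_segment p q = f ` {0..1}" using img[of 0 1] f01 by simp
  then have sub: "closed_segment p q \<subseteq> f ` {u..v}" using C by auto
  show thesis
  proof (rule that[of "f ` {u..v}"])
    show "closed_segment p q \<subseteq> f ` {u..v}" by (rule sub)
    show "f ` {u..v} \<in> segments W"
      unfolding segments_def
    proof (intro CollectI conjI allI impI)
      have "f u \<noteq> f v" using inj[of u v] C by auto
      then show "\<exists>a b. a \<noteq> b \<and> f ` {u..v} = closed_segment a b" using img[of u v] C by auto
      fix c e assume ce: "f ` {u..v} \<subseteq> closed_segment c e \<and> closed_segment c e \<subseteq> skeleton W"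
      have "closed_segment p q \<subseteq> closed_segment c e"
        using ce sub by blast
      then obtain u' v' where uv': "u' \<le> 0" "1 \<le> v'" "closed_segment c e = f ` {u'..v'}"
        using closed_segment_subsegment[OF assms(1)] unfolding f_def d_def by blast
      have "f ` {u..v} \<subseteq> f ` {u'..v'}" using ce uv'(3) by simp
      moreover have "inj f" using inj by (rule injI)
      ultimately have "{u..v} \<subseteq> {u'..v'}" by (simp only: inj_image_subset_iff)
      then have "u' \<le> u" "v \<le> v'" using C by simp_all
      moreover have "(u', v') \<in> C" using uv' ce by (simp add: C_iff)
      then have "v' - u' \<le> v - u" using z(2) uv by fastforce
      ultimately have "u' = u" "v' = v" by linarith+
      then show "closed_segment c e = f ` {u..v}" using uv'(3) by simp
    qed (rule C(3))
  qed
qed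

text \<open>Two segments with a nondegenerate common piece are collinear, so their union is again a
  segment of the skeleton, and by maximality it equals both.\<close>

lemma segment_unique:
  assumes s: "s \<in> segments W" "s' \<in> segments W"
    and pq: "p \<noteq> q" "closed_segment p q \<subseteq> s" "closed_segment p q \<subseteq> s'"
  shows "s = s'"
proof -
  define f where "f x = p + x *\<^sub>R (q - p)" for x
  obtain a b where ab: "s = closed_segment a b" "s \<subseteq> skeleton W" using segmentsE[OF s(1)] .
  obtain a' b' where ab': "s' = closed_segment a' b'" "s' \<subseteq> skeleton W" using segmentsE[OF s(2)] .
  obtain u v where uv: "u \<le> 0" "1 \<le> v" "s = f ` {u..v}"
    using closed_segment_subsegment[OF pq(1)] pq(2) unfolding ab(1) f_def by blast
  obtain u' v' where uv': "u' \<le> 0" "1 \<le> v'" "s' = f ` {u'..v'}"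
    using closed_segment_subsegment[OF pq(1)] pq(3) unfolding ab'(1) f_def by blast
  let ?T = "closed_segment (f (min u u')) (f (max v v'))"
  have "?T = f ` {min u u'..max v v'}"
    using closed_segment_line_image[of p "min u u'" "q - p" "max v v'"] uv uv'
    by (simp add: f_def closed_segment_eq_real_ivl)
  also have "{min u u'..max v v'} = {u..v} \<union> {u'..v'}" using uv uv' by auto
  finally have T: "?T = s \<union> s'" using uv(3) uv'(3) by (simp add: image_Un)
  then have "?T = s" "?T = s'"
    using segments_maximal[OF s(1), of "f (min u u')" "f (max v v')"]
      segments_maximal[OF s(2), of "f (min u u')" "f (max v v')"] ab(2) ab'(2) by auto
  then show ?thesis by simp
qed

definition sg :: "plane \<Rightarrow> plane \<Rightarrow> plane set" where
  "sg p q = (THE s. s \<in> segments W \<and> closed_segment p q \<subseteq> s)"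

lemma sg_eqI:
  assumes "s \<in> segments W" "closed_segment p q \<subseteq> s" "p \<noteq> q"
  shows "sg p q = s"
  unfolding sg_def using assms segment_unique by (intro the_equality) auto

lemma sg:
  assumes "w \<in> W" "side w p q"
  shows "sg p q \<in> segments W" "closed_segment p q \<subseteq> sg p q"
proof -
  have ne: "p \<noteq> q" using side_neq[OF tile_polygon[OF assms(1)] assms(2)] .
  obtain s where s: "s \<in> segments W" "closed_segment p q \<subseteq> s"
    using segment_exists[OF ne side_skeleton[OF assms]] .
  then show "sg p q \<in> segments W" "closed_segment p q \<subseteq> sg p q"
    using sg_eqI[OF s ne] by simp_all
qed

lemma sg_points: "w \<in> W \<Longrightarrow> side w p q \<Longrightarrow> p \<in> sg p q \<and> q \<in> sg p q"
  using sg(2)[of w p q] by auto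

lemma segment_cross:
  assumes "s \<in> segments W" "x \<in> s" "y \<in> s" "x' \<in> s" "y' \<in> s"
  shows "cross (y - x) (y' - x') = 0"
proof -
  obtain a b where ab: "s = closed_segment a b" using segmentsE[OF assms(1)] .
  obtain t1 t2 t3 t4 where "x = a + t1 *\<^sub>R (b - a)" "y = a + t2 *\<^sub>R (b - a)"
    "x' = a + t3 *\<^sub>R (b - a)" "y' = a + t4 *\<^sub>R (b - a)"
    using assms(2-) unfolding ab closed_segment_iff by blast
  then have "y - x = (t2 - t1) *\<^sub>R (b - a)" "y' - x' = (t4 - t3) *\<^sub>R (b - a)"
    by (simp_all add: scaleR_diff_left)
  then show ?thesis by (simp add: cross_simps(7,8))
qed

lemma sg_inj:
  assumes "w \<in> W" "side w p q" "side w p' q'" "sg p q = sg p' q'"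
  shows "p = p' \<and> q = q'"
proof (rule side_unique_on_line[OF tile_polygon[OF assms(1)] assms(2,3)])
  have "p \<in> sg p q" "q \<in> sg p q" "p' \<in> sg p q" "q' \<in> sg p q"
    using sg_points[OF assms(1,2)] sg_points[OF assms(1,3)] assms(4) by auto
  then show "cross (q - p) (p' - p) = 0" "cross (q - p) (q' - p) = 0"
    using segment_cross[OF sg(1)[OF assms(1,2)]] by auto
qed

lemma incident_iff:
  assumes "w \<in> W" "s \<in> segments W"
  shows "incident w s \<longleftrightarrow> (\<exists>p q. side w p q \<and> sg p q = s)"
proof
  assume "incident w s"
  then obtain e where e: "e edge_of w" "e \<subseteq> s" by (auto simp: incident_def)
  obtain p q where "e = closed_segment p q" "side w p q"
    using edge_side[OF tile_polygon[OF assms(1)] e(1)] .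
  then show "\<exists>p q. side w p q \<and> sg p q = s"
    using sg_eqI[OF assms(2)] e(2) side_neq[OF tile_polygon[OF assms(1)]] by blast
next
  assume "\<exists>p q. side w p q \<and> sg p q = s"
  then show "incident w s"
    using sg(2)[OF assms(1)] unfolding incident_def side_def by blast
qed

lemma ccw_edge_sg:
  assumes "w \<in> W" "s \<in> segments W"
  shows "ccw_edge w s p q \<longleftrightarrow> side w p q \<and> sg p q = s"
  unfolding ccw_edge_iff
  using sg_eqI[OF assms(2)] sg(2)[OF assms(1)] side_neq[OF tile_polygon[OF assms(1)]] by blast

text \<open>Points of the segment converging to \<open>x\<close> each lie in a tile that reaches to
  the side of \<open>c\<close>. One of the finitely many tiles contains infinitely many of them,
  hence also \<open>x\<close>, and one of its sides runs along the segment from \<open>x\<close>.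
  The vector \<open>d\<close> may be a positive or negative multiple of \<open>y - x\<close>; its
  sign selects a side of the segment.\<close>

lemma segment_tile:
  assumes s: "s \<in> segments W" and xy: "x \<in> s" "y \<in> s" "x \<noteq> y"
    and d: "d = k *\<^sub>R (y - x)" and c: "c \<in> R" "0 < cross d (c - x)"
  obtains w p q z l where "w \<in> W" "side w p q" "sg p q = s" "z \<in> open_segment x y"
    "closed_segment x z \<subseteq> closed_segment p q" "0 < l" "q - p = l *\<^sub>R d"
proof -
  obtain a b where ab: "s = closed_segment a b" "s \<subseteq> skeleton W" using segmentsE[OF s] .
  define X where "X n = x + (1 / (real n + 2)) *\<^sub>R (y - x)" for n
  have Xo: "X n \<in> open_segment x y" for n
    unfolding open_segment_iff X_def using xy(3)
    by (intro conjI exI[of _ "1 / (real n + 2)"]) auto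
  have xys: "closed_segment x y \<subseteq> s"
    unfolding ab(1) using xy(1,2) ab(1) by (intro closed_segment_subset) auto
  have Xs: "X n \<in> s" for n using Xo xys open_closed_segment by blast
  have cross_X: "cross d (X n - x) = 0" for n
    unfolding d X_def by (simp add: cross_simps(7,8))
  have d0: "d \<noteq> 0" using c(2) by (auto simp: cross_simps(9))
  \<comment> \<open>A small step from \<open>X n\<close> towards \<open>c\<close> stays in
    \<open>R\<close> by convexity and avoids the tiles that do not contain \<open>X n\<close>, so
    the tile it reaches contains \<open>X n\<close> as well.\<close>
  have "\<exists>w\<in>W. X n \<in> w \<and> (\<exists>v\<in>w. 0 < cross d (v - x))" for n
  proof -
    have "((\<lambda>k. X n + k *\<^sub>R (c - X n)) \<longlongrightarrow> X n + 0 *\<^sub>R (c - X n)) (at_right (0::real))"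
      by (intro tendsto_intros)
    then have lim: "((\<lambda>k. X n + k *\<^sub>R (c - X n)) \<longlongrightarrow> X n) (at_right (0::real))" by simp
    have "\<forall>\<^sub>F k in at_right (0::real). X n + k *\<^sub>R (c - X n) \<notin> w" if "w \<in> W" "X n \<notin> w" for w
      using topological_tendstoD[OF lim, of "- w"] that polygon_closed[OF tile_polygon]
      by (simp add: open_Compl)
    then have "\<forall>\<^sub>F k in at_right (0::real). \<forall>w\<in>{w\<in>W. X n \<notin> w}. X n + k *\<^sub>R (c - X n) \<notin> w"
      using finite_W by (intro eventually_ball_finite) auto
    moreover have "\<forall>\<^sub>F k in at_right (0::real). 0 < k \<and> k < 1"
      by (auto simp: eventually_at_right[of 0 1] intro!: exI[of _ 1])
    ultimately have "\<forall>\<^sub>F k in at_right (0::real).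
        (\<forall>w\<in>{w\<in>W. X n \<notin> w}. X n + k *\<^sub>R (c - X n) \<notin> w) \<and> 0 < k \<and> k < 1"
      by eventually_elim simp
    then obtain k where k: "\<forall>w\<in>{w\<in>W. X n \<notin> w}. X n + k *\<^sub>R (c - X n) \<notin> w" "0 < k" "k < (1::real)"
      using eventually_happens'[OF trivial_limit_at_right_real] by blast
    have "X n + k *\<^sub>R (c - X n) = (1 - k) *\<^sub>R X n + k *\<^sub>R c" by (simp add: algebra_simps)
    moreover have "(1 - k) *\<^sub>R X n + k *\<^sub>R c \<in> R"
      using polygon_convex[OF R_polygon] Xs segment_subset_R[OF s] c(1) k
      by (intro convexD) auto
    ultimately obtain w where w: "w \<in> W" "X n + k *\<^sub>R (c - X n) \<in> w" using Union_W by auto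
    then have "X n \<in> w" using k(1) by blast
    moreover have "X n + k *\<^sub>R (c - X n) - x = (1 - k) *\<^sub>R (X n - x) + k *\<^sub>R (c - x)"
      by (simp add: algebra_simps)
    then have "cross d (X n + k *\<^sub>R (c - X n) - x) = k * cross d (c - x)"
      by (simp only: cross_simps(2,8) cross_X) simp
    then have "0 < cross d (X n + k *\<^sub>R (c - X n) - x)" using k(2) c(2) by simp
    ultimately show ?thesis using w by blast
  qed
  then obtain g where g: "\<And>n. g n \<in> W" "\<And>n. X n \<in> g n" "\<And>n. \<exists>v\<in>g n. 0 < cross d (v - x)"
    by metis
  have "finite (range g)" using g(1) finite_W by (meson finite_subset image_subsetI)
  then obtain n0 where inf: "infinite {n. g n = g n0}"
    using pigeonhole_infinite[of UNIV g] by auto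
  define w where "w = g n0"
  have w: "w \<in> W" "convex_polygon w" using g(1) tile_polygon by (auto simp: w_def)
  have xw: "x \<in> w"
  proof (rule ccontr)
    assume "x \<notin> w"
    have "(\<lambda>n. x + (1 / (real n + 2)) *\<^sub>R (y - x)) \<longlonglongrightarrow> x + 0 *\<^sub>R (y - x)"
      using LIMSEQ_ignore_initial_segment[OF lim_1_over_n[where 'a = real], of 2]
      by (intro tendsto_intros) (simp add: add.commute)
    then have "\<forall>\<^sub>F n in sequentially. X n \<in> - w"
      using \<open>x \<notin> w\<close> polygon_closed[OF w(2)] unfolding X_def
      by (intro topological_tendstoD) (auto simp: open_Compl)
    then obtain N where "\<And>n. N \<le> n \<Longrightarrow> X n \<notin> w" by (auto simp: eventually_sequentially)
    then have "{n. g n = g n0} \<subseteq> {..<N}" using g(2) unfolding w_def by (metis (mono_tags) lessThan_iff mem_Collect_eq not_less subsetI)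
    then show False using inf finite_subset by blast
  qed
  define z where "z = X n0"
  have z: "z \<in> w" "z \<in> open_segment x y" using g(2) Xo by (auto simp: z_def w_def)
  obtain v where v: "v \<in> w" "0 < cross d (v - x)" using g(3) by (auto simp: w_def)
  \<comment> \<open>The midpoint is in the skeleton, hence not interior to \<open>w\<close>, and
    some side functional is nonpositive there. Being nonnegative at \<open>x\<close> and
    \<open>z\<close>, it vanishes at both.\<close>
  define m where "m = midpoint x z"
  have xz: "closed_segment x z \<subseteq> s"
    using closed_segment_subset[of x "closed_segment x y" z] z(2) xys open_closed_segment by blast
  have "m \<in> s" using xz midpoint_in_closed_segment unfolding m_def by blast
  then have "m \<notin> interior w" using interior_not_skeleton[OF w(1)] ab(2) by blast
  then obtain p q where pq: "side w p q" "cross (q - p) (m - p) \<le> 0"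
    using polygon_interior_halfplanes[OF w(2)] by (auto simp: not_less)
  have pos: "0 \<le> cross (q - p) (x - p)" "0 \<le> cross (q - p) (z - p)" "0 \<le> cross (q - p) (v - p)"
    using pq(1) xw z(1) v(1) by (auto simp: side_def)
  have "m - p = (1/2) *\<^sub>R (x - p) + (1/2) *\<^sub>R (z - p)"
    by (simp add: m_def midpoint_def algebra_simps flip: scaleR_add_left)
  then have "cross (q - p) (m - p) = (cross (q - p) (x - p) + cross (q - p) (z - p)) / 2"
    by (simp only: cross_simps(2,8)) simp
  then have zero: "cross (q - p) (x - p) = 0" "cross (q - p) (z - p) = 0" using pos pq(2) by auto
  have "cross (q - p) (z - x) = 0" using zero by (simp add: cross_simps(4))
  moreover have "z - x = (1 / (real n0 + 2)) *\<^sub>R (y - x)" by (simp add: z_def X_def)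
  ultimately have "cross (q - p) (y - x) = 0" by (simp add: cross_simps(8))
  then have "cross d (q - p) = 0" using cross_commute[of "y - x" "q - p"] by (simp add: d cross_simps(7))
  then obtain l where l: "q - p = l *\<^sub>R d" using cross_eq_0_parallelE[OF d0] by blast
  have "cross (q - p) (v - p) = cross (q - p) (v - x)" using zero(1) by (simp add: cross_simps(4))
  then have "0 \<le> cross (q - p) (v - x)" using pos(3) by simp
  then have "0 \<le> l * cross d (v - x)" unfolding l by (simp only: cross_simps(7)) simp
  then have "0 \<le> l" using v(2) by (simp add: zero_le_mult_iff)
  moreover have "l \<noteq> 0" using l side_neq[OF w(2) pq(1)] by auto
  ultimately have "0 < l" by simp
  have sub: "closed_segment x z \<subseteq> closed_segment p q"
    using side_line[OF w(2) pq(1) xw zero(1)] side_line[OF w(2) pq(1) z(1) zero(2)]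
    by (intro closed_segment_subset) auto
  have "x \<noteq> z" using z(2) by (auto simp: open_segment_def)
  then have "sg p q = s"
    using segment_unique[OF sg(1)[OF w(1) pq(1)] s _ _ xz] sub sg(2)[OF w(1) pq(1)] by blast
  then show thesis using that[OF w(1) pq(1) _ z(2) sub \<open>0 < l\<close> l] by blast
qed

text \<open>A small step to the left of the common point enters the interiors of both tiles.\<close>

lemma tile_side_unique:
  assumes w: "w \<in> W" "w' \<in> W" and s: "side w p q" "side w' p' q'"
    and z: "z \<in> open_segment p q" "z \<in> open_segment p' q'"
    and k: "q' - p' = k *\<^sub>R (q - p)" "0 < k"
  shows "w' = w \<and> p' = p \<and> q' = q"
proof -
  define m where "m = (vector [- (q - p) $ 2, (q - p) $ 1] :: plane)"
  have "cross (q - p) m = (q - p) \<bullet> (q - p)"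
    by (simp add: m_def cross_def inner_vec_def sum_2 algebra_simps)
  also have "\<dots> > 0" using side_neq[OF tile_polygon[OF w(1)] s(1)] by simp
  finally have m: "0 < cross (q - p) m" .
  then have m': "0 < cross (q' - p') m" unfolding k(1) using k(2) by (simp add: cross_simps(7))
  have "\<forall>\<^sub>F t in at_right 0. z + t *\<^sub>R m \<in> interior w \<and> z + t *\<^sub>R m \<in> interior w'"
    using eventually_interior_side[OF tile_polygon[OF w(1)] s(1) z(1) m]
      eventually_interior_side[OF tile_polygon[OF w(2)] s(2) z(2) m']
    by (rule eventually_conj)
  then obtain t :: real where "z + t *\<^sub>R m \<in> interior w" "z + t *\<^sub>R m \<in> interior w'"
    using eventually_happens'[OF trivial_limit_at_right_real] by blast
  then have "w' = w" using tile_eq_of_interior[OF w(2,1)] by blast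
  then have "p = p' \<and> q = q'"
    using side_direction_unique[OF tile_polygon[OF w(1)] s(1) _ k] s(2) by simp
  then show ?thesis using \<open>w' = w\<close> by simp
qed

text \<open>The midpoint of a segment in the frontier lies on a side of \<open>R\<close>, and the
  face property pulls the whole segment into this side. Conversely, a segment that extends a side
  within its line cannot leave the side without leaving \<open>R\<close>.\<close>

lemma boundary_segments_iff:
  "s \<in> boundary_segments R W \<longleftrightarrow> (\<exists>p q. side R p q \<and> s = closed_segment p q)"
proof
  assume s: "s \<in> boundary_segments R W"
  then have s': "s \<in> segments W" "s \<subseteq> frontier R" by (auto simp: boundary_segments_def)
  obtain a b where ab: "a \<noteq> b" "s = closed_segment a b" "s \<subseteq> skeleton W" using segmentsE[OF s'(1)] .
  have mo: "midpoint a b \<in> open_segment a b" using ab(1) by simp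
  then have "midpoint a b \<in> frontier R" using s'(2) ab(2) open_closed_segment by blast
  then obtain p q where pq: "side R p q" "midpoint a b \<in> closed_segment p q"
    using frontier_sides[OF R_polygon] by blast
  have "a \<in> R" "b \<in> R" using segment_subset_R[OF s'(1)] ab(2) by auto
  then have "a \<in> closed_segment p q" "b \<in> closed_segment p q"
    using face_ofD[OF side_face[OF R_polygon pq(1)] mo] pq(2) by auto
  then have "s \<subseteq> closed_segment p q" unfolding ab(2) by (intro closed_segment_subset) auto
  moreover have "closed_segment p q \<subseteq> frontier R"
    using frontier_sides[OF R_polygon] pq(1) by blast
  ultimately have "closed_segment p q = s"
    using segments_maximal[OF s'(1)] frontier_R_skeleton by blast
  then show "\<exists>p q. side R p q \<and> s = closed_segment p q" using pq(1) by blast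
next
  assume "\<exists>p q. side R p q \<and> s = closed_segment p q"
  then obtain p q where pq: "side R p q" "s = closed_segment p q" by blast
  have fr: "s \<subseteq> frontier R" using frontier_sides[OF R_polygon] pq by blast
  have ne: "p \<noteq> q" using side_neq[OF R_polygon pq(1)] .
  have maximal: "closed_segment c d = s" if cd: "s \<subseteq> closed_segment c d" "closed_segment c d \<subseteq> skeleton W" for c d
  proof
    have "closed_segment p q \<subseteq> closed_segment c d" using cd(1) pq(2) by simp
    then obtain u v where uv: "closed_segment c d = (\<lambda>x. p + x *\<^sub>R (q - p)) ` {u..v}"
      using closed_segment_subsegment[OF ne, of c d] by metis
    show "closed_segment c d \<subseteq> s"
    proof
      fix x assume x: "x \<in> closed_segment c d"
      then obtain t where "x = p + t *\<^sub>R (q - p)" unfolding uv by (rule imageE)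
      then have "cross (q - p) (x - p) = 0" by (simp add: cross_simps(8))
      moreover have "x \<in> R" using x cd(2) skeleton_subset by (meson subsetD)
      ultimately show "x \<in> s" using side_line[OF R_polygon pq(1), of x] pq(2) by simp
    qed
  qed (rule cd(1))
  have "\<exists>a b. a \<noteq> b \<and> s = closed_segment a b" using ne pq(2) by blast
  moreover have "s \<subseteq> skeleton W" using fr frontier_R_skeleton by (rule subset_trans)
  moreover have "\<forall>c d. s \<subseteq> closed_segment c d \<and> closed_segment c d \<subseteq> skeleton W
      \<longrightarrow> closed_segment c d = s"
    using maximal by simp
  ultimately have "s \<in> segments W" unfolding segments_def by (intro CollectI conjI)
  then show "s \<in> boundary_segments R W" using fr by (simp add: boundary_segments_def)
qed

text \<open>If no point of \<open>R\<close> were strictly to the left of \<open>x y\<close>, a step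
  to the left from any point of the segment would leave \<open>R\<close>, and the segment would lie
  in the frontier.\<close>

lemma interior_segment_both_sides:
  assumes s: "s \<in> segments W" "s \<notin> boundary_segments R W" and x: "x \<in> s" "y \<in> s" "x \<noteq> y"
  obtains c where "c \<in> R" "0 < cross (y - x) (c - x)"
proof (rule ccontr)
  assume neg: "\<not> thesis"
  have le: "cross (y - x) (c - x) \<le> 0" if "c \<in> R" for c
    using neg \<open>c \<in> R\<close> \<open>\<And>c. \<lbrakk>c \<in> R; 0 < cross (y - x) (c - x)\<rbrakk> \<Longrightarrow> thesis\<close> by (meson not_le)
  have "s \<subseteq> frontier R"
  proof
    fix u assume u: "u \<in> s"
    have "cross (y - x) (u - x) = 0" using segment_cross[OF s(1) x(1,2,1) u] .
    moreover have "u \<notin> interior R"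
    proof
      assume "u \<in> interior R"
      then have "\<forall>\<^sub>F t in at_right 0. u + t *\<^sub>R vector [- (y - x) $ 2, (y - x) $ 1] \<in> interior R \<and> 0 < t"
        by (intro eventually_conj interior_push eventually_at_right_less)
      then obtain t where t: "u + t *\<^sub>R vector [- (y - x) $ 2, (y - x) $ 1] \<in> R" "0 < (t::real)"
        using eventually_happens'[OF trivial_limit_at_right_real] interior_subset by blast
      have "cross (y - x) (u + t *\<^sub>R vector [- (y - x) $ 2, (y - x) $ 1] - x)
          = cross (y - x) (u - x) + t * ((y - x) \<bullet> (y - x))"
        by (simp add: cross_def inner_vec_def sum_2 algebra_simps)
      moreover have "0 < (y - x) \<bullet> (y - x)" using x(3) by simp
      ultimately show False
        using le[OF t(1)] \<open>cross (y - x) (u - x) = 0\<close>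
          mult_pos_pos[OF t(2), of "(y - x) \<bullet> (y - x)"] by linarith
    qed
    ultimately show "u \<in> frontier R"
      using u segment_subset_R[OF s(1)] closure_subset by (auto simp: frontier_def)
  qed
  then show False using s by (simp add: boundary_segments_def)
qed

lemma segment_incident:
  assumes "s \<in> segments W"
  obtains w p q where "w \<in> W" "side w p q" "sg p q = s"
proof -
  obtain a b where ab: "a \<noteq> b" "s = closed_segment a b" using segmentsE[OF assms] .
  obtain c where c: "c \<in> interior R" by (rule polygon_interior[OF R_polygon])
  define m where "m = (vector [- (b - a) $ 2, (b - a) $ 1] :: plane)"
  have "\<forall>\<^sub>F t in at_right 0. c + t *\<^sub>R m \<in> interior R \<and> 0 < t"
    by (intro eventually_conj interior_push c eventually_at_right_less)
  then obtain t where t: "c + t *\<^sub>R m \<in> R" "0 < (t::real)"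
    using eventually_happens'[OF trivial_limit_at_right_real] interior_subset by blast
  have "cross (b - a) (c + t *\<^sub>R m - a) = cross (b - a) (c - a) + t * ((b - a) \<bullet> (b - a))"
    by (simp add: m_def cross_def inner_vec_def sum_2 algebra_simps)
  moreover have "0 < t * ((b - a) \<bullet> (b - a))" using ab(1) t(2) by simp
  ultimately have "cross (b - a) (c - a) \<noteq> 0 \<or> cross (b - a) (c + t *\<^sub>R m - a) \<noteq> 0"
    by linarith
  moreover have "c \<in> R" using c interior_subset by auto
  ultimately obtain c where c: "c \<in> R" "cross (b - a) (c - a) \<noteq> 0" using t(1) by metis
  have abs: "a \<in> s" "b \<in> s" using ab by auto
  show thesis
  proof (cases "0 < cross (b - a) (c - a)")
    case True
    have "b - a = 1 *\<^sub>R (b - a)" by simp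
    then show thesis
      using segment_tile[OF assms abs ab(1) _ c(1) True] that by metis
  next
    case False
    then have "0 < cross (- (b - a)) (c - a)" unfolding cross_simps(5) using c(2) by linarith
    moreover have "- (b - a) = (- 1) *\<^sub>R (b - a)" by simp
    ultimately show thesis
      using segment_tile[OF assms abs ab(1) _ c(1)] that by metis
  qed
qed

lemma segment_endpoint:
  assumes "s \<in> segments W" "q \<in> s" "q \<notin> rel_interior s" "x \<in> s" "y \<in> s"
  shows "q \<notin> open_segment x y"
proof
  assume q: "q \<in> open_segment x y"
  obtain a b where ab: "a \<noteq> b" "s = closed_segment a b" using segmentsE[OF assms(1)] .
  have "q = a \<or> q = b"
    using assms(2,3) rel_interior_segment[OF ab(1)] unfolding ab(2) by (auto simp: open_segment_def)
  then have "q extreme_point_of s" unfolding ab(2) extreme_point_of_segment .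
  then show False using q assms(4,5) by (auto simp: extreme_point_of_def)
qed

end

section \<open>Passing from tile to tile around a vertex\<close>

context polygon_tiling
begin

lemma side_start_unique_tile:
  assumes "w \<in> W" "w' \<in> W" "side w q r" "side w' q r'" "r' - q = k *\<^sub>R (r - q)" "0 < k"
  shows "w' = w \<and> r' = r"
proof -
  have ne: "q \<noteq> r" "q \<noteq> r'" using side_neq[OF tile_polygon] assms by blast+
  define \<epsilon> where "\<epsilon> = min 1 k / 2"
  have \<epsilon>: "0 < \<epsilon>" "\<epsilon> < 1" "\<epsilon> < k" using assms(6) by (auto simp: \<epsilon>_def)
  have "q + \<epsilon> *\<^sub>R (r - q) \<in> open_segment q r"
    unfolding open_segment_iff using ne \<epsilon> by blast
  moreover have "q + \<epsilon> *\<^sub>R (r - q) = q + (\<epsilon> / k) *\<^sub>R (r' - q)" using assms(5,6) by simp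
  then have "q + \<epsilon> *\<^sub>R (r - q) \<in> open_segment q r'"
    unfolding open_segment_iff using ne \<epsilon> assms(6) by (intro conjI exI[of _ "\<epsilon> / k"]) auto
  ultimately show ?thesis using tile_side_unique[OF assms(1-4) _ _ assms(5,6)] by blast
qed

lemma side_end_unique_tile:
  assumes "w \<in> W" "w' \<in> W" "side w p q" "side w' p' q" "q - p' = k *\<^sub>R (q - p)" "0 < k"
  shows "w' = w \<and> p' = p"
proof -
  have ne: "q \<noteq> p" "q \<noteq> p'" using side_neq[OF tile_polygon] assms by blast+
  define \<epsilon> where "\<epsilon> = min 1 k / 2"
  have \<epsilon>: "0 < \<epsilon>" "\<epsilon> < 1" "\<epsilon> < k" using assms(6) by (auto simp: \<epsilon>_def)
  have eq: "q + \<epsilon> *\<^sub>R (p - q) = q + (\<epsilon> / k) *\<^sub>R (p' - q)"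
  proof -
    have "p' - q = k *\<^sub>R (p - q)" using assms(5) by (metis minus_diff_eq scaleR_minus_right)
    then show ?thesis using assms(6) by simp
  qed
  have "q + \<epsilon> *\<^sub>R (p - q) \<in> open_segment q p"
    unfolding open_segment_iff using ne \<epsilon> by blast
  then have 1: "q + \<epsilon> *\<^sub>R (p - q) \<in> open_segment p q" by (simp add: open_segment_commute)
  have "q + \<epsilon> *\<^sub>R (p - q) \<in> open_segment q p'"
    unfolding open_segment_iff eq using ne \<epsilon> assms(6) by (intro conjI exI[of _ "\<epsilon> / k"]) auto
  then have "q + \<epsilon> *\<^sub>R (p - q) \<in> open_segment p' q" by (simp add: open_segment_commute)
  with 1 show ?thesis using tile_side_unique[OF assms(1-4) _ _ assms(5,6)] by blast
qed

lemma rel_interior_back_point: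
  assumes s: "s \<in> segments W" "q \<in> rel_interior s" "r \<in> s" "r \<noteq> q"
  obtains y k where "y \<in> s" "0 < k" "y - q = - k *\<^sub>R (r - q)"
proof -
  obtain a b where ab: "a \<noteq> b" "s = closed_segment a b" using segmentsE[OF s(1)] .
  have "q \<in> open_segment a b" using s(2) rel_interior_segment[OF ab(1)] ab(2) by simp
  then obtain u where u: "0 < u" "u < 1" "q = a + u *\<^sub>R (b - a)" unfolding open_segment_iff by blast
  obtain v where v: "r = a + v *\<^sub>R (b - a)" using s(3) unfolding ab(2) closed_segment_iff by blast
  have rq: "r - q = (v - u) *\<^sub>R (b - a)" unfolding u(3) v by (simp add: scaleR_diff_left)
  have ne: "v \<noteq> u" using rq s(4) by auto
  have ba: "b - a = (1 / (v - u)) *\<^sub>R (r - q)" using rq ne by simp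
  show thesis
  proof (cases "u < v")
    case True
    have "a - q = - u *\<^sub>R (b - a)" unfolding u(3) by simp
    also have "\<dots> = - (u / (v - u)) *\<^sub>R (r - q)" unfolding ba by simp
    finally show thesis using True u(1) ab(2) by (intro that[of a "u / (v - u)"]) auto
  next
    case False
    have "b - q = (1 - u) *\<^sub>R (b - a)" unfolding u(3) by (simp add: algebra_simps)
    also have "\<dots> = - ((1 - u) / (u - v)) *\<^sub>R (r - q)"
    proof -
      have "(1 - u) / (v - u) = - ((1 - u) / (u - v))"
        using ne by (metis minus_diff_eq minus_divide_right)
      then show ?thesis unfolding ba by simp
    qed
    finally show thesis using False ne u(2) ab(2) by (intro that[of b "(1 - u) / (u - v)"]) auto
  qed
qed

text \<open>This is the black rotation at \<open>q\<close> in terms of tiles. If the segment passes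
  straight through \<open>q\<close>, the next tile is on the same side of it, behind
  \<open>q\<close>; if the segment ends at \<open>q\<close>, the next tile is on its other side. The
  sign in front of \<open>l\<close> records the case.\<close>

lemma across:
  assumes w: "w \<in> W" "side w q r"
    and int: "q \<in> rel_interior (sg q r) \<or> sg q r \<notin> boundary_segments R W"
  obtains w' p' l where "w' \<in> W" "side w' p' q" "sg p' q = sg q r" "0 < l"
    "q - p' = (if q \<in> rel_interior (sg q r) then l else - l) *\<^sub>R (r - q)"
proof -
  let ?t = "sg q r"
  have t: "?t \<in> segments W" "q \<in> ?t" "r \<in> ?t" using sg(1)[OF w] sg_points[OF w] by auto
  have qr: "q \<noteq> r" using side_neq[OF tile_polygon[OF w(1)] w(2)] .
  have ne: "r \<noteq> q" using qr by simp
  show thesis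
  proof (cases "q \<in> rel_interior ?t")
    case True
    obtain y k where y: "y \<in> ?t" "0 < k" "y - q = - k *\<^sub>R (r - q)"
      by (rule rel_interior_back_point[OF t(1) True t(3) ne])
    have qy: "q \<noteq> y" using y qr by auto
    have d: "r - q = (- 1 / k) *\<^sub>R (y - q)" using y(2,3) by simp
    obtain c where c: "c \<in> interior w" by (rule polygon_interior[OF tile_polygon[OF w(1)]])
    have cR: "c \<in> R" using c tile_subset[OF w(1)] interior_subset by blast
    obtain w' p' q' z l where w': "w' \<in> W" "side w' p' q'" "sg p' q' = ?t" "z \<in> open_segment q y"
      "closed_segment q z \<subseteq> closed_segment p' q'" "0 < l" "q' - p' = l *\<^sub>R (r - q)"
      using segment_tile[OF t(1,2) y(1) qy d cR side_interior[OF tile_polygon[OF w(1)] w(2) c]]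
      by metis
    obtain \<tau> where \<tau>: "0 < \<tau>" "z = q + \<tau> *\<^sub>R (y - q)" using w'(4) unfolding open_segment_iff by blast
    have "q \<in> closed_segment p' q'" "z \<in> closed_segment p' q'" using w'(5) by auto
    then obtain v v' where v: "0 \<le> v" "v \<le> 1" "q = p' + v *\<^sub>R (q' - p')"
      and v': "0 \<le> v'" "z = p' + v' *\<^sub>R (q' - p')" unfolding closed_segment_iff by blast
    have "z - q = - (\<tau> * k) *\<^sub>R (r - q)" using \<tau>(2) y(3) by simp
    moreover have "z - q = (v' - v) *\<^sub>R (q' - p')"
      using v(3) v'(2) by (metis add_diff_cancel_left scaleR_diff_left)
    ultimately have "((v' - v) * l + \<tau> * k) *\<^sub>R (r - q) = 0"
      unfolding w'(7) by (simp add: scaleR_add_left)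
    then have "(v' - v) * l = - (\<tau> * k)" using qr by auto
    then have "(v' - v) * l < 0" using \<tau>(1) y(2) by simp
    then have "v' < v" using w'(6) by (simp add: mult_less_0_iff)
    then have "0 < v" using v'(1) by simp
    \<comment> \<open>A side of \<open>w'\<close> continuing past \<open>q\<close> would overlap the
      side \<open>q r\<close> of \<open>w\<close> with the same direction, so the two sides would be
      equal.\<close>
    have "v = 1"
    proof (rule ccontr)
      assume "v \<noteq> 1"
      then have "v < 1" using v(2) by simp
      define \<epsilon> where "\<epsilon> = min 1 ((1 - v) * l) / 2"
      have \<epsilon>: "0 < \<epsilon>" "\<epsilon> < 1" "\<epsilon> < (1 - v) * l"
        using \<open>v < 1\<close> w'(6) mult_pos_pos[of "1 - v" l] unfolding \<epsilon>_def by linarith+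
      have "q + \<epsilon> *\<^sub>R (r - q) \<in> open_segment q r"
        unfolding open_segment_iff using qr \<epsilon> by blast
      moreover have "q + \<epsilon> *\<^sub>R (r - q) \<in> open_segment p' q'"
        unfolding open_segment_iff
      proof (intro conjI exI[of _ "v + \<epsilon> / l"])
        show "p' \<noteq> q'" using side_neq[OF tile_polygon[OF w'(1)] w'(2)] .
        show "0 < v + \<epsilon> / l" using \<open>0 < v\<close> \<epsilon>(1) w'(6) by (simp add: add_pos_pos)
        show "v + \<epsilon> / l < 1" using \<epsilon>(3) w'(6) by (simp add: field_simps)
        have "\<epsilon> *\<^sub>R (r - q) = (\<epsilon> / l) *\<^sub>R (q' - p')" unfolding w'(7) using w'(6) by simp
        then show "q + \<epsilon> *\<^sub>R (r - q) = p' + (v + \<epsilon> / l) *\<^sub>R (q' - p')"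
          by (subst v(3)) (simp add: scaleR_add_left)
      qed
      ultimately have "p' = q"
        using tile_side_unique[OF w(1) w'(1) w(2) w'(2) _ _ w'(7,6)] by blast
      then show False using v(3) \<open>0 < v\<close> side_neq[OF tile_polygon[OF w'(1)] w'(2)] by simp
    qed
    then have "q' = q" using v(3) by simp
    then show thesis using w' True by (intro that[of w' p' l]) simp_all
  next
    case False
    then have nb: "?t \<notin> boundary_segments R W" using int by simp
    obtain c where c: "c \<in> R" "0 < cross (q - r) (c - r)"
      using interior_segment_both_sides[OF t(1) nb t(3,2) ne] .
    then have cpos: "0 < cross (q - r) (c - q)" by (simp add: cross_def algebra_simps)
    have d: "q - r = (- 1) *\<^sub>R (r - q)" by simp
    obtain w' p' q' z l where w': "w' \<in> W" "side w' p' q'" "sg p' q' = ?t" "z \<in> open_segment q r"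
      "closed_segment q z \<subseteq> closed_segment p' q'" "0 < l" "q' - p' = l *\<^sub>R (q - r)"
      using segment_tile[OF t(1,2,3) qr d c(1) cpos] by metis
    obtain \<tau> where \<tau>: "0 < \<tau>" "z = q + \<tau> *\<^sub>R (r - q)" using w'(4) unfolding open_segment_iff by blast
    have "q \<in> closed_segment p' q'" "z \<in> closed_segment p' q'" using w'(5) by auto
    then obtain v v' where v: "0 \<le> v" "v \<le> 1" "q = p' + v *\<^sub>R (q' - p')"
      and v': "0 \<le> v'" "z = p' + v' *\<^sub>R (q' - p')" unfolding closed_segment_iff by blast
    have q't: "q' \<in> ?t" "z \<in> ?t"
      using sg_points[OF w'(1,2)] sg(2)[OF w'(1,2)] w'(3) \<open>z \<in> closed_segment p' q'\<close> by auto
    \<comment> \<open>Here a side continuing past \<open>q\<close> would place \<open>q\<close>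
      strictly between two points of the segment, although \<open>q\<close> is one of its
      ends.\<close>
    have "q' = q"
    proof (rule ccontr)
      assume "q' \<noteq> q"
      then have "v \<noteq> 1" using v(3) by auto
      then have "v < 1" using v(2) by simp
      have "q' - q = (1 - v) *\<^sub>R (q' - p')" by (subst v(3)) (simp add: algebra_simps)
      then have q'q': "q' - q = - ((1 - v) * l) *\<^sub>R (r - q)" unfolding w'(7)
        by (simp add: scaleR_diff_right)
      define A B where "A = \<tau>" and "B = (1 - v) * l"
      have AB: "0 < A" "0 < B" using \<tau>(1) \<open>v < 1\<close> w'(6) by (simp_all add: A_def B_def)
      have z': "z = q + A *\<^sub>R (r - q)" and q': "q' = q - B *\<^sub>R (r - q)"
        using \<tau>(2) q'q' by (simp_all add: A_def B_def algebra_simps)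
      have "q = z + (A / (A + B)) *\<^sub>R (q' - z)"
      proof -
        have "q' - z = - (A + B) *\<^sub>R (r - q)" unfolding z' q' by (simp add: algebra_simps)
        moreover have "A / (A + B) * - (A + B) = - A" using AB by (simp add: field_simps)
        ultimately have "(A / (A + B)) *\<^sub>R (q' - z) = - A *\<^sub>R (r - q)"
          by (simp only: scaleR_scaleR)
        then show ?thesis unfolding z' by simp
      qed
      moreover have "z \<noteq> q'"
      proof
        assume "z = q'"
        then have "(A + B) *\<^sub>R (r - q) = 0" using z' q' by (simp add: algebra_simps)
        then show False using AB qr by simp
      qed
      ultimately have "q \<in> open_segment z q'"
        unfolding open_segment_iff using AB by (intro conjI exI[of _ "A / (A + B)"]) auto
      then show False using segment_endpoint[OF t(1,2) False q't(2,1)] by blast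
    qed
    then have "q - p' = - l *\<^sub>R (r - q)" using w'(7) by (simp add: scaleR_diff_right)
    then show thesis using w' False \<open>q' = q\<close> by (intro that[of w' p' l]) simp_all
  qed
qed

text \<open>These are the corners of \<open>R\<close>, phrased through segments as in the exterior
  case of \<open>black_next\<close>, so that a facial walk around any other vertex takes no exterior
  turn.\<close>

definition boundary_corners :: "plane set" where
  "boundary_corners = {q. \<exists>s\<in>boundary_segments R W. q \<in> s \<and> q \<notin> rel_interior s}"

lemma sg_corner_neq:
  assumes "w \<in> W" "side w p q" "side w q r"
  shows "sg p q \<noteq> sg q r"
proof
  assume "sg p q = sg q r"
  then have "p = q" using sg_inj[OF assms] by simp
  then show False using side_neq[OF tile_polygon[OF assms(1)] assms(2)] by simp
qed

lemma across_face_step: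
  assumes w: "w \<in> W" "side w p q" "side w q r"
    and int: "q \<in> rel_interior (sg q r) \<or> sg q r \<notin> boundary_segments R W"
    and w': "w' \<in> W" "side w' p' q" "sg p' q = sg q r" "0 < l"
    "q - p' = (if q \<in> rel_interior (sg q r) then l else - l) *\<^sub>R (r - q)"
  shows "((w, sg p q), (w', sg q r)) \<in> face_step R W"
proof -
  have "white_next w (sg p q) (sg q r)"
    unfolding white_next_def ccw_edge_iff using w sg(2)[OF w(1)] by blast
  moreover have "black_next R W (sg q r) w w'"
    unfolding black_next_def
  proof (intro exI conjI)
    show "ccw_edge w (sg q r) q r" using w sg(2)[OF w(1)] by (simp add: ccw_edge_iff)
    show "ccw_edge w' (sg q r) p' q" using w' sg(2)[OF w'(1,2)] by (simp add: ccw_edge_iff)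
    have "0 < (r - q) \<bullet> (r - q)" using side_neq[OF tile_polygon[OF w(1)] w(3)] by simp
    then show "if q \<in> rel_interior (sg q r) then q = q \<and> 0 < (r - q) \<bullet> (q - p')
         else if sg q r \<in> boundary_segments R W then q \<notin> rel_interior (sg q r)
         else q = q \<and> (r - q) \<bullet> (q - p') < 0"
      using int w'(4,5) by (auto simp: inner_commute)
  qed
  moreover have "(w, sg p q) \<in> graph_edges W" "(w', sg q r) \<in> graph_edges W"
    unfolding graph_edges_def
    using incident_iff[OF w(1) sg(1)[OF w(1,2)]] incident_iff[OF w'(1) sg(1)[OF w(1,3)]]
      w sg(1)[OF w(1)] w' by auto
  ultimately show ?thesis by (simp add: face_step_def)
qed

text \<open>A graph edge \<open>(w, s)\<close> encodes the corner of \<open>w\<close> at the end of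
  its side in \<open>s\<close>. A facial step keeps that point unless it turns through the exterior,
  so the face of a vertex other than a corner of \<open>R\<close> consists of tile corners at this
  vertex.\<close>

lemma face_step_vertex:
  assumes step: "((w1, s1), (w2, s2)) \<in> face_step R W" and e: "ccw_edge w1 s1 p1 q"
    and q: "q \<notin> boundary_corners"
  shows "\<exists>p2. ccw_edge w2 s2 p2 q"
proof -
  have g: "w1 \<in> W" "s1 \<in> segments W" "w2 \<in> W" "s2 \<in> segments W"
    "white_next w1 s1 s2" "black_next R W s2 w1 w2"
    using step by (auto simp: face_step_def graph_edges_def)
  have ccw_unique: "a = c \<and> b = d" if "ccw_edge w1 s a b" "ccw_edge w1 s c d" "s \<in> segments W" for s a b c d
    using that sg_inj[OF g(1), of a b c d] by (simp add: ccw_edge_sg[OF g(1) that(3)])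
  obtain p0 q0 r0 where "ccw_edge w1 s1 p0 q0" "ccw_edge w1 s2 q0 r0"
    using g(5) by (auto simp: white_next_def)
  then have r0: "ccw_edge w1 s2 q r0" using ccw_unique[OF _ e g(2)] by blast
  obtain P Q P' Q' where b: "ccw_edge w1 s2 P Q" "ccw_edge w2 s2 P' Q'"
    "if P \<in> rel_interior s2 then Q' = P \<and> 0 < (Q - P) \<bullet> (Q' - P')
     else if s2 \<in> boundary_segments R W then Q' \<notin> rel_interior s2
     else Q' = P \<and> (Q - P) \<bullet> (Q' - P') < 0"
    using g(6) unfolding black_next_def by blast
  have "P = q" using ccw_unique[OF b(1) r0 g(4)] by blast
  have "q \<in> s2" using r0 by (auto simp: ccw_edge_iff)
  then have "q \<in> rel_interior s2 \<or> s2 \<notin> boundary_segments R W"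
    using q by (auto simp: boundary_corners_def)
  then have "Q' = q" using b(3) \<open>P = q\<close> by (auto split: if_splits)
  then show ?thesis using b(2) by blast
qed

end

locale quad_tiling = polygon_tiling +
  assumes quad: "\<forall>F\<in>bounded_faces R W. face_degree F = 4"
begin

text \<open>Degree four means that the facial walk around a vertex turns back after two corners, so the
  vertex is a T-junction of exactly two segments.\<close>

lemma partner:
  assumes w: "w \<in> W" "side w p q" "side w q r" and q: "q \<notin> boundary_corners"
  obtains w' p' r' l m where "w' \<in> W" "side w' p' q" "side w' q r'" "sg p' q = sg q r" "sg q r' = sg p q"
    "0 < l" "0 < m" "q \<in> rel_interior (sg q r) \<longleftrightarrow> q \<notin> rel_interior (sg p q)"
    "q - p' = (if q \<in> rel_interior (sg q r) then l else - l) *\<^sub>R (r - q)"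
    "r' - q = (if q \<in> rel_interior (sg q r) then - m else m) *\<^sub>R (q - p)"
proof -
  have not_bd: "q \<in> rel_interior s \<or> s \<notin> boundary_segments R W" if "q \<in> s" for s
    using q that by (auto simp: boundary_corners_def)
  define e0 where "e0 = (w, sg p q)"
  define F where "F = (face_step R W)\<^sup>* `` {e0}"
  have e0: "e0 \<in> graph_edges W"
    unfolding e0_def graph_edges_def
    using incident_iff[OF w(1) sg(1)[OF w(1,2)]] w sg(1)[OF w(1,2)] by auto
  have vertex: "\<exists>p2. ccw_edge (fst e) (snd e) p2 q" if "(e0, e) \<in> (face_step R W)\<^sup>*" for e
    using that
  proof (induction rule: rtrancl_induct)
    case base
    show ?case unfolding e0_def ccw_edge_iff using w(2) sg(2)[OF w(1,2)] by auto
  next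
    case (step e f)
    then show ?case using face_step_vertex[of "fst e" "snd e" "fst f" "snd f"] q by auto
  qed
  \<comment> \<open>All graph edges of the walk end at \<open>q\<close>, and a member witnessing the
    unbounded face would make \<open>q\<close> an end point of a boundary segment.\<close>
  have "F \<in> bounded_faces R W"
    unfolding bounded_faces_def
  proof (intro CollectI conjI notI)
    show "F \<in> faces R W" using e0 unfolding faces_def F_def by blast
    assume "\<exists>(w, s)\<in>F. s \<in> boundary_segments R W \<and> (\<exists>p q. ccw_edge w s p q \<and> q \<notin> rel_interior s)"
    then obtain w1 s1 p1 q1 where b: "(w1, s1) \<in> F" "s1 \<in> boundary_segments R W"
      "ccw_edge w1 s1 p1 q1" "q1 \<notin> rel_interior s1" by blast
    then have "(e0, (w1, s1)) \<in> (face_step R W)\<^sup>*" by (simp add: F_def)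
    then obtain p2 where p2: "ccw_edge w1 s1 p2 q" using vertex by fastforce
    have "(w1, s1) \<in> graph_edges W"
      using \<open>(e0, (w1, s1)) \<in> (face_step R W)\<^sup>*\<close> e0
      by (cases rule: rtranclE) (auto simp: face_step_def)
    then have g: "w1 \<in> W" "s1 \<in> segments W" by (auto simp: graph_edges_def)
    have "q1 = q"
      using sg_inj[OF g(1), of p1 q1 p2 q] b(3) p2 by (simp add: ccw_edge_sg[OF g])
    moreover have "q \<in> s1" using p2 by (auto simp: ccw_edge_iff)
    ultimately show False using b(2,4) q by (auto simp: boundary_corners_def)
  qed
  then have "card F = 2" using quad by (auto simp: face_degree_def)
  have qs: "q \<in> sg q r" "q \<in> sg p q" using sg_points[OF w(1)] w by blast+
  obtain w' p' l where w': "w' \<in> W" "side w' p' q" "sg p' q = sg q r" "0 < l"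
    "q - p' = (if q \<in> rel_interior (sg q r) then l else - l) *\<^sub>R (r - q)"
    using across[OF w(1,3) not_bd[OF qs(1)]] by blast
  obtain r' where r': "side w' q r'" using side_next[OF tile_polygon[OF w'(1)] w'(2)] .
  have qs': "q \<in> sg q r'" using sg_points[OF w'(1) r'] by blast
  obtain w'' p'' m where w'': "w'' \<in> W" "side w'' p'' q" "sg p'' q = sg q r'" "0 < m"
    "q - p'' = (if q \<in> rel_interior (sg q r') then m else - m) *\<^sub>R (r' - q)"
    using across[OF w'(1) r' not_bd[OF qs']] by blast
  have step1: "(e0, (w', sg q r)) \<in> face_step R W"
    unfolding e0_def by (rule across_face_step[OF w not_bd[OF qs(1)] w'])
  have step2: "((w', sg q r), (w'', sg q r')) \<in> face_step R W"
    using across_face_step[OF w'(1,2) r' not_bd[OF qs'] w''] w'(3) by simp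
  have inF: "e0 \<in> F" "(w', sg q r) \<in> F" "(w'', sg q r') \<in> F"
    unfolding F_def using step1 step2 by (auto intro: rtrancl_into_rtrancl)
  have "e0 \<noteq> (w', sg q r)" using sg_corner_neq[OF w] by (simp add: e0_def)
  moreover have "(w'', sg q r') \<noteq> (w', sg q r)"
    using sg_corner_neq[OF w'(1,2) r'] w'(3) by simp
  \<comment> \<open>The face has only two members and consecutive ones differ, so the second step
    returns to the start.\<close>
  ultimately have "(w'', sg q r') = e0"
    using \<open>card F = 2\<close> inF by (metis card_2_iff' )
  then have turn: "w'' = w" "sg q r' = sg p q" by (auto simp: e0_def)
  have "p'' = p" using side_end_unique[OF tile_polygon[OF w(1)] w(2), of p''] w''(2) turn(1) by simp
  let ?i = "q \<in> rel_interior (sg q r)" and ?j = "q \<in> rel_interior (sg p q)"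
  have qp: "q - p = (if ?j then m else - m) *\<^sub>R (r' - q)"
    using w''(5) turn \<open>p'' = p\<close> by simp
  have r'q: "r' - q = (if ?j then 1 / m else - (1 / m)) *\<^sub>R (q - p)"
    unfolding qp using w''(4) by auto
  have c1: "0 < cross (q - p) (r - q)" using corner_cross[OF tile_polygon[OF w(1)] w(2,3)] .
  have c2: "0 < cross (q - p') (r' - q)" using corner_cross[OF tile_polygon[OF w'(1)] w'(2) r'] .
  have "cross (r - q) (q - p) < 0" using c1 cross_commute[of "r - q"] by simp
  \<comment> \<open>Both corners turn left. If the two segments both passed through
    \<open>q\<close>, or both ended there, the directions at the second corner would make it turn
    right.\<close>
  then have ij: "?i \<longleftrightarrow> \<not> ?j"
    using c2 w'(4) w''(4) unfolding w'(5) r'q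
    by (auto simp: cross_simps(7,8) zero_less_mult_iff zero_less_divide_iff split: if_splits)
  show thesis
    using that[OF w'(1,2) r' w'(3) turn(2) w'(4) _ ij w'(5), of "1 / m"] w''(4) r'q ij by auto
qed

end

section \<open>Sign changes around the tiles\<close>

text \<open>The sign of a side for counting sign changes: a side with value zero takes over the sign
  of the nearest preceding nonzero side. The least fixed point makes all sides nonpositive when
  every value is zero.\<close>

inductive pos_side :: "(plane \<Rightarrow> plane \<Rightarrow> real) \<Rightarrow> plane set \<Rightarrow> plane \<Rightarrow> plane \<Rightarrow> bool" for U w where
  pos: "side w p q \<Longrightarrow> 0 < U p q \<Longrightarrow> pos_side U w p q"
| inherit: "pos_side U w p q \<Longrightarrow> side w q r \<Longrightarrow> U q r = 0 \<Longrightarrow> pos_side U w q r"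

lemma pos_side_side: "pos_side U w p q \<Longrightarrow> side w p q"
  by (induction rule: pos_side.induct) auto

lemma pos_side_nonzero:
  assumes "side w p q" "U p q \<noteq> 0"
  shows "pos_side U w p q \<longleftrightarrow> 0 < U p q"
  using assms by (auto intro: pos_side.pos elim: pos_side.cases)

lemma pos_side_zero:
  assumes "convex_polygon w" "side w p q" "side w q r" "U q r = 0"
  shows "pos_side U w q r \<longleftrightarrow> pos_side U w p q"
proof
  assume "pos_side U w q r"
  then show "pos_side U w p q"
  proof cases
    case (inherit p')
    then have "p' = p" using side_end_unique[OF assms(1,2), of p'] pos_side_side by blast
    then show ?thesis using inherit by simp
  qed (use assms(4) in simp)
next
  assume "pos_side U w p q"
  then show "pos_side U w q r" using assms(3,4) by (rule pos_side.inherit)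
qed

text \<open>The quantity is \<open>norm g\<close> times the cosine of the angle with
  \<open>g\<close>, which decreases with the angle to the left of \<open>g\<close>. It orders the
  rays at a corner of \<open>R\<close> by angle, using inner products only.\<close>

lemma cos_key_mono:
  assumes g: "g \<noteq> 0" "0 \<le> cross g x" "0 \<le> cross g y" and xy: "0 < cross y x"
  shows "(x \<bullet> g) / norm x < (y \<bullet> g) / norm y"
proof -
  have x0: "x \<noteq> 0" "y \<noteq> 0" using xy by (auto simp: cross_simps)
  define X X' Y Y' where "X = (x \<bullet> g) / norm x" and "X' = cross g x / norm x"
    and "Y = (y \<bullet> g) / norm y" and "Y' = cross g y / norm y"
  have sq: "(v \<bullet> g)\<^sup>2 + (cross g v)\<^sup>2 = (g \<bullet> g) * (v \<bullet> v)" for v :: plane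
    by (simp add: cross_def inner_vec_def sum_2 power2_eq_square algebra_simps)
  have nsq: "(v \<bullet> g / norm v)\<^sup>2 + (cross g v / norm v)\<^sup>2 = g \<bullet> g" if "v \<noteq> 0" for v
  proof -
    have "(v \<bullet> g / norm v)\<^sup>2 + (cross g v / norm v)\<^sup>2 = ((g \<bullet> g) * (v \<bullet> v)) / (norm v)\<^sup>2"
      unfolding power_divide add_divide_distrib[symmetric] sq ..
    also have "\<dots> = g \<bullet> g" using that by (simp add: power2_norm_eq_inner)
    finally show ?thesis .
  qed
  have eq: "X\<^sup>2 + X'\<^sup>2 = Y\<^sup>2 + Y'\<^sup>2"
    using nsq[OF x0(1)] nsq[OF x0(2)] by (simp add: X_def X'_def Y_def Y'_def)
  have pos: "0 \<le> X'" "0 \<le> Y'" using g by (simp_all add: X'_def Y'_def)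
  \<comment> \<open>The subtraction formula for the sine, before division by the norms.\<close>
  have id: "(y \<bullet> g) * cross g x - (x \<bullet> g) * cross g y = (g \<bullet> g) * cross y x"
    by (simp add: cross_def inner_vec_def sum_2) algebra
  have "0 < g \<bullet> g" using g(1) by simp
    then have "0 < (y \<bullet> g) * cross g x - (x \<bullet> g) * cross g y" unfolding id using xy by simp
    then have "0 < ((y \<bullet> g) * cross g x - (x \<bullet> g) * cross g y) / (norm x * norm y)"
      using x0 by simp
    also have "\<dots> = Y * X' - X * Y'"
      using x0 by (simp add: X_def X'_def Y_def Y'_def field_simps)
    finally have gt: "X * Y' < Y * X'" by simp
    have "X < Y"
    proof (rule ccontr)
      assume "\<not> X < Y"
      then have le: "Y \<le> X" by simp
      consider "0 \<le> Y" | "Y \<le> 0" "0 \<le> X" | "X \<le> 0" using le by linarith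
      then show False
      proof cases
        case 1
        then have "Y\<^sup>2 \<le> X\<^sup>2" using le by (simp add: power_mono)
        then have "X'\<^sup>2 \<le> Y'\<^sup>2" using eq by linarith
        then have "X' \<le> Y'" using pos(2) by (rule power2_le_imp_le)
        then show False using gt mult_mono[OF le, of X' Y'] 1 le pos by linarith
      next
        case 2
        then show False using gt mult_nonpos_nonneg[of Y X'] mult_nonneg_nonneg[of X Y'] pos by linarith
      next
        case 3
        then have "(- X)\<^sup>2 \<le> (- Y)\<^sup>2" using le by (intro power_mono) auto
        then have "Y'\<^sup>2 \<le> X'\<^sup>2" using eq by simp
        then have "Y' \<le> X'" using pos(1) by (rule power2_le_imp_le)
        then show False using gt mult_mono[of "- X" "- Y" Y' X'] 3 le pos by simp
      qed
    qed
  then show ?thesis by (simp add: X_def Y_def)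
qed

text \<open>Each pair of points excludes at most one value of \<mu>, the root of an affine function;
  independence of \<open>d1\<close> and \<open>d2\<close> keeps this function from vanishing
  identically.\<close>

lemma generic_combination:
  fixes V :: "plane set"
  assumes V: "finite V" and d: "cross d1 d2 \<noteq> 0"
  obtains \<mu> where "0 < \<mu>" "\<And>x y. x \<in> V \<Longrightarrow> y \<in> V \<Longrightarrow> x \<noteq> y \<Longrightarrow>
    cross x (d1 + \<mu> *\<^sub>R d2) \<noteq> cross y (d1 + \<mu> *\<^sub>R d2)"
proof -
  define B where "B = (\<lambda>(x, y). - cross (x - y) d1 / cross (x - y) d2) ` (V \<times> V)"
  have "finite B" using V by (simp add: B_def)
  then have "infinite ({0<..} - B)" using infinite_Ioi[of "0::real"] by (simp add: Diff_infinite_finite)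
  then obtain \<mu> where mu: "0 < \<mu>" "\<mu> \<notin> B"
    by (metis DiffE all_not_in_conv finite.emptyI greaterThan_iff)
  show thesis
  proof (rule that[OF mu(1)])
    fix x y assume xy: "x \<in> V" "y \<in> V" "x \<noteq> y"
    show "cross x (d1 + \<mu> *\<^sub>R d2) \<noteq> cross y (d1 + \<mu> *\<^sub>R d2)"
    proof
      assume "cross x (d1 + \<mu> *\<^sub>R d2) = cross y (d1 + \<mu> *\<^sub>R d2)"
      then have eq: "cross (x - y) d1 + \<mu> * cross (x - y) d2 = 0"
        by (simp add: cross_simps(2,3,8) right_diff_distrib)
      show False
      proof (cases "cross (x - y) d2 = 0")
        case True
        then have "cross (x - y) d1 = 0" using eq by simp
        have "x - y = (cross (x - y) d2 / cross d1 d2) *\<^sub>R d1 + (cross d1 (x - y) / cross d1 d2) *\<^sub>R d2"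
          by (rule cross_decompose[OF d])
        then have "x - y = 0"
          using True \<open>cross (x - y) d1 = 0\<close> cross_commute[of d1 "x - y"] by simp
        then show False using xy(3) by simp
      next
        case False
        then have "\<mu> = - cross (x - y) d1 / cross (x - y) d2" using eq by (simp add: field_simps)
        then have "\<mu> \<in> B" unfolding B_def using xy(1,2) by force
        then show False using mu(2) by simp
      qed
    qed
  qed
qed

section \<open>Generic functionals and the corners of the region\<close>

context polygon_tiling
begin

definition tile_vertices :: "plane set" where
  "tile_vertices = {p. \<exists>w\<in>insert R W. \<exists>q. side w p q}"

lemma finite_tile_vertices: "finite tile_vertices"
proof -
  have "tile_vertices = (\<Union>w\<in>insert R W. fst ` {(p, q). side w p q})"
    by (force simp: tile_vertices_def)
  then show ?thesis using finite_W finite_sides tile_polygon R_polygon by simp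
qed

lemma side_tile_vertices:
  assumes "w \<in> insert R W" "side w p q"
  shows "p \<in> tile_vertices" "q \<in> tile_vertices"
proof -
  have "convex_polygon w" using assms(1) R_polygon tile_polygon by auto
  then obtain r where "side w q r" using side_next[OF _ assms(2)] by blast
  then show "p \<in> tile_vertices" "q \<in> tile_vertices"
    using assms unfolding tile_vertices_def by blast+
qed

text \<open>The edge vectors of \<open>R\<close> before and after \<open>v0\<close> both give
  functionals maximal at \<open>v0\<close>, and only \<open>v0\<close> maximises both. So every
  positive combination has its strict maximum there, and \<mu> remains free to separate the tile
  vertices.\<close>

lemma generic_direction:
  assumes "side R v0 v1"
  obtains e where "\<And>x. x \<in> R \<Longrightarrow> x \<noteq> v0 \<Longrightarrow> cross x e < cross v0 e"
    "\<And>x y. x \<in> tile_vertices \<Longrightarrow> y \<in> tile_vertices \<Longrightarrow> x \<noteq> y \<Longrightarrow> cross x e \<noteq> cross y e"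
proof -
  obtain a where a: "side R a v0" using side_prev[OF R_polygon assms] .
  let ?d1 = "v0 - a" and ?d2 = "v1 - v0"
  have D: "0 < cross ?d1 ?d2" using corner_cross[OF R_polygon a assms] .
  then obtain \<mu> where mu: "0 < \<mu>" "\<And>x y. x \<in> tile_vertices \<Longrightarrow> y \<in> tile_vertices \<Longrightarrow> x \<noteq> y \<Longrightarrow>
    cross x (?d1 + \<mu> *\<^sub>R ?d2) \<noteq> cross y (?d1 + \<mu> *\<^sub>R ?d2)"
    using generic_combination[OF finite_tile_vertices, of ?d1 ?d2] by (metis less_irrefl)
  have "cross x (?d1 + \<mu> *\<^sub>R ?d2) < cross v0 (?d1 + \<mu> *\<^sub>R ?d2)" if x: "x \<in> R" "x \<noteq> v0" for x
  proof -
    have 1: "0 \<le> cross ?d1 (x - v0)"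
    proof -
      have "cross ?d1 (x - v0) = cross ?d1 (x - a)" by (simp add: cross_def algebra_simps)
      then show ?thesis using a x(1) by (simp add: side_def)
    qed
    have 2: "0 \<le> cross ?d2 (x - v0)" using assms x(1) by (simp add: side_def)
    have "cross ?d1 (x - v0) \<noteq> 0 \<or> cross ?d2 (x - v0) \<noteq> 0"
    proof (rule ccontr)
      assume z: "\<not> ?thesis"
      have "x - v0 = (cross (x - v0) ?d2 / cross ?d1 ?d2) *\<^sub>R ?d1
          + (cross ?d1 (x - v0) / cross ?d1 ?d2) *\<^sub>R ?d2"
        using D by (intro cross_decompose) simp
      then have "x - v0 = 0" using z cross_commute[of "x - v0" ?d2] by simp
      then show False using x(2) by simp
    qed
    then have "0 < cross ?d1 (x - v0) + \<mu> * cross ?d2 (x - v0)"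
      using 1 2 mu(1) by (smt (verit) mult_pos_pos mult_nonneg_nonneg)
    also have "\<dots> = cross (?d1 + \<mu> *\<^sub>R ?d2) (x - v0)" by (simp only: cross_simps(1,7) real_scaleR_def)
    also have "\<dots> = cross v0 (?d1 + \<mu> *\<^sub>R ?d2) - cross x (?d1 + \<mu> *\<^sub>R ?d2)"
      using cross_commute[of "?d1 + \<mu> *\<^sub>R ?d2" x] cross_commute[of "?d1 + \<mu> *\<^sub>R ?d2" v0]
      by (simp only: cross_simps(4))
    finally show ?thesis by simp
  qed
  then show thesis using that[of "?d1 + \<mu> *\<^sub>R ?d2"] mu(2) by blast
qed

lemma boundary_cornerE:
  assumes "q \<in> boundary_corners"
  obtains a b where "side R a b" "q = a \<or> q = b"
proof -
  obtain s where s: "s \<in> boundary_segments R W" "q \<in> s" "q \<notin> rel_interior s"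
    using assms by (auto simp: boundary_corners_def)
  obtain a b where ab: "side R a b" "s = closed_segment a b"
    using s(1) unfolding boundary_segments_iff by blast
  have "q \<notin> open_segment a b"
    using s(3) ab(2) rel_interior_segment[OF side_neq[OF R_polygon ab(1)]] by simp
  then have "q = a \<or> q = b" using s(2) unfolding ab(2) by (auto simp: open_segment_def)
  then show thesis using that ab(1) by blast
qed

lemma boundary_corner_frontier:
  assumes "q \<in> boundary_corners"
  shows "q \<notin> interior R"
proof -
  obtain a b where "side R a b" "q = a \<or> q = b" by (rule boundary_cornerE[OF assms])
  then have "q \<in> frontier R" using frontier_sides[OF R_polygon, of q] by auto
  then show ?thesis by (simp add: frontier_def)
qed

text \<open>Sides of \<open>R\<close> are faces: a segment in \<open>R\<close> with a corner of
  \<open>R\<close> in its relative interior lies in a side of \<open>R\<close>.\<close>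

lemma boundary_corner_interior_segment:
  assumes q: "q \<in> boundary_corners" and s: "s \<in> segments W" "s \<notin> boundary_segments R W"
  shows "q \<notin> rel_interior s"
proof
  assume qs: "q \<in> rel_interior s"
  obtain a b where ab: "side R a b" "q = a \<or> q = b" by (rule boundary_cornerE[OF q])
  obtain c d where cd: "c \<noteq> d" "s = closed_segment c d" using segmentsE[OF s(1)] .
  have qo: "q \<in> open_segment c d" using qs rel_interior_segment[OF cd(1)] cd(2) by simp
  have "c \<in> R" "d \<in> R" using segment_subset_R[OF s(1)] cd(2) by auto
  moreover have "q \<in> closed_segment a b" using ab(2) by auto
  ultimately have "c \<in> closed_segment a b" "d \<in> closed_segment a b"
    using face_ofD[OF side_face[OF R_polygon ab(1)] qo] by auto
  then have "s \<subseteq> closed_segment a b" unfolding cd(2) by (intro closed_segment_subset) auto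
  also have "\<dots> \<subseteq> frontier R" using frontier_sides[OF R_polygon] ab(1) by blast
  finally show False using s by (simp add: boundary_segments_def)
qed

text \<open>The tile and \<open>R\<close> lie on the same side of the common line, so the
  counterclockwise directions agree.\<close>

lemma boundary_side:
  assumes w: "w \<in> W" "side w p q" and v: "side R v0 v1" "sg p q = closed_segment v0 v1"
  obtains s t where "0 \<le> s" "s < t" "t \<le> 1" "p = v0 + s *\<^sub>R (v1 - v0)" "q = v0 + t *\<^sub>R (v1 - v0)"
    "q - p = (t - s) *\<^sub>R (v1 - v0)"
proof -
  have "p \<in> closed_segment v0 v1" "q \<in> closed_segment v0 v1" using sg_points[OF w] v(2) by auto
  then obtain s t where st: "p = v0 + s *\<^sub>R (v1 - v0)" "q = v0 + t *\<^sub>R (v1 - v0)"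
    "0 \<le> s" "t \<le> 1" unfolding closed_segment_iff by blast
  have qp: "q - p = (t - s) *\<^sub>R (v1 - v0)" unfolding st(1,2) by (simp add: scaleR_diff_left)
  obtain c where c: "c \<in> interior w" by (rule polygon_interior[OF tile_polygon[OF w(1)]])
  have "c \<in> R" using c tile_subset[OF w(1)] interior_subset by blast
  then have "0 \<le> cross (v1 - v0) (c - v0)" using v(1) by (simp add: side_def)
  moreover have "cross (v1 - v0) (c - v0) = cross (v1 - v0) (c - p)"
    unfolding st(1) by (simp add: cross_simps(2,4,8))
  moreover have "0 < (t - s) * cross (v1 - v0) (c - p)"
    using side_interior[OF tile_polygon[OF w(1)] w(2) c] unfolding qp by (simp only: cross_simps(7)) simp
  ultimately have "s < t" by (simp add: zero_less_mult_iff)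
  then show thesis using that st qp by blast
qed

lemma boundary_corner_on_side:
  assumes "q \<in> boundary_corners" "side R v0 v1" "q = v0 + t *\<^sub>R (v1 - v0)" "0 \<le> t" "t \<le> 1"
  shows "t = 0 \<or> t = 1"
proof -
  obtain a b where ab: "side R a b" "q = a \<or> q = b" by (rule boundary_cornerE[OF assms(1)])
  have "q \<in> closed_segment v0 v1" unfolding closed_segment_iff using assms(3-5) by blast
  then have "q = v0 \<or> q = v1" using side_vertex[OF R_polygon ab(1) assms(2), of q] ab(2) by auto
  moreover have "(1 - t) *\<^sub>R (v1 - v0) = v1 - q" unfolding assms(3) by (simp add: algebra_simps)
  ultimately show ?thesis using side_neq[OF R_polygon assms(2)] assms(3) by auto
qed

lemma boundary_side_start:
  assumes w: "w \<in> W" "side w q r" and v: "side R v0 v1" "sg q r = closed_segment v0 v1"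
    and q: "q \<in> boundary_corners"
  shows "q = v0 \<and> (\<exists>k>0. r - q = k *\<^sub>R (v1 - v0))"
proof -
  obtain s t where st: "0 \<le> s" "s < t" "t \<le> 1" "q = v0 + s *\<^sub>R (v1 - v0)"
    "r - q = (t - s) *\<^sub>R (v1 - v0)" using boundary_side[OF w v] by metis
  then have "s = 0" using boundary_corner_on_side[OF q v(1) st(4)] by auto
  then show ?thesis using st by auto
qed

lemma boundary_side_end:
  assumes w: "w \<in> W" "side w p q" and v: "side R v0 v1" "sg p q = closed_segment v0 v1"
    and q: "q \<in> boundary_corners"
  shows "q = v1 \<and> (\<exists>k>0. q - p = k *\<^sub>R (v1 - v0))"
proof -
  obtain s t where st: "0 \<le> s" "s < t" "t \<le> 1" "q = v0 + t *\<^sub>R (v1 - v0)"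
    "q - p = (t - s) *\<^sub>R (v1 - v0)" using boundary_side[OF w v] by metis
  then have "t = 1" using boundary_corner_on_side[OF q v(1) st(4)] by auto
  then have "q = v1" using st(4) by simp
  moreover have "0 < t - s" using st(2) by simp
  ultimately show ?thesis using st(5) by blast
qed

lemma segment_ray:
  assumes s: "s \<in> segments W" "q \<in> s" "q \<notin> rel_interior s" and xy: "x \<in> s" "y \<in> s" "x \<noteq> q" "y \<noteq> q"
  obtains k where "0 < k" "y - q = k *\<^sub>R (x - q)"
proof -
  have "cross (x - q) (y - q) = 0" using segment_cross[OF s(1,2) xy(1) s(2) xy(2)] .
  moreover have "x - q \<noteq> 0" using xy(3) by simp
  ultimately obtain k where k: "y - q = k *\<^sub>R (x - q)" using cross_eq_0_parallelE by blast
  have "k \<noteq> 0" using k xy(4) by auto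
  moreover have "\<not> k < 0"
  proof
    assume "k < 0"
    have y: "y = q + k *\<^sub>R (x - q)" using k by (metis add.commute diff_add_cancel)
    have yx: "y - x = (k - 1) *\<^sub>R (x - q)" unfolding y by (simp add: algebra_simps)
    have "1 / (1 - k) * (k - 1) = - 1" using \<open>k < 0\<close> by (simp add: field_simps)
    then have "x + (1 / (1 - k)) *\<^sub>R (y - x) = q"
      unfolding yx by (simp only: scaleR_scaleR) simp
    moreover have "y \<noteq> x" using yx \<open>k < 0\<close> xy(3) by auto
    ultimately have "q \<in> open_segment x y"
      unfolding open_segment_iff using \<open>k < 0\<close> by (intro conjI exI[of _ "1 / (1 - k)"]) auto
    then show False using segment_endpoint[OF s xy(1,2)] by blast
  qed
  ultimately show thesis using that[of k] k by simp
qed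

end

section \<open>The count of sign changes\<close>

context quad_tiling
begin

text \<open>\<open>U p q\<close> stands for edge length times outward displacement, whence its
  homogeneity in the edge vector. The set \<open>N\<close> collects the tile corners without sign
  change and \<open>H\<close> those where \<open>h\<close> is not extremal. Counting tile by tile
  gives \<open>card N \<le> card H\<close>, counting vertex by vertex the reverse strict
  inequality.\<close>

lemma balanced_zero:
  fixes U :: "plane \<Rightarrow> plane \<Rightarrow> real"
  assumes b0: "side R v0 v1"
    and hom: "\<And>w w' p q p' q' k. w \<in> W \<Longrightarrow> w' \<in> W \<Longrightarrow> side w p q \<Longrightarrow> side w' p' q' \<Longrightarrow>
      sg p q = sg p' q' \<Longrightarrow> q' - p' = k *\<^sub>R (q - p) \<Longrightarrow> U p' q' = k * U p q"
    and bd: "\<And>w p q. w \<in> W \<Longrightarrow> side w p q \<Longrightarrow> sg p q \<in> boundary_segments R W \<Longrightarrow>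
      sg p q \<noteq> closed_segment v0 v1 \<Longrightarrow> U p q = 0"
    and bal: "\<And>w p q. w \<in> W \<Longrightarrow> side w p q \<Longrightarrow> U p q \<noteq> 0 \<Longrightarrow>
      (\<exists>a b. side w a b \<and> 0 < U a b) \<and> (\<exists>a b. side w a b \<and> U a b < 0)"
    and w0: "w0 \<in> W" "side w0 p0 q0"
  shows "U p0 q0 = 0"
proof (rule ccontr)
  assume U0: "U p0 q0 \<noteq> 0"
  obtain e where top: "\<And>x. x \<in> R \<Longrightarrow> x \<noteq> v0 \<Longrightarrow> cross x e < cross v0 e"
    and generic: "\<And>x y. x \<in> tile_vertices \<Longrightarrow> y \<in> tile_vertices \<Longrightarrow> x \<noteq> y \<Longrightarrow> cross x e \<noteq> cross y e"
    using generic_direction[OF b0] by blast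
  define h where "h x = cross x e" for x
  have h_diff: "cross (x - y) e = h x - h y" for x y by (simp add: h_def cross_simps(3))
  have h_neq: "h p \<noteq> h q" if "w \<in> W" "side w p q" for w p q
    unfolding h_def using generic side_tile_vertices[OF _ that(2)] that(1)
      side_neq[OF tile_polygon[OF that(1)] that(2)] by blast
  \<comment> \<open>These are the tiles to which \<open>bal\<close> applies; the others have
    extremal corners but no sign changes to set against them.\<close>
  define W1 where "W1 = {w \<in> W. \<exists>p q. side w p q \<and> U p q \<noteq> 0}"
  have W1: "w \<in> W" if "w \<in> W1" for w using that by (simp add: W1_def)
  have W1I: "w \<in> W1" if "w \<in> W" "side w p q" "U p q \<noteq> 0" for w p q using that by (auto simp: W1_def)
  define cor where "cor w = {(p, q, r). side w p q \<and> side w q r}" for w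
  define steady where "steady w c = (case c of (p, q, r) \<Rightarrow> pos_side U w p q = pos_side U w q r)" for w c
  define turn where "turn c = (case c of (p, q, r) \<Rightarrow> (h q - h p) * (h r - h q) < 0)" for c
  define C where "C = Sigma W1 cor"
  define N where "N = Sigma W1 (\<lambda>w. {c \<in> cor w. steady w c})"
  define H where "H = Sigma W1 (\<lambda>w. {c \<in> cor w. \<not> turn c})"
  have N_iff: "(w, p, q, r) \<in> N \<longleftrightarrow> w \<in> W1 \<and> side w p q \<and> side w q r \<and>
      pos_side U w p q = pos_side U w q r" for w p q r
    by (auto simp: N_def cor_def steady_def)
  have H_iff: "(w, p, q, r) \<in> H \<longleftrightarrow> w \<in> W1 \<and> side w p q \<and> side w q r \<and>
      \<not> (h q - h p) * (h r - h q) < 0" for w p q r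
    by (auto simp: H_def cor_def turn_def)
  have fin_W1: "finite W1" using finite_W by (simp add: W1_def)
  have fin_cor: "finite (cor w)" if "w \<in> W1" for w
  proof (rule finite_subset)
    let ?E = "{(p, q). side w p q}"
    show "cor w \<subseteq> (\<lambda>((p, q), (a, r)). (p, q, r)) ` (?E \<times> ?E)"
      by (force simp: cor_def image_iff)
    show "finite ((\<lambda>((p, q), (a, r)). (p, q, r)) ` (?E \<times> ?E))"
      using finite_sides[OF tile_polygon[OF W1[OF that]]] by simp
  qed
  have fin: "finite N" "finite H" "finite C"
    unfolding N_def H_def C_def using fin_W1 fin_cor by auto

  \<comment> \<open>Per tile there are at most two extremal corners, a maximum and a minimum, and at
    least two sign changes, one in each direction.\<close>
  have "card (C - H) \<le> card (C - N)"
  proof -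
    have "C - H = Sigma W1 (\<lambda>w. {c \<in> cor w. turn c})"
      "C - N = Sigma W1 (\<lambda>w. {c \<in> cor w. \<not> steady w c})"
      by (auto simp: C_def H_def N_def)
    moreover have "card {c \<in> cor w. turn c} \<le> card {c \<in> cor w. \<not> steady w c}" if w: "w \<in> W1" for w
    proof -
      note P = tile_polygon[OF W1[OF w]]
      have gen: "\<forall>p q. side w p q \<longrightarrow> cross p e \<noteq> cross q e"
        using h_neq[OF W1[OF w]] by (auto simp: h_def)
      \<comment> \<open>The map tells a maximum from a minimum. Each occurs only once in a tile, by
        \<open>corner_max\<close> for \<open>e\<close> and for \<open>- e\<close>.\<close>
      have "inj_on (\<lambda>(p, q, r). h p < h q) {c \<in> cor w. turn c}"
      proof (rule inj_onI)
        fix c1 c2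
        assume cc: "c1 \<in> {c \<in> cor w. turn c}" "c2 \<in> {c \<in> cor w. turn c}"
          "(\<lambda>(p, q, r). h p < h q) c1 = (\<lambda>(p, q, r). h p < h q) c2"
        obtain p q r where c1: "c1 = (p, q, r)" by (cases c1) auto
        obtain p' q' r' where c2: "c2 = (p', q', r')" by (cases c2) auto
        have c: "(p, q, r) \<in> cor w" "turn (p, q, r)" "(p', q', r') \<in> cor w" "turn (p', q', r')"
          "(h p < h q) = (h p' < h q')"
          using cc unfolding c1 c2 by auto
        have s: "side w p q" "side w q r" "side w p' q'" "side w q' r'"
          using c by (auto simp: cor_def)
        have t: "(h q - h p) * (h r - h q) < 0" "(h q' - h p') * (h r' - h q') < 0"
          using c by (auto simp: turn_def)
        have "q' = q"
        proof (rule ccontr)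
          assume ne: "q' \<noteq> q"
          have q: "q \<in> w" "q' \<in> w" using side_endpoints[OF P] s by blast+
          show False
          proof (cases "h p < h q")
            case True
            then have "h r < h q" "h p' < h q'" "h r' < h q'"
              using t c(5) by (auto simp: mult_less_0_iff)
            then show False
              using corner_max[OF P s(1,2) _ _ q(2), of e] corner_max[OF P s(3,4) _ _ q(1), of e] ne True
              by (auto simp: h_def)
          next
            case False
            then have "h q < h p" "h q < h r" "h q' < h p'" "h q' < h r'"
              using t c(5) by (auto simp: mult_less_0_iff)
            then show False
              using corner_max[OF P s(1,2) _ _ q(2), of "- e"] corner_max[OF P s(3,4) _ _ q(1), of "- e"] ne
              by (auto simp: h_def cross_simps(6))
          qed
        qed
        then show "c1 = c2" unfolding c1 c2
          using side_end_unique[OF P s(1), of p'] side_start_unique[OF P s(2), of r'] s(3,4) by simp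
      qed
      then have "card {c \<in> cor w. turn c} \<le> card (UNIV :: bool set)"
        by (intro card_inj_on_le) auto
      also have "\<dots> = 2" by simp
      also have "2 \<le> card {c \<in> cor w. \<not> steady w c}"
      proof -
        obtain p q where "side w p q" "U p q \<noteq> 0" using w by (auto simp: W1_def)
        then obtain a b c d where ab: "side w a b" "0 < U a b" and cd: "side w c d" "U c d < 0"
          using bal[OF W1[OF w]] by blast
        have ab': "pos_side U w a b" and cd': "\<not> pos_side U w c d"
          using pos_side_nonzero[OF ab(1), of U] pos_side_nonzero[OF cd(1), of U] ab(2) cd(2) by auto
        obtain p1 q1 r1 where 1: "side w p1 q1" "side w q1 r1" "pos_side U w p1 q1" "\<not> pos_side U w q1 r1"
          using sides_change[OF P gen ab(1), of "pos_side U w", OF ab' cd(1) cd'] by blast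
        obtain p2 q2 r2 where 2: "side w p2 q2" "side w q2 r2" "\<not> pos_side U w p2 q2" "\<not> \<not> pos_side U w q2 r2"
          using sides_change[OF P gen cd(1), of "\<lambda>a b. \<not> pos_side U w a b", OF cd' ab(1)] ab' by blast
        have "(p1, q1, r1) \<noteq> (p2, q2, r2)" using 1 2 by blast
        then have "card {(p1, q1, r1), (p2, q2, r2)} = 2" by simp
        moreover have "{(p1, q1, r1), (p2, q2, r2)} \<subseteq> {c \<in> cor w. \<not> steady w c}"
          using 1 2 by (auto simp: cor_def steady_def)
        ultimately show ?thesis
          using card_mono[of "{c \<in> cor w. \<not> steady w c}" "{(p1, q1, r1), (p2, q2, r2)}"] fin_cor[OF w]
          by simp
      qed
      finally show ?thesis .
    qed
    ultimately show ?thesis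
      using fin_W1 fin_cor by (simp add: card_SigmaI sum_mono)
  qed
  moreover have "N \<subseteq> C" "H \<subseteq> C" by (auto simp: N_def H_def C_def)
  ultimately have NH: "card N \<le> card H"
    using card_Diff_subset[of N C] card_Diff_subset[of H C] card_mono[of C N] card_mono[of C H] fin
    by simp

  \<comment> \<open>Zeros inherit from the preceding side, so a change always shows as a nonzero
    value on the outgoing side.\<close>
  have change_nonzero: "U q r \<noteq> 0"
    if "w \<in> W1" "side w p q" "side w q r" "pos_side U w p q \<noteq> pos_side U w q r" for w p q r
    using pos_side_zero[OF tile_polygon[OF W1[OF that(1)]] that(2,3)] that(4) by blast
  \<comment> \<open>The edge vectors at the partner corner are multiples of the two original ones,
    one factor being positive and the other negative. Hence both the product of the two values of
    \<open>U\<close> and that of the two increments of \<open>h\<close> change sign: a sign change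
    becomes none, and a non-extremal corner becomes extremal.\<close>
  have change_partner: "\<exists>w' p' r' l. (w', p', q, r') \<in> N \<and> (h q - h p') * (h r' - h q) < 0 \<and>
      sg p' q = sg q r \<and> 0 < l \<and>
      q - p' = (if q \<in> rel_interior (sg q r) then l else - l) *\<^sub>R (r - q)"
    if c: "w \<in> W1" "side w p q" "side w q r" "pos_side U w p q \<noteq> pos_side U w q r"
      "q \<notin> boundary_corners" "\<not> (h q - h p) * (h r - h q) < 0" for w p q r
  proof -
    have Uqr: "U q r \<noteq> 0" using change_nonzero[OF c(1-4)] .
    obtain w' p' r' l m where w': "w' \<in> W" "side w' p' q" "side w' q r'" "sg p' q = sg q r" "sg q r' = sg p q"
      "0 < l" "0 < m"
      "q - p' = (if q \<in> rel_interior (sg q r) then l else - l) *\<^sub>R (r - q)"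
      "r' - q = (if q \<in> rel_interior (sg q r) then - m else m) *\<^sub>R (q - p)"
      using partner[OF W1[OF c(1)] c(2,3,5)] by metis
    have U1: "U p' q = (if q \<in> rel_interior (sg q r) then l else - l) * U q r"
      by (rule hom[OF W1[OF c(1)] w'(1) c(3) w'(2) w'(4)[symmetric] w'(8)])
    have U2: "U q r' = (if q \<in> rel_interior (sg q r) then - m else m) * U p q"
      by (rule hom[OF W1[OF c(1)] w'(1) c(2) w'(3) w'(5)[symmetric] w'(9)])
    have nz: "U p' q \<noteq> 0" using U1 Uqr w'(6) by simp
    have w'1: "w' \<in> W1" using W1I[OF w'(1,2) nz] .
    have pos1: "pos_side U w' p' q \<longleftrightarrow> 0 < U p' q" using pos_side_nonzero[of _ _ _ U, OF w'(2) nz] .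
    have posqr: "pos_side U w q r \<longleftrightarrow> 0 < U q r" using pos_side_nonzero[of _ _ _ U, OF c(3) Uqr] .
    have "pos_side U w' p' q = pos_side U w' q r'"
    proof (cases "U p q = 0")
      case True
      then have "U q r' = 0" using U2 by simp
      then show ?thesis using pos_side_zero[OF tile_polygon[OF w'(1)] w'(2,3)] by simp
    next
      case False
      then have "U q r' \<noteq> 0" using U2 w'(7) by simp
      then have "pos_side U w' q r' \<longleftrightarrow> 0 < U q r'" using pos_side_nonzero[of _ _ _ U, OF w'(3)] by blast
      moreover have "pos_side U w p q \<longleftrightarrow> 0 < U p q" using pos_side_nonzero[of _ _ _ U, OF c(2) False] .
      ultimately show ?thesis
        using c(4) pos1 posqr U1 U2 w'(6,7) Uqr False
        by (auto simp: zero_less_mult_iff mult_less_0_iff split: if_splits)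
    qed
    then have "(w', p', q, r') \<in> N" using w'1 w'(2,3) by (simp add: N_iff)
    moreover have "(h q - h p') * (h r' - h q) < 0"
    proof -
      have "h q \<noteq> h p" "h r \<noteq> h q"
        using h_neq[OF W1[OF c(1)] c(2)] h_neq[OF W1[OF c(1)] c(3)] by auto
      then have "0 < (h q - h p) * (h r - h q)" using c(6) by (auto simp: not_less order_less_le)
      then have "0 < (l * m) * ((h q - h p) * (h r - h q))" using w'(6,7) by simp
      moreover have "h q - h p' = (if q \<in> rel_interior (sg q r) then l else - l) * (h r - h q)"
        "h r' - h q = (if q \<in> rel_interior (sg q r) then - m else m) * (h q - h p)"
        unfolding h_diff[symmetric] w'(8,9) by (simp_all add: cross_simps(7))
      then have "(h q - h p') * (h r' - h q) = - ((l * m) * ((h q - h p) * (h r - h q)))"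
        by (cases "q \<in> rel_interior (sg q r)") simp_all
      ultimately show ?thesis by linarith
    qed
    ultimately show ?thesis using w'(4,6,8) by blast
  qed

  \<comment> \<open>The one corner of \<open>R\<close> that \<open>corner_steady\<close> does not
    cover contributes nothing to \<open>H\<close>.\<close>
  have v0_corner: "v0 \<noteq> q" if c: "w \<in> W" "side w p q" "side w q r" "\<not> (h q - h p) * (h r - h q) < 0" for w p q r
  proof
    assume q: "v0 = q"
    have "p \<in> R" "r \<in> R"
      using side_endpoints[OF tile_polygon[OF c(1)]] c tile_subset[OF c(1)] by blast+
    moreover have "p \<noteq> q" "r \<noteq> q" using side_neq[OF tile_polygon[OF c(1)]] c by blast+
    ultimately have "h p < h q" "h r < h q" using top q by (auto simp: h_def)
    then show False using c(4) by (simp add: mult_less_0_iff)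
  qed

  \<comment> \<open>At a non-extremal corner, \<open>e\<close> or \<open>- e\<close> points into the
    tile. Two tiles using the same direction coincide; two using opposite directions would make
    \<open>q\<close> an interior point of \<open>R\<close>.\<close>
  have corner_one: "(w, p, r) = (w', p', r')"
    if c: "w \<in> W" "side w p q" "side w q r" "\<not> (h q - h p) * (h r - h q) < 0"
      "w' \<in> W" "side w' p' q" "side w' q r'" "\<not> (h q - h p') * (h r' - h q) < 0"
      "q \<in> boundary_corners" for w p q r w' p' r'
  proof -
    have push: "\<exists>\<delta>\<in>{1, -1}. \<forall>\<^sub>F k in at_right 0. q + k *\<^sub>R (\<delta> *\<^sub>R e) \<in> interior v"
      if v: "v \<in> W" "side v a q" "side v q b" "\<not> (h q - h a) * (h b - h q) < 0" for v a b
    proof -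
      have "h q \<noteq> h a" "h b \<noteq> h q" using h_neq[OF v(1,2)] h_neq[OF v(1,3)] by auto
      then have "0 < (h q - h a) * (h b - h q)" using v(4) by (auto simp: not_less order_less_le)
      then consider "0 < cross (q - a) e" "0 < cross (b - q) e"
        | "0 < cross (q - a) (- e)" "0 < cross (b - q) (- e)"
        unfolding h_diff[symmetric] cross_simps(6) by (auto simp: zero_less_mult_iff)
      then show ?thesis
      proof cases
        case 1
        then show ?thesis
          using eventually_interior_corner[OF tile_polygon[OF v(1)] v(2,3), of e] by auto
      next
        case 2
        then show ?thesis
          using eventually_interior_corner[OF tile_polygon[OF v(1)] v(2,3), of "- e"] by auto
      qed
    qed
    obtain \<delta> \<delta>' where d: "\<delta> \<in> {1, -1::real}" "\<delta>' \<in> {1, -1::real}"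
      "\<forall>\<^sub>F k in at_right 0. q + k *\<^sub>R (\<delta> *\<^sub>R e) \<in> interior w"
      "\<forall>\<^sub>F k in at_right 0. q + k *\<^sub>R (\<delta>' *\<^sub>R e) \<in> interior w'"
      using push[OF c(1-4)] push[OF c(5-8)] by blast
    have "\<forall>\<^sub>F k in at_right 0. q + k *\<^sub>R (\<delta> *\<^sub>R e) \<in> interior w \<and> q + k *\<^sub>R (\<delta>' *\<^sub>R e) \<in> interior w'"
      using d(3,4) by (rule eventually_conj)
    then obtain k :: real where k: "q + k *\<^sub>R (\<delta> *\<^sub>R e) \<in> interior w" "q + k *\<^sub>R (\<delta>' *\<^sub>R e) \<in> interior w'"
      using eventually_happens'[OF trivial_limit_at_right_real] by blast
    have "\<delta> = \<delta>'"
    proof (rule ccontr)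
      assume "\<delta> \<noteq> \<delta>'"
      then have "\<delta>' = - \<delta>" using d(1,2) by auto
      then have "(1/2) *\<^sub>R (q + k *\<^sub>R (\<delta> *\<^sub>R e)) + (1/2) *\<^sub>R (q + k *\<^sub>R (\<delta>' *\<^sub>R e)) = q"
      proof -
        have "(1/2) *\<^sub>R (q + v) + (1/2) *\<^sub>R (q + - v) = ((1/2) + (1/2)) *\<^sub>R q" for v
          by (simp only: scaleR_add_right scaleR_add_left scaleR_minus_right) simp
        from this[of "k *\<^sub>R (\<delta> *\<^sub>R e)"] show ?thesis by (simp add: \<open>\<delta>' = - \<delta>\<close>)
      qed
      moreover have "convex (interior R)" using convex_interior[OF polygon_convex[OF R_polygon]] .
      moreover have "q + k *\<^sub>R (\<delta> *\<^sub>R e) \<in> interior R" "q + k *\<^sub>R (\<delta>' *\<^sub>R e) \<in> interior R"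
        using k interior_mono[OF tile_subset[OF c(1)]] interior_mono[OF tile_subset[OF c(5)]] by blast+
      ultimately have "q \<in> interior R"
        using convexD[of "interior R" "q + k *\<^sub>R (\<delta> *\<^sub>R e)" "q + k *\<^sub>R (\<delta>' *\<^sub>R e)" "1/2" "1/2"] by simp
      then show False using boundary_corner_frontier[OF c(9)] by simp
    qed
    then have "w = w'" using tile_eq_of_interior[OF c(1,5)] k by simp
    then show ?thesis
      using side_end_unique[OF tile_polygon[OF c(1)] c(2), of p']
        side_start_unique[OF tile_polygon[OF c(1)] c(3), of r'] c(6,7) by simp
  qed

  \<comment> \<open>Among the tiles of \<open>W1\<close> at \<open>q\<close>, take one whose
    outgoing side makes the smallest angle with \<open>b - a\<close>. A sign change there needs a
    nonzero value on that side. Since \<open>q\<close> is not the start of \<open>b0\<close>, the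
    side is then on an interior segment, and the tile across it belongs to \<open>W1\<close> and has
    a smaller angle.\<close>
  have corner_steady: "\<exists>w p r. (w, p, q, r) \<in> N"
    if c: "w \<in> W1" "side w p q" "side w q r" "q \<in> boundary_corners" "v0 \<noteq> q" for w p q r
  proof -
    obtain a b where ab: "side R a b" "q = a \<or> q = b" by (rule boundary_cornerE[OF c(4)])
    let ?g = "b - a"
    have g0: "?g \<noteq> 0" using side_neq[OF R_polygon ab(1)] by simp
    have g: "0 \<le> cross ?g (x - q)" if "x \<in> R" for x
    proof -
      have "0 \<le> cross ?g (x - a)" using ab(1) that by (simp add: side_def)
      moreover have "cross ?g (x - b) = cross ?g (x - a)" by (simp add: cross_def algebra_simps)
      ultimately show ?thesis using ab(2) by auto
    qed
    define A where "A = {(v, r'). \<exists>p'. v \<in> W1 \<and> side v p' q \<and> side v q r'}"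
    have "A \<subseteq> (\<lambda>(v, p', q', r'). (v, r')) ` C"
    proof
      fix x assume "x \<in> A"
      then obtain v r' p' where "x = (v, r')" "v \<in> W1" "side v p' q" "side v q r'" by (auto simp: A_def)
      then have "(v, p', q, r') \<in> C" by (simp add: C_def cor_def)
      then show "x \<in> (\<lambda>(v, p', q', r'). (v, r')) ` C" using \<open>x = (v, r')\<close> by force
    qed
    then have "finite A" using fin(3) finite_surj by blast
    moreover have "A \<noteq> {}" using c by (auto simp: A_def)
    ultimately obtain x where x: "x \<in> A" "\<And>y. y \<in> A \<Longrightarrow>
        ((snd y - q) \<bullet> ?g) / norm (snd y - q) \<le> ((snd x - q) \<bullet> ?g) / norm (snd x - q)"
      using finite_max_obtain[of A "\<lambda>y. ((snd y - q) \<bullet> ?g) / norm (snd y - q)"] by blast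
    obtain v r1 p1 where v: "x = (v, r1)" "v \<in> W1" "side v p1 q" "side v q r1"
      using x(1) by (auto simp: A_def)
    have vW: "v \<in> W" using W1[OF v(2)] .
    have "pos_side U v p1 q = pos_side U v q r1"
    proof (rule ccontr)
      assume "pos_side U v p1 q \<noteq> pos_side U v q r1"
      then have nz: "U q r1 \<noteq> 0" using change_nonzero[OF v(2-4)] by blast
      have nb: "sg q r1 \<notin> boundary_segments R W"
      proof
        assume "sg q r1 \<in> boundary_segments R W"
        then have "sg q r1 = closed_segment v0 v1" using bd[OF vW v(4)] nz by blast
        then show False using boundary_side_start[OF vW v(4) b0 _ c(4)] c(5) by blast
      qed
      have nri: "q \<notin> rel_interior (sg q r1)"
        using boundary_corner_interior_segment[OF c(4) sg(1)[OF vW v(4)] nb] .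
      obtain w' p' l where w': "w' \<in> W" "side w' p' q" "sg p' q = sg q r1" "0 < l"
        "q - p' = - l *\<^sub>R (r1 - q)"
        using across[OF vW v(4) disjI2[OF nb], unfolded if_not_P[OF nri]] by blast
      have "U p' q = - l * U q r1" by (rule hom[OF vW w'(1) v(4) w'(2) w'(3)[symmetric] w'(5)])
      then have w'1: "w' \<in> W1" using W1I[OF w'(1,2)] nz w'(4) by simp
      obtain r' where r': "side w' q r'" using side_next[OF tile_polygon[OF w'(1)] w'(2)] .
      have "0 < cross (q - p') (r' - q)" using corner_cross[OF tile_polygon[OF w'(1)] w'(2) r'] .
      then have "0 < l * cross (r' - q) (r1 - q)"
        unfolding w'(5) using cross_commute[of "r1 - q" "r' - q"] by (simp only: cross_simps(7)) simp
      then have "0 < cross (r' - q) (r1 - q)" using w'(4) by (simp add: zero_less_mult_iff)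
      moreover have "r' \<in> R" "r1 \<in> R"
        using side_endpoints(2)[OF tile_polygon[OF w'(1)] r'] tile_subset[OF w'(1)]
          side_endpoints(2)[OF tile_polygon[OF vW] v(4)] tile_subset[OF vW] by blast+
      ultimately have "((r1 - q) \<bullet> ?g) / norm (r1 - q) < ((r' - q) \<bullet> ?g) / norm (r' - q)"
        using cos_key_mono[OF g0 g g] by blast
      moreover have "(w', r') \<in> A" using w'1 w'(2) r' by (auto simp: A_def)
      then have "((r' - q) \<bullet> ?g) / norm (r' - q) \<le> ((r1 - q) \<bullet> ?g) / norm (r1 - q)"
        using x(2)[of "(w', r')"] v(1) by simp
      ultimately show False by simp
    qed
    then have "(v, p1, q, r1) \<in> N" using v by (simp add: N_iff)
    then show ?thesis by blast
  qed

  \<comment> \<open>A non-extremal corner goes to itself if it shows no sign change and to its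
    partner across the outgoing side otherwise; at a corner of \<open>R\<close> it goes to any
    member of \<open>N\<close> at the same vertex.\<close>
  define rel where "rel c c' \<longleftrightarrow> (case c of (w, p, q, r) \<Rightarrow> case c' of (w', p', q', r') \<Rightarrow> q' = q \<and>
      (q \<notin> boundary_corners \<longrightarrow> (if pos_side U w p q = pos_side U w q r then c' = c else
        (h q - h p') * (h r' - h q) < 0 \<and> sg p' q = sg q r \<and>
        (\<exists>l>0. q - p' = (if q \<in> rel_interior (sg q r) then l else - l) *\<^sub>R (r - q)))))" for c c'
  have "\<forall>c\<in>H. \<exists>c'. c' \<in> N \<and> rel c c'"
  proof
    fix c assume cH: "c \<in> H"
    obtain w p q r where c: "c = (w, p, q, r)" by (cases c) auto
    have s: "w \<in> W1" "side w p q" "side w q r" "\<not> (h q - h p) * (h r - h q) < 0"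
      using cH unfolding c H_iff by auto
    show "\<exists>c'. c' \<in> N \<and> rel c c'"
    proof (cases "q \<in> boundary_corners")
      case True
      then obtain w' p' r' where "(w', p', q, r') \<in> N"
        using corner_steady[OF s(1-3) True v0_corner[OF W1[OF s(1)] s(2-4)]] by blast
      then show ?thesis using True by (intro exI[of _ "(w', p', q, r')"]) (simp add: c rel_def)
    next
      case False
      show ?thesis
      proof (cases "pos_side U w p q = pos_side U w q r")
        case True
        then have "(w, p, q, r) \<in> N" using s by (simp add: N_iff)
        then show ?thesis using True False by (intro exI[of _ c]) (simp add: c rel_def)
      next
        case ch: False
        obtain w' p' r' l where "(w', p', q, r') \<in> N" "(h q - h p') * (h r' - h q) < 0"
          "sg p' q = sg q r" "0 < l"
          "q - p' = (if q \<in> rel_interior (sg q r) then l else - l) *\<^sub>R (r - q)"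
          using change_partner[OF s(1-3) ch False] s(4) by blast
        then show ?thesis
          using ch False by (intro exI[of _ "(w', p', q, r')"]) (auto simp: c rel_def)
      qed
    qed
  qed
  then obtain \<phi> where phi: "\<And>c. c \<in> H \<Longrightarrow> \<phi> c \<in> N" "\<And>c. c \<in> H \<Longrightarrow> rel c (\<phi> c)" by metis
  \<comment> \<open>Away from the corners of \<open>R\<close>, fixed corners are non-extremal,
    partners are extremal, and a partner determines the outgoing side from which it was reached. At
    a corner of \<open>R\<close>, \<open>corner_one\<close> suffices.\<close>
  have "inj_on \<phi> H"
  proof (rule inj_onI)
    fix c1 c2 assume cc: "c1 \<in> H" "c2 \<in> H" "\<phi> c1 = \<phi> c2"
    obtain w p q r where c1: "c1 = (w, p, q, r)" by (cases c1) auto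
    obtain w2 p2 q2 r2 where c2: "c2 = (w2, p2, q2, r2)" by (cases c2) auto
    obtain w' p' q' r' where c': "\<phi> c1 = (w', p', q', r')" by (cases "\<phi> c1") auto
    have rel: "rel (w, p, q, r) (w', p', q', r')" "rel (w2, p2, q2, r2) (w', p', q', r')"
      using phi(2)[OF cc(1)] phi(2)[OF cc(2)] cc(3) c1 c2 c' by auto
    have "q' = q" "q2 = q" using rel by (auto simp: rel_def)
    then have s: "w \<in> W1" "side w p q" "side w q r" "\<not> (h q - h p) * (h r - h q) < 0"
      and s2: "w2 \<in> W1" "side w2 p2 q" "side w2 q r2" "\<not> (h q - h p2) * (h r2 - h q) < 0"
      using cc(1,2) unfolding c1 c2 H_iff by auto
    show "c1 = c2"
    proof (cases "q \<in> boundary_corners")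
      case True
      then show ?thesis
        using corner_one[OF W1[OF s(1)] s(2-4) W1[OF s2(1)] s2(2-4)] c1 c2 \<open>q2 = q\<close> by simp
    next
      case False
      consider "pos_side U w p q = pos_side U w q r" "pos_side U w2 p2 q = pos_side U w2 q r2"
        | "pos_side U w p q = pos_side U w q r" "pos_side U w2 p2 q \<noteq> pos_side U w2 q r2"
        | "pos_side U w p q \<noteq> pos_side U w q r" "pos_side U w2 p2 q = pos_side U w2 q r2"
        | "pos_side U w p q \<noteq> pos_side U w q r" "pos_side U w2 p2 q \<noteq> pos_side U w2 q r2" by blast
      then show ?thesis
      proof cases
        case 1
        then show ?thesis using rel False c1 c2 \<open>q2 = q\<close> by (simp add: rel_def)
      next
        case 2
        then show ?thesis using rel False s(4) \<open>q2 = q\<close> by (simp add: rel_def)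
      next
        case 3
        then show ?thesis using rel False s2(4) \<open>q2 = q\<close> by (simp add: rel_def)
      next
        case 4
        obtain l l2 where l: "0 < l" "q - p' = (if q \<in> rel_interior (sg q r) then l else - l) *\<^sub>R (r - q)"
          and l2: "0 < l2" "q - p' = (if q \<in> rel_interior (sg q r2) then l2 else - l2) *\<^sub>R (r2 - q)"
          and sgs: "sg q r = sg q r2"
        proof -
          have 1: "sg p' q = sg q r \<and>
              (\<exists>l>0. q - p' = (if q \<in> rel_interior (sg q r) then l else - l) *\<^sub>R (r - q))"
            using rel(1) 4(1) False by (simp add: rel_def)
          have 2: "sg p' q = sg q r2 \<and>
              (\<exists>l>0. q - p' = (if q \<in> rel_interior (sg q r2) then l else - l) *\<^sub>R (r2 - q))"
            using rel(2) 4(2) False \<open>q2 = q\<close> by (simp add: rel_def)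
          show thesis using that 1 2 by metis
        qed
        have "l2 *\<^sub>R (r2 - q) = l *\<^sub>R (r - q)"
          using l(2) l2(2) sgs by (auto split: if_splits)
        then have "(1 / l2) *\<^sub>R (l2 *\<^sub>R (r2 - q)) = (1 / l2) *\<^sub>R (l *\<^sub>R (r - q))" by simp
        then have "r2 - q = (l / l2) *\<^sub>R (r - q)" using l2(1) by simp
        moreover have "0 < l / l2" using l(1) l2(1) by simp
        ultimately have "w2 = w \<and> r2 = r"
          by (rule side_start_unique_tile[OF W1[OF s(1)] W1[OF s2(1)] s(3) s2(3)])
        then show ?thesis
          using side_end_unique[OF tile_polygon[OF W1[OF s(1)]] s(2), of p2] s2(2) c1 c2 \<open>q2 = q\<close> by simp
      qed
    qed
  qed
  \<comment> \<open>At the lowest vertex \<open>q\<close> of a tile in \<open>W1\<close>, all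
    corners of such tiles are minima, so none is in \<open>H\<close>; it remains to find a member of
    \<open>N\<close> there.\<close>
  moreover have "\<phi> ` H \<subset> N"
  proof -
    have "C \<noteq> {}"
    proof -
      obtain r where "side w0 q0 r" using side_next[OF tile_polygon[OF w0(1)] w0(2)] .
      then have "(w0, p0, q0, r) \<in> C" using W1I[OF w0 U0] w0(2) by (simp add: C_def cor_def)
      then show ?thesis by auto
    qed
    then obtain c where c: "c \<in> C" "\<And>d. d \<in> C \<Longrightarrow> - h (fst (snd (snd d))) \<le> - h (fst (snd (snd c)))"
      using finite_max_obtain[OF fin(3), of "\<lambda>c. - h (fst (snd (snd c)))"] by blast
    obtain w p q r where c': "c = (w, p, q, r)" by (cases c) auto
    have s: "w \<in> W1" "side w p q" "side w q r" using c(1) unfolding c' by (auto simp: C_def cor_def)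
    have low: "h q < h p' \<and> h q < h r'" if d: "v \<in> W1" "side v p' q" "side v q r'" for v p' r'
    proof -
      note P = tile_polygon[OF W1[OF d(1)]]
      obtain a where a: "side v a p'" using side_prev[OF P d(2)] .
      obtain b where b: "side v r' b" using side_next[OF P d(3)] .
      have "(v, a, p', q) \<in> C" "(v, q, r', b) \<in> C" using d a b by (auto simp: C_def cor_def)
      then have "h q \<le> h p'" "h q \<le> h r'" using c(2) c' by fastforce+
      moreover have "h p' \<noteq> h q" "h q \<noteq> h r'"
        using h_neq[OF W1[OF d(1)] d(2)] h_neq[OF W1[OF d(1)] d(3)] .
      ultimately show ?thesis by linarith
    qed
    have noH: "(v, p', q, r') \<notin> H" for v p' r'
    proof
      assume "(v, p', q, r') \<in> H"
      then show False using low[of v p' r'] by (auto simp: H_iff mult_less_0_iff)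
    qed
    have "\<exists>v p' r'. (v, p', q, r') \<in> N"
    proof (cases "q \<in> boundary_corners")
      case True
      have "v0 \<noteq> q"
      proof
        assume "v0 = q"
        have "r \<in> R" "r \<noteq> q"
          using side_endpoints(2)[OF tile_polygon[OF W1[OF s(1)]] s(3)] tile_subset[OF W1[OF s(1)]]
            side_neq[OF tile_polygon[OF W1[OF s(1)]] s(3)] by auto
        then have "h r < h q" using top[of r] \<open>v0 = q\<close> by (auto simp: h_def)
        then show False using low[OF s] by simp
      qed
      then show ?thesis using corner_steady[OF s True] by blast
    next
      case False
      show ?thesis
      proof (cases "pos_side U w p q = pos_side U w q r")
        case True
        then have "(w, p, q, r) \<in> N" using s by (simp add: N_iff)
        then show ?thesis by blast
      next
        case ch: False
        obtain w' p' r' l m where w': "w' \<in> W" "side w' p' q" "side w' q r'" "sg p' q = sg q r"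
          "0 < l" "0 < m" "q - p' = (if q \<in> rel_interior (sg q r) then l else - l) *\<^sub>R (r - q)"
          "r' - q = (if q \<in> rel_interior (sg q r) then - m else m) *\<^sub>R (q - p)"
          using partner[OF W1[OF s(1)] s(2,3) False] by metis
        have Uqr: "U q r \<noteq> 0" using change_nonzero[OF s ch] .
        have "U p' q = (if q \<in> rel_interior (sg q r) then l else - l) * U q r"
          by (rule hom[OF W1[OF s(1)] w'(1) s(3) w'(2) w'(4)[symmetric] w'(7)])
        then have w'1: "w' \<in> W1" using W1I[OF w'(1,2)] Uqr w'(5) by simp
        \<comment> \<open>The partner also has its corner at the lowest vertex and would be a
          minimum, but one of its sides continues a side of \<open>w\<close> straight through
          \<open>q\<close> and thus descends.\<close>
        have "h q - h p' = (if q \<in> rel_interior (sg q r) then l else - l) * (h r - h q)"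
          "h r' - h q = (if q \<in> rel_interior (sg q r) then - m else m) * (h q - h p)"
          unfolding h_diff[symmetric] w'(7,8) by (simp_all add: cross_simps(7))
        moreover have "0 < l * (h r - h q)" "m * (h q - h p) < 0"
          using low[OF s] w'(5,6) by (simp_all add: mult_pos_neg)
        ultimately have False
          using low[OF w'1 w'(2,3)] by (cases "q \<in> rel_interior (sg q r)") simp_all
        then show ?thesis ..
      qed
    qed
    then obtain v p' r' where n: "(v, p', q, r') \<in> N" by blast
    have "(v, p', q, r') \<notin> \<phi> ` H"
    proof
      assume "(v, p', q, r') \<in> \<phi> ` H"
      then obtain d where d: "d \<in> H" "\<phi> d = (v, p', q, r')" by auto
      obtain w2 p2 q2 r2 where d2: "d = (w2, p2, q2, r2)" by (cases d) auto
      have "q2 = q" using phi(2)[OF d(1)] d(2) d2 by (simp add: rel_def)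
      then show False using noH d(1) d2 by simp
    qed
    then show ?thesis using phi(1) n by blast
  qed
  ultimately have "card H < card N"
    using psubset_card_mono[OF fin(1), of "\<phi> ` H"] card_image[of \<phi> H] by simp
  then show False using NH by simp
qed

section \<open>Comparing the numbers of tiles and free segments\<close>

lemma finite_segments: "finite (segments W)"
proof -
  have "segments W \<subseteq> (\<Union>w\<in>W. (\<lambda>(p, q). sg p q) ` {(p, q). side w p q})"
  proof
    fix s assume "s \<in> segments W"
    then obtain w p q where w: "w \<in> W" "side w p q" "sg p q = s" by (rule segment_incident)
    then have "(p, q) \<in> {(p, q). side w p q}" "s = (\<lambda>(p, q). sg p q) (p, q)" by auto
    then show "s \<in> (\<Union>w\<in>W. (\<lambda>(p, q). sg p q) ` {(p, q). side w p q})" using w(1) by blast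
  qed
  moreover have "finite (\<Union>w\<in>W. (\<lambda>(p, q). sg p q) ` {(p, q). side w p q})"
    using finite_W finite_sides[OF tile_polygon] by simp
  ultimately show ?thesis by (rule finite_subset)
qed

text \<open>A tile with highest corner \<open>q\<close> is charged to an interior segment that
  carries one of its two sides at \<open>q\<close> and ends there. At a T-junction one of the two
  segments qualifies. At a corner of \<open>R\<close> the choice depends only on the preceding
  corner \<open>a\<close> of \<open>R\<close>: if \<open>a\<close> is higher, the incoming side is
  charged, otherwise the outgoing one. If the latter lies on the boundary, \<open>q\<close> is the
  highest corner of \<open>R\<close> and the charge goes to \<open>b0\<close>, which happens for at
  most one tile.\<close>

lemma card_tiles_le:
  assumes b0: "b0 \<in> boundary_segments R W"
  shows "card W \<le> card (interior_segments R W \<union> {b0})"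
proof -
  let ?I = "interior_segments R W"
  have I_iff: "s \<in> ?I \<longleftrightarrow> s \<in> segments W \<and> s \<notin> boundary_segments R W" for s
    by (simp add: interior_segments_def)
  obtain v0 v1 where v: "side R v0 v1" using b0 unfolding boundary_segments_iff by blast
  obtain e where "\<And>x. x \<in> R \<Longrightarrow> x \<noteq> v0 \<Longrightarrow> cross x e < cross v0 e"
    and generic: "\<And>x y. x \<in> tile_vertices \<Longrightarrow> y \<in> tile_vertices \<Longrightarrow> x \<noteq> y \<Longrightarrow> cross x e \<noteq> cross y e"
    using generic_direction[OF v] by blast
  define h where "h x = cross x e" for x
  have h_diff: "cross (x - y) e = h x - h y" for x y by (simp add: h_def cross_simps(3))
  have h_neq: "h p \<noteq> h q" if "w \<in> insert R W" "side w p q" for w p q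
  proof -
    have "convex_polygon w" using that(1) R_polygon tile_polygon by auto
    then have "p \<noteq> q" using side_neq that(2) by blast
    then show ?thesis unfolding h_def by (rule generic[OF side_tile_vertices[OF that]])
  qed
  define top where "top w p q r \<longleftrightarrow> side w p q \<and> side w q r \<and> h p < h q \<and> h r < h q" for w p q r
  define M where "M w s \<longleftrightarrow> (\<exists>p q r. top w p q r \<and>
     ((q \<notin> boundary_corners \<and> s \<in> ?I \<and> q \<notin> rel_interior s \<and> (s = sg p q \<or> s = sg q r)) \<or>
      (q \<in> boundary_corners \<and> s \<in> ?I \<and> (\<exists>a. side R a q \<and> h q < h a) \<and> s = sg p q) \<or>
      (q \<in> boundary_corners \<and> s \<in> ?I \<and> (\<exists>a. side R a q \<and> h a < h q) \<and> s = sg q r) \<or>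
      (q \<in> boundary_corners \<and> sg q r \<in> boundary_segments R W \<and> (\<exists>a. side R a q \<and> h a < h q) \<and> s = b0)))"
    for w s
  have "\<exists>s. M w s" if w: "w \<in> W" for w
  proof -
    note P = tile_polygon[OF w]
    have gen: "\<forall>p q. side w p q \<longrightarrow> cross p e \<noteq> cross q e"
      using h_neq[of w] w by (auto simp: h_def)
    obtain p q where pq: "side w p q" "\<forall>x\<in>w. x \<noteq> q \<longrightarrow> cross x e < cross q e"
      using sides_closed_max[OF P gen subset_refl] sides_nonempty[OF P] by blast
    obtain r where r: "side w q r" using side_next[OF P pq(1)] .
    have "h p < h q" "h r < h q"
      using pq(2) side_endpoints[OF P pq(1)] side_endpoints[OF P r] side_neq[OF P pq(1)] side_neq[OF P r]
      by (auto simp: h_def)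
    then have t: "top w p q r" using pq(1) r by (simp add: top_def)
    have s: "sg p q \<in> segments W" "sg q r \<in> segments W" using sg(1)[OF w] pq(1) r by auto
    show ?thesis
    proof (cases "q \<in> boundary_corners")
      case False
      have "q \<notin> rel_interior (sg p q) \<or> q \<notin> rel_interior (sg q r)"
        using partner[OF w pq(1) r False] by metis
      moreover have "q \<in> sg p q" "q \<in> sg q r"
        using sg_points[OF w pq(1)] sg_points[OF w r] by auto
      then have "q \<notin> rel_interior (sg p q) \<Longrightarrow> sg p q \<in> ?I" "q \<notin> rel_interior (sg q r) \<Longrightarrow> sg q r \<in> ?I"
        using False s unfolding I_iff boundary_corners_def by blast+
      ultimately obtain s' where s': "s' \<in> ?I" "q \<notin> rel_interior s'" "s' = sg p q \<or> s' = sg q r"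
        by metis
      have "M w s'"
        unfolding M_def
        by (rule exI[of _ p], rule exI[of _ q], rule exI[of _ r], rule conjI[OF t], rule disjI1)
          (intro conjI False s')
      then show ?thesis ..
    next
      case True
      obtain c d where cd: "side R c d" "q = c \<or> q = d" by (rule boundary_cornerE[OF True])
      then obtain a where a: "side R a q" using side_prev[OF R_polygon cd(1)] by blast
      have "h a \<noteq> h q" using h_neq[OF _ a] by simp
      then consider "h q < h a" | "h a < h q" by linarith
      then show ?thesis
      proof cases
        case 1
        \<comment> \<open>On the boundary the incoming side would run along the side of
          \<open>R\<close> from \<open>a\<close> to \<open>q\<close>, which descends, whereas
          \<open>p\<close> is below \<open>q\<close>.\<close>
        have nb: "sg p q \<notin> boundary_segments R W"
        proof
          assume "sg p q \<in> boundary_segments R W"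
          then obtain c d where cd: "side R c d" "sg p q = closed_segment c d"
            unfolding boundary_segments_iff by blast
          then obtain k where k: "q = d" "0 < k" "q - p = k *\<^sub>R (d - c)"
            using boundary_side_end[OF w pq(1) cd True] by blast
          have "c = a" using side_end_unique[OF R_polygon a, of c] cd(1) k(1) by simp
          then have "h q - h p = k * (h q - h a)"
            unfolding h_diff[symmetric] k(3) k(1)[symmetric] by (simp only: cross_simps(7) real_scaleR_def)
          moreover have "k * (h q - h a) < 0" using 1 k(2) by (simp add: mult_pos_neg)
          ultimately show False using \<open>h p < h q\<close> by linarith
        qed
        have "M w (sg p q)"
          unfolding M_def I_iff
          by (rule exI[of _ p], rule exI[of _ q], rule exI[of _ r], rule conjI[OF t], rule disjI2, rule disjI1)
            (intro conjI True s(1) nb exI[of _ a] a 1 refl)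
        then show ?thesis ..
      next
        case 2
        show ?thesis
        proof (cases "sg q r \<in> boundary_segments R W")
          case bd: True
          have "M w b0"
            unfolding M_def
            by (rule exI[of _ p], rule exI[of _ q], rule exI[of _ r], rule conjI[OF t], rule disjI2, rule disjI2, rule disjI2)
              (intro conjI True bd exI[of _ a] a 2 refl)
          then show ?thesis ..
        next
          case bd: False
          have "M w (sg q r)"
            unfolding M_def I_iff
            by (rule exI[of _ p], rule exI[of _ q], rule exI[of _ r], rule conjI[OF t], rule disjI2, rule disjI2, rule disjI1)
              (intro conjI True bd s(2) exI[of _ a] a 2 refl)
          then show ?thesis ..
        qed
      qed
    qed
  qed
  then obtain m where m: "\<And>w. w \<in> W \<Longrightarrow> M w (m w)" by metis
  have "m w \<in> ?I \<union> {b0}" if "w \<in> W" for w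
    using m[OF that] unfolding M_def by blast
  moreover have "inj_on m W"
  proof (rule inj_onI)
    fix w w' assume w: "w \<in> W" and w': "w' \<in> W" and eq: "m w = m w'"
    note P = tile_polygon[OF w]
    show "w = w'"
    proof (cases "m w \<in> ?I")
      case False
      \<comment> \<open>A tile charged to \<open>b0\<close> has its highest corner at a corner of
        \<open>R\<close> above both neighbouring corners, and it runs along the side of
        \<open>R\<close> that starts there; this determines the tile.\<close>
      have f: "\<exists>p q r a k d. top v p q r \<and> side R a q \<and> h a < h q \<and> side R q d \<and> 0 < k \<and> r - q = k *\<^sub>R (d - q)"
        if v: "v \<in> W" "m v \<notin> ?I" for v
      proof -
        obtain p q r a where t: "top v p q r" "q \<in> boundary_corners" "sg q r \<in> boundary_segments R W"
          "side R a q" "h a < h q"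
          using m[OF v(1)] v(2) unfolding M_def by blast
        obtain c d where cd: "side R c d" "sg q r = closed_segment c d"
          using t(3) unfolding boundary_segments_iff by blast
        have "side v q r" using t(1) by (simp add: top_def)
        then obtain k where k: "q = c" "0 < k" "r - q = k *\<^sub>R (d - c)"
          using boundary_side_start[OF v(1) _ cd t(2)] by blast
        then show ?thesis using t cd(1) by blast
      qed
      obtain p q r a k d where t: "top w p q r" "side R a q" "h a < h q" "side R q d" "0 < k" "r - q = k *\<^sub>R (d - q)"
        using f[OF w False] by blast
      obtain p' q' r' a' k' d' where t': "top w' p' q' r'" "side R a' q'" "h a' < h q'" "side R q' d'" "0 < k'"
        "r' - q' = k' *\<^sub>R (d' - q')"
        using f[OF w' False[unfolded eq]] by blast
      have "h d < h q"
      proof -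
        have "h r - h q = k * (h d - h q)" unfolding h_diff[symmetric] t(6) by (simp only: cross_simps(7) real_scaleR_def)
        moreover have "h r < h q" using t(1) by (simp add: top_def)
        ultimately have "k * (h d - h q) < 0" by simp
        then show ?thesis using t(5) by (simp add: mult_less_0_iff)
      qed
      moreover have "h d' < h q'"
      proof -
        have "h r' - h q' = k' * (h d' - h q')" unfolding h_diff[symmetric] t'(6) by (simp only: cross_simps(7) real_scaleR_def)
        moreover have "h r' < h q'" using t'(1) by (simp add: top_def)
        ultimately have "k' * (h d' - h q') < 0" by simp
        then show ?thesis using t'(5) by (simp add: mult_less_0_iff)
      qed
      ultimately have qq: "q' = q"
        using corner_max[OF R_polygon t(2,4), of e q'] corner_max[OF R_polygon t'(2,4), of e q]
          t(3) t'(3) side_endpoints(1)[OF R_polygon t(4)] side_endpoints(1)[OF R_polygon t'(4)]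
        unfolding h_def by fastforce
      then have "d' = d" using side_start_unique[OF R_polygon t(4), of d'] t'(4) by simp
      then have "r' - q = (k' / k) *\<^sub>R (r - q)" using t(5,6) t'(6) qq by simp
      moreover have "0 < k' / k" using t(5) t'(5) by simp
      moreover have "side w q r" "side w' q r'" using t(1) t'(1) qq by (auto simp: top_def)
      ultimately show ?thesis using side_start_unique_tile[OF w w'] by blast
    next
      case True
      define s where "s = m w"
      have s: "s \<in> segments W" "s \<notin> boundary_segments R W" using True by (simp_all add: s_def I_iff)
      have "s \<noteq> b0" using s(2) b0 by auto
      \<comment> \<open>The charged corner is an end of \<open>s\<close> from which \<open>s\<close>
        descends, so it is the higher end and is determined by \<open>s\<close>.\<close>
      have f: "\<exists>p q r x. top v p q r \<and> q \<in> s \<and> q \<notin> rel_interior s \<and> (s = sg p q \<or> s = sg q r) \<and>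
          x \<in> s \<and> h x < h q \<and>
          (q \<in> boundary_corners \<longrightarrow> (\<exists>a. side R a q \<and> (if h q < h a then s = sg p q else s = sg q r)))"
        if v: "v \<in> W" "M v s" for v
      proof -
        obtain p q r where t: "top v p q r" and c: "(q \<notin> boundary_corners \<and> q \<notin> rel_interior s \<and> (s = sg p q \<or> s = sg q r)) \<or>
          (q \<in> boundary_corners \<and> (\<exists>a. side R a q \<and> h q < h a) \<and> s = sg p q) \<or>
          (q \<in> boundary_corners \<and> (\<exists>a. side R a q \<and> h a < h q) \<and> s = sg q r)"
          using v(2) \<open>s \<noteq> b0\<close> unfolding M_def by blast
        have sq: "side v p q" "side v q r" "h p < h q" "h r < h q" using t by (auto simp: top_def)
        have "q \<notin> rel_interior s"
          using c boundary_corner_interior_segment[OF _ s] by blast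
        moreover have "s = sg p q \<or> s = sg q r" using c by blast
        moreover from this obtain x where "x \<in> s" "h x < h q" "q \<in> s"
          using sg_points[OF v(1) sq(1)] sg_points[OF v(1) sq(2)] sq by blast
        moreover have "q \<in> boundary_corners \<Longrightarrow> \<exists>a. side R a q \<and> (if h q < h a then s = sg p q else s = sg q r)"
          using c by fastforce
        ultimately show ?thesis using t by blast
      qed
      obtain p q r x where t: "top w p q r" "q \<in> s" "q \<notin> rel_interior s" "s = sg p q \<or> s = sg q r"
        "x \<in> s" "h x < h q"
        "q \<in> boundary_corners \<longrightarrow> (\<exists>a. side R a q \<and> (if h q < h a then s = sg p q else s = sg q r))"
        using f[OF w m[OF w, folded s_def]] by blast
      obtain p' q' r' x' where t': "top w' p' q' r'" "q' \<in> s" "q' \<notin> rel_interior s" "s = sg p' q' \<or> s = sg q' r'"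
        "x' \<in> s" "h x' < h q'"
        "q' \<in> boundary_corners \<longrightarrow> (\<exists>a. side R a q' \<and> (if h q' < h a then s = sg p' q' else s = sg q' r'))"
        using f[OF w' m[OF w', folded eq, folded s_def]] by blast
      have "q' = q"
      proof (rule ccontr)
        assume ne: "q' \<noteq> q"
        have "x \<noteq> q" "x' \<noteq> q'" using t(6) t'(6) by auto
        obtain k where k: "0 < k" "x - q = k *\<^sub>R (q' - q)"
          using segment_ray[OF s(1) t(2,3) t'(2) t(5) ne \<open>x \<noteq> q\<close>] .
        obtain k' where k': "0 < k'" "x' - q' = k' *\<^sub>R (q - q')"
          using segment_ray[OF s(1) t'(2,3) t(2) t'(5) ne[symmetric] \<open>x' \<noteq> q'\<close>] .
        have "h x - h q = k * (h q' - h q)" "h x' - h q' = k' * (h q - h q')"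
          unfolding h_diff[symmetric] k(2) k'(2) by (simp_all only: cross_simps(7) real_scaleR_def)
        then have "k * (h q' - h q) < 0" "k' * (h q - h q') < 0" using t(6) t'(6) by simp_all
        then show False using k(1) k'(1) by (simp add: mult_less_0_iff)
      qed
      have sd: "side w p q" "side w q r" "side w' p' q" "side w' q r'" "h p < h q" "h r < h q" "h p' < h q" "h r' < h q"
        using t(1) t'(1) \<open>q' = q\<close> by (auto simp: top_def)
      have ne: "p \<noteq> q" "r \<noteq> q" "p' \<noteq> q" "r' \<noteq> q" using sd by auto
      have start: "w' = w" if "s = sg q r" "s = sg q r'"
      proof -
        have rs: "r \<in> s" "r' \<in> s"
          using sg_points[OF w sd(2)] sg_points[OF w' sd(4)] that by auto
        obtain k where "0 < k" "r' - q = k *\<^sub>R (r - q)"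
          using segment_ray[OF s(1) t(2,3) rs ne(2,4)] .
        then show ?thesis using side_start_unique_tile[OF w w' sd(2,4)] by blast
      qed
      have end_unique: "u' = u \<and> b' = b" if u: "u \<in> W" "u' \<in> W" "side u b q" "side u' b' q" "s = sg b q" "s = sg b' q" for u u' b b'
      proof -
        have bs: "b \<in> s" "b' \<in> s"
          using sg_points[OF u(1,3)] sg_points[OF u(2,4)] u(5,6) by auto
        have bn: "b \<noteq> q" "b' \<noteq> q" using side_neq[OF tile_polygon[OF u(1)] u(3)] side_neq[OF tile_polygon[OF u(2)] u(4)] .
        obtain k where k: "0 < k" "b' - q = k *\<^sub>R (b - q)"
          using segment_ray[OF s(1) t(2,3) bs bn] .
        have "q - b' = k *\<^sub>R (q - b)" using k(2) by (metis minus_diff_eq scaleR_minus_right)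
        then show ?thesis using side_end_unique_tile[OF u(1-4) _ k(1)] by blast
      qed
      \<comment> \<open>Two tiles face each other across the end of \<open>s\<close>. The other
        segment passes straight through \<open>q\<close>, so their sides on it continue each other
        and cannot both descend from \<open>q\<close>.\<close>
      have mixed: False if x: "u \<in> W" "u' \<in> W" "top u b q c" "top u' b' q c'" "s = sg b q" "s = sg q c'"
        "q \<notin> boundary_corners" for u u' b b' c c'
      proof -
        have sx: "side u b q" "side u q c" "side u' b' q" "side u' q c'" "h c < h q" "h b' < h q"
          using x by (auto simp: top_def)
        obtain w'' p'' r'' m where p: "w'' \<in> W" "side w'' p'' q" "side w'' q r''" "sg p'' q = sg q c'" "0 < m"
          "r'' - q = (if q \<in> rel_interior (sg q c') then - m else m) *\<^sub>R (q - b')"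
          using partner[OF x(2) sx(3,4) x(7)] by metis
        have "w'' = u" using end_unique[OF x(1) p(1) sx(1) p(2) x(5)] p(4) x(6) by simp
        then have "r'' = c" using side_start_unique[OF tile_polygon[OF x(1)] sx(2), of r''] p(3) by simp
        have "r'' - q = m *\<^sub>R (q - b')" using p(6) t(3) x(6) by simp
        then have "h r'' - h q = m * (h q - h b')"
          unfolding h_diff[symmetric] by (simp only: cross_simps(7) real_scaleR_def)
        then have "0 < h r'' - h q" using p(5) sx(6) by simp
        then show False using sx(5) \<open>r'' = c\<close> by simp
      qed
      show ?thesis
      proof (cases "q \<in> boundary_corners")
        case True
        obtain a where a: "side R a q" "if h q < h a then s = sg p q else s = sg q r" using t(7) True by blast
        obtain a' where a': "side R a' q" "if h q < h a' then s = sg p' q else s = sg q r'"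
          using t'(7) True \<open>q' = q\<close> by blast
        have "a' = a" using side_end_unique[OF R_polygon a(1), of a'] a'(1) by simp
        then have "(s = sg p q \<and> s = sg p' q) \<or> (s = sg q r \<and> s = sg q r')"
          using a(2) a'(2) by (cases "h q < h a") auto
        then show ?thesis using start end_unique[OF w w' sd(1,3)] by blast
      next
        case False
        have tops: "top w p q r" "top w' p' q r'" using t(1) t'(1) \<open>q' = q\<close> by auto
        consider "s = sg p q" "s = sg p' q" | "s = sg q r" "s = sg q r'"
          | "s = sg p q" "s = sg q r'" | "s = sg q r" "s = sg p' q"
          using t(4) t'(4) \<open>q' = q\<close> by auto
        then show ?thesis
        proof cases
          case 1
          then show ?thesis using end_unique[OF w w' sd(1,3)] by blast
        next
          case 2
          then show ?thesis using start by blast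
        next
          case 3
          then show ?thesis using mixed[OF w w' tops _ _ False] by blast
        next
          case 4
          then show ?thesis using mixed[OF w' w tops(2,1) _ _ False] by blast
        qed
      qed
    qed
  qed
  moreover have "finite (?I \<union> {b0})" using finite_segments by (simp add: interior_segments_def)
  ultimately show ?thesis by (intro card_inj_on_le[of m]) auto
qed

end

section \<open>Areas as quadratic forms in the intercepts\<close>

lemma zero_sum_both_signs:
  fixes c u :: "'a \<Rightarrow> real"
  assumes "finite A" "a \<in> A" "\<And>z. z \<in> A \<Longrightarrow> 0 < c z" "(\<Sum>z\<in>A. c z * u z) = 0" "u a \<noteq> 0"
  shows "(\<exists>z\<in>A. 0 < u z) \<and> (\<exists>z\<in>A. u z < 0)"
proof -
  have one: "\<exists>z\<in>A. 0 < v z" if v: "(\<Sum>z\<in>A. c z * v z) = 0" "v a \<noteq> 0" for v :: "'a \<Rightarrow> real"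
  proof (rule ccontr)
    assume "\<not> ?thesis"
    then have le: "v z \<le> 0" if "z \<in> A" for z using that by (meson not_le)
    have "0 < (\<Sum>z\<in>A. - (c z * v z))"
    proof (rule sum_pos2[OF assms(1,2)])
      show "0 < - (c a * v a)" using assms(3)[OF assms(2)] le[OF assms(2)] v(2) by (simp add: mult_pos_neg)
      show "0 \<le> - (c z * v z)" if "z \<in> A" for z
        using mult_nonneg_nonpos[of "c z" "v z"] assms(3)[OF that] le[OF that] by simp
    qed
    then show False using v(1) by (simp add: sum_negf)
  qed
  from one[of u] one[of "\<lambda>z. - u z"] show ?thesis using assms(4,5) by (simp add: sum_negf)
qed

text \<open>The clockwise quarter turn: it takes a counterclockwise edge vector to the outward
  normal, scaled by the edge length.\<close>

definition rot :: "plane \<Rightarrow> plane" where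
  "rot d = vector [d $ 2, - d $ 1]"

lemma rot_simps: "rot (x + y) = rot x + rot y" "rot (x - y) = rot x - rot y" "rot (c *\<^sub>R x) = c *\<^sub>R rot x"
  by (simp_all add: rot_def vec_eq_iff forall_2)

lemma inner_rot: "x \<bullet> rot d = cross x d"
  by (simp add: rot_def cross_def inner_vec_def sum_2)

lemma cross_rot: "cross (rot x) (rot y) = cross x y"
  by (simp add: rot_def cross_def)

lemma rot_normal:
  assumes "norm n = 1" "n \<bullet> d = 0"
  shows "rot d = (n \<bullet> rot d) *\<^sub>R n"
proof -
  have n: "n $ 1 * n $ 1 + n $ 2 * n $ 2 = 1"
    using assms(1) by (simp add: norm_eq_1 inner_vec_def sum_2)
  have d: "n $ 1 * d $ 1 + n $ 2 * d $ 2 = 0" using assms(2) by (simp add: inner_vec_def sum_2)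
  define m where "m = n $ 1 * d $ 2 - n $ 2 * d $ 1"
  have "d $ 2 = m * n $ 1" "- d $ 1 = m * n $ 2" unfolding m_def using n d by algebra+
  moreover have "n \<bullet> rot d = m" by (simp add: m_def rot_def inner_vec_def sum_2)
  ultimately show ?thesis by (simp add: rot_def vec_eq_iff forall_2)
qed

lemma cross_zero_of_normal:
  assumes "norm n = 1" "n \<bullet> x = 0" "n \<bullet> y = 0"
  shows "cross x y = 0"
proof -
  have "cross x y = x \<bullet> rot y" by (simp add: inner_rot)
  also have "\<dots> = (n \<bullet> rot y) * (n \<bullet> x)"
    by (subst rot_normal[OF assms(1,3)]) (simp add: inner_commute)
  finally show ?thesis using assms(2) by simp
qed

text \<open>Cramer's formula for the common point of the lines with normals \<open>a\<close>,
  \<open>b\<close> and intercepts \<open>x\<close>, \<open>y\<close>; it is linear in the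
  intercepts.\<close>

definition meet :: "plane \<Rightarrow> plane \<Rightarrow> real \<Rightarrow> real \<Rightarrow> plane" where
  "meet a b x y = inverse (cross a b) *\<^sub>R (x *\<^sub>R rot b - y *\<^sub>R rot a)"

lemma inner_meet:
  assumes "cross a b \<noteq> 0"
  shows "a \<bullet> meet a b x y = x" "b \<bullet> meet a b x y = y"
  using assms cross_commute[of b a]
  by (simp_all add: meet_def inner_diff_right inner_rot)

lemma meet_unique:
  assumes "cross a b \<noteq> 0"
  shows "meet a b (a \<bullet> z) (b \<bullet> z) = z"
proof -
  have "(a \<bullet> z) *\<^sub>R rot b - (b \<bullet> z) *\<^sub>R rot a = cross a b *\<^sub>R z"
    by (simp add: vec_eq_iff forall_2 rot_def cross_def inner_vec_def sum_2 algebra_simps)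
  then show ?thesis using assms by (simp add: meet_def)
qed

lemma meet_add: "meet a b (x + x') (y + y') = meet a b x y + meet a b x' y'"
  by (simp add: meet_def algebra_simps)

lemma meet_scale: "meet a b (c * x) (c * y) = c *\<^sub>R meet a b x y"
  by (simp add: meet_def algebra_simps)

locale normal_tiling = quad_tiling +
  fixes \<nu> :: "plane set \<Rightarrow> plane"
  assumes normals: "unit_normals W \<nu>"
begin

lemma normal: "s \<in> segments W \<Longrightarrow> norm (\<nu> s) = 1"
  "s \<in> segments W \<Longrightarrow> x \<in> s \<Longrightarrow> y \<in> s \<Longrightarrow> \<nu> s \<bullet> (x - y) = 0"
  using normals by (auto simp: unit_normals_def)

text \<open>The edge length with a sign that compares the chosen normal with the outward one: times
  a change of the intercept it gives edge length times outward displacement.\<close>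

definition \<kappa> :: "plane \<Rightarrow> plane \<Rightarrow> real" where
  "\<kappa> p q = \<nu> (sg p q) \<bullet> rot (q - p)"

lemma rot_side:
  assumes "w \<in> W" "side w p q"
  shows "rot (q - p) = \<kappa> p q *\<^sub>R \<nu> (sg p q)"
  unfolding \<kappa>_def using sg(1)[OF assms] sg_points[OF assms] normal by (intro rot_normal) auto

lemma \<kappa>_nonzero:
  assumes "w \<in> W" "side w p q"
  shows "\<kappa> p q \<noteq> 0"
proof
  assume "\<kappa> p q = 0"
  then have "rot (q - p) = 0" using rot_side[OF assms] by simp
  then have "q - p = 0" by (simp add: rot_def vec_eq_iff forall_2)
  then show False using side_neq[OF tile_polygon[OF assms(1)] assms(2)] by simp
qed

lemma cross_side:
  assumes "w \<in> W" "side w p q"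
  shows "cross x (q - p) = \<kappa> p q * (\<nu> (sg p q) \<bullet> x)"
  using rot_side[OF assms] inner_rot[of x "q - p"] by (simp add: inner_commute)

lemma cross_normals:
  assumes "w \<in> W" "side w p q" "side w q r"
  shows "cross (\<nu> (sg p q)) (\<nu> (sg q r)) \<noteq> 0"
proof
  assume "cross (\<nu> (sg p q)) (\<nu> (sg q r)) = 0"
  then have "cross (rot (q - p)) (rot (r - q)) = 0"
    unfolding rot_side[OF assms(1,2)] rot_side[OF assms(1,3)] by (simp add: cross_simps(7,8))
  then show False using corner_cross[OF tile_polygon[OF assms(1)] assms(2,3)] by (simp add: cross_rot)
qed

text \<open>The vertex of the tile corresponding to \<open>w\<close> at its corner \<open>q\<close>, as a linear function of the
  intercepts \<open>X\<close> of all segments.\<close>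

definition vt :: "plane set \<Rightarrow> plane \<Rightarrow> (plane set \<Rightarrow> real) \<Rightarrow> plane" where
  "vt w q X = (let s = sg (SOME p. side w p q) q; t = sg q (SOME r. side w q r)
     in meet (\<nu> s) (\<nu> t) (X s) (X t))"

lemma vt_eq:
  assumes "w \<in> W" "side w p q" "side w q r"
  shows "vt w q X = meet (\<nu> (sg p q)) (\<nu> (sg q r)) (X (sg p q)) (X (sg q r))"
proof -
  have "(SOME p. side w p q) = p"
    using someI[of "\<lambda>p. side w p q", OF assms(2)] side_end_unique[OF tile_polygon[OF assms(1)] assms(2)]
    by metis
  moreover have "(SOME r. side w q r) = r"
    using someI[of "\<lambda>r. side w q r", OF assms(3)] side_start_unique[OF tile_polygon[OF assms(1)] assms(3)]
    by metis
  ultimately show ?thesis by (simp add: vt_def Let_def)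
qed

lemma vt_add: "vt w q (\<lambda>s. X s + Y s) = vt w q X + vt w q Y"
  by (simp add: vt_def Let_def meet_add)

lemma vt_scale: "vt w q (\<lambda>s. c * X s) = c *\<^sub>R vt w q X"
  by (simp add: vt_def Let_def meet_scale)

lemma inner_vt:
  assumes w: "w \<in> W" "side w p q"
  shows "\<nu> (sg p q) \<bullet> vt w p X = X (sg p q)" "\<nu> (sg p q) \<bullet> vt w q X = X (sg p q)"
proof -
  obtain a where a: "side w a p" using side_prev[OF tile_polygon[OF w(1)] w(2)] .
  obtain r where r: "side w q r" using side_next[OF tile_polygon[OF w(1)] w(2)] .
  show "\<nu> (sg p q) \<bullet> vt w p X = X (sg p q)"
    unfolding vt_eq[OF w(1) a w(2)] by (rule inner_meet(2)[OF cross_normals[OF w(1) a w(2)]])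
  show "\<nu> (sg p q) \<bullet> vt w q X = X (sg p q)"
    unfolding vt_eq[OF w r] by (rule inner_meet(1)[OF cross_normals[OF w r]])
qed

text \<open>The factor by which the edge vector is multiplied in the deformed tile;
  \<open>vt_diff\<close> shows that the two vectors are parallel.\<close>

definition ratio :: "plane set \<Rightarrow> plane \<Rightarrow> plane \<Rightarrow> (plane set \<Rightarrow> real) \<Rightarrow> real" where
  "ratio w p q X = ((vt w q X - vt w p X) \<bullet> (q - p)) / ((q - p) \<bullet> (q - p))"

lemma ratio_add: "ratio w p q (\<lambda>s. X s + Y s) = ratio w p q X + ratio w p q Y"
  unfolding ratio_def vt_add by (simp add: inner_diff_left inner_add_left add_divide_distrib diff_divide_distrib)

lemma ratio_scale: "ratio w p q (\<lambda>s. c * X s) = c * ratio w p q X"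
  unfolding ratio_def vt_scale by (simp add: inner_diff_left diff_divide_distrib right_diff_distrib)

lemma vt_diff:
  assumes w: "w \<in> W" "side w p q"
  shows "vt w q X - vt w p X = ratio w p q X *\<^sub>R (q - p)"
proof -
  have s: "sg p q \<in> segments W" using sg(1)[OF w] .
  have "\<nu> (sg p q) \<bullet> (q - p) = 0" using normal(2)[OF s] sg_points[OF w] by blast
  moreover have "\<nu> (sg p q) \<bullet> (vt w q X - vt w p X) = 0"
    using inner_vt[OF w] by (simp add: inner_diff_right)
  ultimately have "cross (q - p) (vt w q X - vt w p X) = 0"
    using cross_zero_of_normal[OF normal(1)[OF s]] by blast
  moreover have "q - p \<noteq> 0" using side_neq[OF tile_polygon[OF w(1)] w(2)] by simp
  ultimately show ?thesis unfolding ratio_def by (intro cross_eq_0_parallel)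
qed

text \<open>The polarised area form, or mixed area. The product of \<open>\<kappa> p q\<close> and
  the ratio is the signed length of the deformed edge, so \<open>2 * Q w X Y\<close> is the first
  variation of the area when the intercepts \<open>X\<close> move by \<open>Y\<close>.\<close>

definition Q :: "plane set \<Rightarrow> (plane set \<Rightarrow> real) \<Rightarrow> (plane set \<Rightarrow> real) \<Rightarrow> real" where
  "Q w X Y = (\<Sum>(p, q)\<in>{(p, q). side w p q}. \<kappa> p q * ratio w p q X * Y (sg p q)) / 2"

text \<open>\<open>Y (sg p q)\<close> is the inner product of the normal with the vertex at either
  end of the side, which yields one expression for each end.\<close>

lemma Q_term:
  assumes w: "w \<in> W" "side w p q"
  shows "\<kappa> p q * ratio w p q X * Y (sg p q) = cross (vt w p Y) (vt w q X) - cross (vt w p Y) (vt w p X)"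
    and "\<kappa> p q * ratio w p q X * Y (sg p q) = cross (vt w q Y) (vt w q X) - cross (vt w q Y) (vt w p X)"
proof -
  have eq: "cross z (vt w q X - vt w p X) = \<kappa> p q * ratio w p q X * (\<nu> (sg p q) \<bullet> z)" for z
    unfolding vt_diff[OF w] cross_simps(8) cross_side[OF w] by simp
  show "\<kappa> p q * ratio w p q X * Y (sg p q) = cross (vt w p Y) (vt w q X) - cross (vt w p Y) (vt w p X)"
    using eq[of "vt w p Y"] unfolding inner_vt[OF w] cross_simps(4) by simp
  show "\<kappa> p q * ratio w p q X * Y (sg p q) = cross (vt w q Y) (vt w q X) - cross (vt w q Y) (vt w p X)"
    using eq[of "vt w q Y"] unfolding inner_vt[OF w] cross_simps(4) by simp
qed

text \<open>Summation by parts around the tile: after the diagonal terms are shifted by one vertex,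
  the expansion at the starts of the sides becomes the one at their ends with \<open>X\<close> and
  \<open>Y\<close> exchanged.\<close>

lemma Q_sym:
  assumes w: "w \<in> W"
  shows "Q w X Y = Q w Y X"
proof -
  let ?E = "{(p, q). side w p q}"
  have "2 * Q w X Y = (\<Sum>(p, q)\<in>?E. cross (vt w p Y) (vt w q X) - cross (vt w p Y) (vt w p X))"
    unfolding Q_def by (simp, intro sum.cong refl) (simp add: case_prod_unfold Q_term(1)[OF w])
  also have "\<dots> = (\<Sum>(p, q)\<in>?E. cross (vt w p Y) (vt w q X) + cross (vt w p X) (vt w p Y))"
  proof (intro sum.cong refl)
    fix z show "(case z of (p, q) \<Rightarrow> cross (vt w p Y) (vt w q X) - cross (vt w p Y) (vt w p X))
        = (case z of (p, q) \<Rightarrow> cross (vt w p Y) (vt w q X) + cross (vt w p X) (vt w p Y))"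
      using cross_commute[of "vt w (fst z) Y" "vt w (fst z) X"] by (simp add: case_prod_unfold)
  qed
  also have "\<dots> = (\<Sum>(p, q)\<in>?E. cross (vt w p Y) (vt w q X)) + (\<Sum>(p, q)\<in>?E. cross (vt w p X) (vt w p Y))"
    by (simp add: case_prod_unfold sum.distrib)
  also have "(\<Sum>(p, q)\<in>?E. cross (vt w p X) (vt w p Y)) = (\<Sum>(p, q)\<in>?E. cross (vt w q X) (vt w q Y))"
    by (rule sum_sides_shift[OF tile_polygon[OF w], symmetric])
  also have "(\<Sum>(p, q)\<in>?E. cross (vt w p Y) (vt w q X)) + \<dots>
      = (\<Sum>(p, q)\<in>?E. cross (vt w q X) (vt w q Y) - cross (vt w q X) (vt w p Y))"
  proof -
    have "cross (vt w (fst z) Y) (vt w (snd z) X) = - cross (vt w (snd z) X) (vt w (fst z) Y)" for z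
      by (rule cross_commute)
    then show ?thesis by (simp add: case_prod_unfold sum_subtractf sum_negf)
  qed
  also have "\<dots> = 2 * Q w Y X"
    unfolding Q_def by (simp, intro sum.cong refl) (simp add: case_prod_unfold Q_term(2)[OF w])
  finally show ?thesis by simp
qed

lemma Q_add: "Q w (\<lambda>s. X s + X' s) Y = Q w X Y + Q w X' Y" "Q w X (\<lambda>s. Y s + Y' s) = Q w X Y + Q w X Y'"
  by (simp_all add: Q_def ratio_add case_prod_unfold sum.distrib[symmetric] add_divide_distrib[symmetric] algebra_simps)

lemma Q_scale: "Q w (\<lambda>s. c * X s) Y = c * Q w X Y" "Q w X (\<lambda>s. c * Y s) = c * Q w X Y"
  by (simp_all add: Q_def ratio_scale case_prod_unfold sum_distrib_left algebra_simps)

lemma Q_self: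
  assumes w: "w \<in> W"
  shows "Q w X X = (\<Sum>(p, q)\<in>{(p, q). side w p q}. cross (vt w p X) (vt w q X)) / 2"
  unfolding Q_def
  by (intro arg_cong2[where f = "(/)"] sum.cong refl) (simp add: case_prod_unfold Q_term(1)[OF w])

text \<open>After multiplication by \<open>\<epsilon> w\<close>, the vanishing sum
  \<open>Q w X Y\<close> gives the values of \<open>U\<close> positive weights. So \<open>U\<close>
  takes both signs on every tile where it is not zero, which is the balance required by
  \<open>balanced_zero\<close>.\<close>

lemma derivative_injective:
  assumes b0: "b0 \<in> boundary_segments R W"
    and Y: "\<And>s. s \<in> boundary_segments R W \<Longrightarrow> s \<noteq> b0 \<Longrightarrow> Y s = 0"
    and sgn: "\<And>w p q. w \<in> W \<Longrightarrow> side w p q \<Longrightarrow> 0 < \<epsilon> w * ratio w p q X"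
    and zero: "\<And>w. w \<in> W \<Longrightarrow> Q w X Y = 0"
    and s: "s \<in> segments W"
  shows "Y s = 0"
proof -
  define U where "U p q = \<kappa> p q * Y (sg p q)" for p q
  obtain v0 v1 where v: "side R v0 v1" "b0 = closed_segment v0 v1"
    using b0 unfolding boundary_segments_iff by blast
  have hom: "U p' q' = k * U p q"
    if "sg p q = sg p' q'" "q' - p' = k *\<^sub>R (q - p)" for p q p' q' k
    using that by (simp add: U_def \<kappa>_def rot_simps(3))
  have bd: "U p q = 0"
    if "w \<in> W" "side w p q" "sg p q \<in> boundary_segments R W" "sg p q \<noteq> closed_segment v0 v1" for w p q
    using Y that v(2) by (simp add: U_def)
  have bal: "(\<exists>a b. side w a b \<and> 0 < U a b) \<and> (\<exists>a b. side w a b \<and> U a b < 0)"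
    if w: "w \<in> W" "side w p q" "U p q \<noteq> 0" for w p q
  proof -
    let ?E = "{(p, q). side w p q}"
    have fin: "finite ?E" by (rule finite_sides[OF tile_polygon[OF w(1)]])
    have "0 = \<epsilon> w * (2 * Q w X Y)" using zero[OF w(1)] by simp
    also have "\<dots> = (\<Sum>(p, q)\<in>?E. (\<epsilon> w * ratio w p q X) * U p q)"
      unfolding Q_def U_def
      by (simp add: sum_distrib_left case_prod_unfold mult.commute mult.left_commute)
    finally have sum: "(\<Sum>z\<in>?E. (\<epsilon> w * ratio w (fst z) (snd z) X) * U (fst z) (snd z)) = 0"
      by (simp add: case_prod_unfold)
    have pq: "(p, q) \<in> ?E" using w(2) by simp
    have r: "0 < \<epsilon> w * ratio w (fst z) (snd z) X" if "z \<in> ?E" for z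
      using sgn[OF w(1), of "fst z" "snd z"] that by (cases z) simp
    have "(\<exists>z\<in>?E. 0 < U (fst z) (snd z)) \<and> (\<exists>z\<in>?E. U (fst z) (snd z) < 0)"
      by (rule zero_sum_both_signs[OF fin pq r sum]) (use w(3) in simp_all)
    then show ?thesis by force
  qed
  obtain w p q where w: "w \<in> W" "side w p q" "sg p q = s" using segment_incident[OF s] .
  have "U p q = 0"
    by (rule balanced_zero[OF v(1) hom bd bal w(1,2)])
  then show ?thesis using \<kappa>_nonzero[OF w(1,2)] w(3) by (simp add: U_def)
qed

end

section \<open>Equivalent tilings\<close>

context normal_tiling
begin

lemma normal_affine_hull:
  assumes s: "s \<in> segments W" and x: "x \<in> affine hull s" "y \<in> affine hull s"
  shows "\<nu> s \<bullet> x = \<nu> s \<bullet> y"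
proof -
  obtain a b where "s = closed_segment a b" using segmentsE[OF s] .
  then have a: "a \<in> s" by simp
  have "s \<subseteq> {z. \<nu> s \<bullet> z = \<nu> s \<bullet> a}"
    using normal(2)[OF s _ a] by (auto simp: inner_diff_right)
  then have "affine hull s \<subseteq> {z. \<nu> s \<bullet> z = \<nu> s \<bullet> a}"
    by (intro hull_minimal affine_hyperplane)
  from subsetD[OF this x(1)] subsetD[OF this x(2)] show ?thesis by simp
qed

context
  fixes R' W' b0 f g
  assumes E: "equivalent_tiling R W b0 R' W' f g"
begin

interpretation T: polygon_tiling R' W'
  using E by (unfold_locales) (simp add: equivalent_tiling_def)

lemma equivalent_bij: "bij_betw f W W'" "bij_betw g (segments W) (segments W')"
  and equivalent_incident: "w \<in> W \<Longrightarrow> s \<in> segments W \<Longrightarrow> incident w s \<longleftrightarrow> incident (f w) (g s)"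
  and equivalent_parallel: "s \<in> segments W \<Longrightarrow> affine_parallel (affine hull s) (affine hull (g s))"
  and equivalent_fixed: "s \<in> boundary_segments R W \<Longrightarrow> s \<noteq> b0 \<Longrightarrow> affine hull (g s) = affine hull s"
  using E by (auto simp: equivalent_tiling_def graph_iso_def)

lemma equivalent_in: "w \<in> W \<Longrightarrow> f w \<in> W'" "s \<in> segments W \<Longrightarrow> g s \<in> segments W'"
  using equivalent_bij by (auto dest: bij_betwE)

lemma equivalent_tile_polygon: "w \<in> W \<Longrightarrow> convex_polygon (f w)"
  using T.tile_polygon equivalent_in by blast

lemma equivalent_side:
  assumes w: "w \<in> W" "side w p q"
  shows "\<exists>p' q'. side (f w) p' q' \<and> T.sg p' q' = g (sg p q)"
proof -
  have s: "sg p q \<in> segments W" using sg(1)[OF w] .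
  have "incident w (sg p q)" using incident_iff[OF w(1) s] w(2) by blast
  then have "incident (f w) (g (sg p q))" using equivalent_incident[OF w(1) s] by simp
  then show ?thesis using T.incident_iff[OF equivalent_in(1)[OF w(1)] equivalent_in(2)[OF s]] by simp
qed

lemma equivalent_side_converse:
  assumes w: "w \<in> W" and s': "side (f w) p' q'"
  shows "\<exists>p q. side w p q \<and> T.sg p' q' = g (sg p q)"
proof -
  have fw: "f w \<in> W'" using equivalent_in(1)[OF w] .
  have "T.sg p' q' \<in> segments W'" using T.sg(1)[OF fw s'] .
  then obtain s where s: "s \<in> segments W" "T.sg p' q' = g s"
    using bij_betw_imp_surj_on[OF equivalent_bij(2)] by (metis imageE)
  have "incident (f w) (g s)" using T.incident_iff[OF fw equivalent_in(2)[OF s(1)]] s' s(2) by blast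
  then have "incident w s" using equivalent_incident[OF w s(1)] by simp
  then show ?thesis using incident_iff[OF w s(1)] s(2) by auto
qed

lemma normal_equivalent:
  assumes s: "s \<in> segments W" and x: "x \<in> g s" "y \<in> g s"
  shows "\<nu> s \<bullet> x = \<nu> s \<bullet> y"
proof -
  obtain a where a: "affine hull (g s) = (\<lambda>x. a + x) ` (affine hull s)"
    using equivalent_parallel[OF s] by (auto simp: affine_parallel_def)
  have "x \<in> affine hull (g s)" "y \<in> affine hull (g s)" using x hull_subset by (metis subsetD)+
  then obtain x0 y0 where xy: "x = a + x0" "y = a + y0" "x0 \<in> affine hull s" "y0 \<in> affine hull s"
    unfolding a by blast
  then show ?thesis using normal_affine_hull[OF s xy(3,4)] by (simp add: inner_add_right)
qed

end

section \<open>Tiles of an equivalent tiling in terms of the intercepts\<close>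

lemma intercept_eq:
  assumes "z \<in> s" "\<And>y. y \<in> s \<Longrightarrow> n \<bullet> y = n \<bullet> z"
  shows "intercept n s = n \<bullet> z"
  unfolding intercept_def
proof (rule the_equality)
  show "\<forall>x\<in>s. n \<bullet> x = n \<bullet> z" using assms(2) by blast
  show "c = n \<bullet> z" if "\<forall>x\<in>s. n \<bullet> x = c" for c using that assms(1) by metis
qed

text \<open>Extends a vector of free intercepts to all segments: the sides of \<open>R\<close> other
  than \<open>b0\<close> keep the intercepts of the original tiling.\<close>

definition icpt :: "('b::finite \<Rightarrow> plane set) \<Rightarrow> real^'b \<Rightarrow> plane set \<Rightarrow> real" where
  "icpt \<beta> x s = (if s \<in> range \<beta> then x $ (inv \<beta> s) else intercept (\<nu> s) s)"

lemma icpt_equivalent: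
  assumes E: "equivalent_tiling R W b0 R' W' f g" and x: "has_intercepts \<nu> \<beta> g x"
    and \<beta>: "bij_betw \<beta> UNIV (interior_segments R W \<union> {b0})"
    and s: "s \<in> segments W" and z: "z \<in> g s"
  shows "\<nu> s \<bullet> z = icpt \<beta> x s"
proof (cases "s \<in> range \<beta>")
  case True
  then have "\<beta> (inv \<beta> s) = s" by (simp add: f_inv_into_f)
  then have "x $ (inv \<beta> s) = intercept (\<nu> s) (g s)" using x by (metis has_intercepts_def)
  also have "\<dots> = \<nu> s \<bullet> z"
    using normal_equivalent[OF E s _ z] by (intro intercept_eq[OF z])
  finally show ?thesis using True by (simp add: icpt_def)
next
  case False
  then have "s \<in> boundary_segments R W" "s \<noteq> b0"
    using s bij_betw_imp_surj_on[OF \<beta>] by (auto simp: interior_segments_def)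
  then have hull: "affine hull (g s) = affine hull s" using equivalent_fixed[OF E] by blast
  obtain a b where "s = closed_segment a b" using segmentsE[OF s] .
  then have a: "a \<in> s" by simp
  have "z \<in> affine hull s" using z hull_subset[of "g s" affine] hull by blast
  moreover have "a \<in> affine hull s" using a hull_subset by (metis subsetD)
  ultimately have "\<nu> s \<bullet> z = \<nu> s \<bullet> a" by (rule normal_affine_hull[OF s])
  moreover have "intercept (\<nu> s) s = \<nu> s \<bullet> a"
    using normal(2)[OF s _ a] by (intro intercept_eq[OF a]) (simp add: inner_diff_right)
  ultimately show ?thesis using False by (simp add: icpt_def)
qed

text \<open>In both tilings the sides of the tile lie on the lines with normal
  \<open>\<nu> s\<close> and intercept \<open>X s\<close>, one for each segment \<open>s\<close>
  incident to \<open>w\<close>, so \<open>polygon_lines_unique\<close> applies.\<close>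

lemma tile_unique:
  assumes E1: "equivalent_tiling R W b0 R1 W1 f1 g1" and E2: "equivalent_tiling R W b0 R2 W2 f2 g2"
    and X1: "\<And>s z. s \<in> segments W \<Longrightarrow> z \<in> g1 s \<Longrightarrow> \<nu> s \<bullet> z = X s"
    and X2: "\<And>s z. s \<in> segments W \<Longrightarrow> z \<in> g2 s \<Longrightarrow> \<nu> s \<bullet> z = X s"
    and w: "w \<in> W"
  shows "f1 w = f2 w"
proof -
  have half: "\<exists>p' q'. side (f' w) p' q' \<and> same_line p q p' q'"
    if E: "equivalent_tiling R W b0 R1 W1 f g" and E': "equivalent_tiling R W b0 R2 W2 f' g'"
      and X: "\<And>s z. s \<in> segments W \<Longrightarrow> z \<in> g s \<Longrightarrow> \<nu> s \<bullet> z = X s"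
      and X': "\<And>s z. s \<in> segments W \<Longrightarrow> z \<in> g' s \<Longrightarrow> \<nu> s \<bullet> z = X s"
      and pq: "side (f w) p q"
    for R1 W1 f g R2 W2 f' g' p q
  proof -
    interpret T: polygon_tiling R1 W1 using E by unfold_locales (simp add: equivalent_tiling_def)
    interpret T': polygon_tiling R2 W2 using E' by unfold_locales (simp add: equivalent_tiling_def)
    obtain a b where ab: "side w a b" "T.sg p q = g (sg a b)"
      using equivalent_side_converse[OF E w pq] by blast
    obtain p' q' where pq': "side (f' w) p' q'" "T'.sg p' q' = g' (sg a b)"
      using equivalent_side[OF E' w ab(1)] by blast
    have s: "sg a b \<in> segments W" using sg(1)[OF w ab(1)] .
    have "p \<in> g (sg a b)" "q \<in> g (sg a b)"
      using T.sg_points[OF equivalent_in(1)[OF E w] pq] ab(2) by auto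
    moreover have "p' \<in> g' (sg a b)" "q' \<in> g' (sg a b)"
      using T'.sg_points[OF equivalent_in(1)[OF E' w] pq'(1)] pq'(2) by auto
    ultimately have n: "\<nu> (sg a b) \<bullet> p = X (sg a b)" "\<nu> (sg a b) \<bullet> q = X (sg a b)"
      "\<nu> (sg a b) \<bullet> p' = X (sg a b)" "\<nu> (sg a b) \<bullet> q' = X (sg a b)"
      using X[OF s] X'[OF s] by auto
    have "same_line p q p' q'"
      unfolding same_line_def
      by (intro conjI cross_zero_of_normal[OF normal(1)[OF s]]) (simp_all add: inner_diff_right n)
    then show ?thesis using pq'(1) by blast
  qed
  show ?thesis
    by (rule polygon_lines_unique[OF equivalent_tile_polygon[OF E1 w] equivalent_tile_polygon[OF E2 w]])
      (use half[OF E1 E2 X1 X2] half[OF E2 E1 X2 X1] in blast)+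
qed

text \<open>The orientation makes consecutive sides of \<open>w\<close> correspond to consecutive
  sides of \<open>f w\<close>. Hence every vertex of \<open>f w\<close> is the common point of two
  known lines, namely \<open>vt w q X\<close>, and ratios and area follow by substitution.\<close>

lemma oriented_tile:
  assumes E: "equivalent_tiling R W b0 R' W' f g"
    and X: "\<And>s z. s \<in> segments W \<Longrightarrow> z \<in> g s \<Longrightarrow> \<nu> s \<bullet> z = X s"
    and w: "w \<in> W" and \<epsilon>: "\<epsilon> \<in> {1, -1}" and orient: "tile_orientation W g w (f w) \<epsilon>"
  shows "side w p q \<Longrightarrow> 0 < \<epsilon> * ratio w p q X"
    and "measure lebesgue (f w) = Q w X X"
proof -
  interpret T: polygon_tiling R' W' using E by unfold_locales (simp add: equivalent_tiling_def)
  note P = tile_polygon[OF w] and P' = equivalent_tile_polygon[OF E w]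
  have fw: "f w \<in> W'" using equivalent_in(1)[OF E w] .
  have "\<forall>p q. \<exists>p' q'. side w p q \<longrightarrow> side (f w) p' q' \<and> T.sg p' q' = g (sg p q)"
    using equivalent_side[OF E w] by blast
  then obtain s t where st: "\<And>p q. side w p q \<Longrightarrow> side (f w) (s p q) (t p q)"
    and sgst: "\<And>p q. side w p q \<Longrightarrow> T.sg (s p q) (t p q) = g (sg p q)" by metis
  have surj: "\<exists>p q. side w p q \<and> a = s p q \<and> b = t p q" if ab: "side (f w) a b" for a b
  proof -
    obtain p q where pq: "side w p q" "T.sg a b = g (sg p q)"
      using equivalent_side_converse[OF E w ab] by blast
    have "a = s p q \<and> b = t p q"
      by (rule T.sg_inj[OF fw ab st[OF pq(1)]]) (simp add: pq(2) sgst[OF pq(1)])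
    then show ?thesis using pq(1) by blast
  qed
  have dir: "\<exists>k>0. t p q - s p q = (\<epsilon> * k) *\<^sub>R (q - p)" if pq: "side w p q" for p q
  proof -
    have "ccw_edge w (sg p q) p q" using pq sg(2)[OF w pq] by (simp add: ccw_edge_iff)
    moreover have "ccw_edge (f w) (g (sg p q)) (s p q) (t p q)"
      using st[OF pq] T.sg(2)[OF fw st[OF pq]] sgst[OF pq] by (simp add: ccw_edge_iff)
    ultimately show ?thesis using orient sg(1)[OF w pq] unfolding tile_orientation_def by blast
  qed
  have adj: "t p q = s q r" if "side w p q" "side w q r" for p q r
    using adjacent_transfer[OF P P' \<epsilon> st surj dir that] .
  have on: "\<nu> (sg p q) \<bullet> s p q = X (sg p q)" "\<nu> (sg p q) \<bullet> t p q = X (sg p q)" if pq: "side w p q" for p q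
    using X[OF sg(1)[OF w pq]] T.sg_points[OF fw st[OF pq]] sgst[OF pq] by auto
  have t_eq: "t p q = vt w q X" if pq: "side w p q" for p q
  proof -
    obtain r where r: "side w q r" using side_next[OF P pq] .
    have "\<nu> (sg q r) \<bullet> t p q = X (sg q r)" using on(1)[OF r] adj[OF pq r] by simp
    then show ?thesis
      unfolding vt_eq[OF w pq r]
      using meet_unique[OF cross_normals[OF w pq r], of "t p q"] on(2)[OF pq] by simp
  qed
  have s_eq: "s p q = vt w p X" if pq: "side w p q" for p q
  proof -
    obtain a where a: "side w a p" using side_prev[OF P pq] .
    show ?thesis using adj[OF a pq] t_eq[OF a] by simp
  qed
  show "0 < \<epsilon> * ratio w p q X" if pq: "side w p q" for p q
  proof -
    obtain k where k: "0 < k" "t p q - s p q = (\<epsilon> * k) *\<^sub>R (q - p)" using dir[OF pq] by blast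
    have "ratio w p q X *\<^sub>R (q - p) = (\<epsilon> * k) *\<^sub>R (q - p)"
      using vt_diff[OF w pq, of X] k(2) unfolding t_eq[OF pq] s_eq[OF pq] by metis
    then have "ratio w p q X = \<epsilon> * k"
      using side_neq[OF P pq] by (simp only: scaleR_cancel_right) simp
    then show ?thesis using k(1) \<epsilon> by auto
  qed
  let ?E = "{(p, q). side w p q}" and ?h = "\<lambda>(p, q). (s p q, t p q)"
  have inj: "inj_on ?h ?E"
  proof (rule inj_onI)
    fix x y assume xy: "x \<in> ?E" "y \<in> ?E" "?h x = ?h y"
    obtain p q p' q' where x: "x = (p, q)" and y: "y = (p', q')" by (cases x, cases y)
    have "side w p q" "side w p' q'" "s p q = s p' q'" "t p q = t p' q'" using xy x y by auto
    then have "g (sg p q) = g (sg p' q')" using sgst by metis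
    then have "sg p q = sg p' q'"
      using bij_betw_imp_inj_on[OF equivalent_bij(2)[OF E]] sg(1)[OF w] \<open>side w p q\<close> \<open>side w p' q'\<close>
      by (meson inj_onD)
    then show "x = y" using sg_inj[OF w \<open>side w p q\<close> \<open>side w p' q'\<close>] x y by simp
  qed
  have im: "{(p, q). side (f w) p q} = ?h ` ?E"
    using surj st by (auto simp: image_iff)
  have "measure lebesgue (f w) = (\<Sum>(p, q)\<in>?h ` ?E. cross p q) / 2"
    using polygon_area[OF P'] im by simp
  also have "(\<Sum>(p, q)\<in>?h ` ?E. cross p q) = (\<Sum>(p, q)\<in>?E. cross (vt w p X) (vt w q X))"
    unfolding sum.reindex[OF inj] by (intro sum.cong refl) (auto simp: s_eq t_eq)
  finally show "measure lebesgue (f w) = Q w X X" unfolding Q_self[OF w] .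
qed

end

theorem theorem6:
  fixes R :: "plane set" and W :: "plane set set" and b0 :: "plane set"
    and \<nu> :: "plane set \<Rightarrow> plane"
    and \<beta> :: "'b::finite \<Rightarrow> plane set" and \<tau> :: "'w::finite \<Rightarrow> plane set"
    and \<sigma> :: "'w \<Rightarrow> real"
  assumes "tiling R W"
    and "\<forall>F\<in>bounded_faces R W. face_degree F = 4"
    and "b0 \<in> boundary_segments R W"
    and "unit_normals W \<nu>"
    and "bij_betw \<beta> UNIV (interior_segments R W \<union> {b0})"
    and "bij_betw \<tau> UNIV W"
    and "\<forall>k. \<sigma> k \<in> {1, -1}"
  shows "diffeomorphism_onto_image
           (oriented_tiling_space R W b0 \<nu> \<beta> \<tau> \<sigma>) (area_map R W b0 \<nu> \<beta> \<tau>)"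
proof -
  interpret normal_tiling R W \<nu>
    using assms(1,2,4) by unfold_locales auto
  have \<tau>: "\<tau> k \<in> W" for k using assms(6) by (auto dest: bij_betwE)
  have \<tau>_surj: "\<exists>k. \<tau> k = w" if "w \<in> W" for w
    using bij_betw_imp_surj_on[OF assms(6)] that by (metis rangeE)
  have range: "range \<beta> = interior_segments R W \<union> {b0}" using bij_betw_imp_surj_on[OF assms(5)] .
  have inj: "inj \<beta>" using bij_betw_imp_inj_on[OF assms(5)] .
  define X0 where "X0 s = (if s \<in> range \<beta> then 0 else intercept (\<nu> s) s)" for s
  define L where "L x s = (if s \<in> range \<beta> then x $ (inv \<beta> s) else 0)" for x :: "real^'b" and s
  have icpt: "icpt \<beta> x = (\<lambda>s. X0 s + L x s)" for x by (auto simp: icpt_def X0_def L_def)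
  have L_add: "L (x + y) = (\<lambda>s. L x s + L y s)" and L_scale: "L (c *\<^sub>R x) = (\<lambda>s. c * L x s)" for x y c
    by (auto simp: L_def)
  define B :: "real^'b \<Rightarrow> real^'b \<Rightarrow> real^'w" where "B x y = (\<chi> k. Q (\<tau> k) (L x) (L y))" for x y
  \<comment> \<open>The factor 2 collects the two mixed terms of the symmetric form
    \<open>Q\<close>.\<close>
  define l :: "real^'b \<Rightarrow> real^'w" where "l x = (\<chi> k. 2 * Q (\<tau> k) X0 (L x))" for x
  define c :: "real^'w" where "c = (\<chi> k. Q (\<tau> k) X0 X0)"
  define F where "F x = (\<chi> k. Q (\<tau> k) (icpt \<beta> x) (icpt \<beta> x))" for x
  \<comment> \<open>Only the sign conditions are kept here. The quadratic map \<open>F\<close> makes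
    sense at every point of \<open>S\<close>, whether or not a tiling has these intercepts.\<close>
  define S where "S = {x. \<forall>k p q. side (\<tau> k) p q \<longrightarrow> 0 < \<sigma> k * ratio (\<tau> k) p q (icpt \<beta> x)}"
  have ratio_icpt: "ratio w p q (icpt \<beta> x) = ratio w p q X0 + ratio w p q (L x)" for w p q x
    unfolding icpt by (rule ratio_add)
  have lin_ratio: "linear (\<lambda>x. ratio w p q (L x))" for w p q
    by (rule linearI) (simp_all add: L_add L_scale ratio_add ratio_scale)
  show ?thesis
  proof (rule quadratic_map_diffeomorphism_onto_image[of l B F c S])
    have "linear l" by (rule linearI) (simp_all add: l_def vec_eq_iff L_add L_scale Q_add Q_scale algebra_simps)
    then show "bounded_linear l" by (rule linear_conv_bounded_linear[THEN iffD1])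
    have "bilinear B"
      unfolding bilinear_def
      by (intro conjI allI linearI) (simp_all add: B_def vec_eq_iff L_add L_scale Q_add Q_scale)
    then show "bounded_bilinear B" by (rule bilinear_conv_bounded_bilinear[THEN iffD1])
    show "B x y = B y x" for x y using Q_sym[OF \<tau>] by (simp add: B_def vec_eq_iff)
    show "F x = c + l x + B x x" for x
      using Q_sym[OF \<tau>, of _ X0 "L x"]
      by (simp add: F_def c_def l_def B_def vec_eq_iff icpt Q_add)
    have S: "S = (\<Inter>k. \<Inter>(p, q)\<in>{(p, q). side (\<tau> k) p q}. {x. 0 < \<sigma> k * (ratio (\<tau> k) p q X0 + ratio (\<tau> k) p q (L x))})"
      by (auto simp: S_def ratio_icpt)
    have "open {x. 0 < \<sigma> k * (ratio (\<tau> k) p q X0 + ratio (\<tau> k) p q (L x))}" for k p q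
      by (intro open_Collect_less continuous_intros linear_continuous_on
          linear_conv_bounded_linear[THEN iffD1] lin_ratio)
    then show "open S"
      unfolding S using finite_sides[OF tile_polygon[OF \<tau>]] by (intro open_INT ballI) auto
    show "convex S"
    proof (rule convexI)
      fix x y and u v :: real
      assume xy: "x \<in> S" "y \<in> S" "0 \<le> u" "0 \<le> v" "u + v = 1"
      have "0 < \<sigma> k * ratio (\<tau> k) p q (icpt \<beta> (u *\<^sub>R x + v *\<^sub>R y))" if "side (\<tau> k) p q" for k p q
      proof -
        let ?r = "\<lambda>x. \<sigma> k * ratio (\<tau> k) p q (icpt \<beta> x)"
        \<comment> \<open>The function is affine, not linear; the last term accounts for its
          constant part and vanishes for \<open>u + v = 1\<close>.\<close>
        have "?r (u *\<^sub>R x + v *\<^sub>R y) = u * ?r x + v * ?r y + (1 - (u + v)) * (\<sigma> k * ratio (\<tau> k) p q X0)"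
          by (simp add: ratio_icpt L_add L_scale ratio_add ratio_scale algebra_simps)
        also have "\<dots> = u * ?r x + v * ?r y" using xy(5) by simp
        also have "\<dots> > 0"
        proof -
          have "0 < ?r x" "0 < ?r y" using xy(1,2) that by (auto simp: S_def)
          then show ?thesis using xy(3-5) by (smt (verit) mult_nonneg_nonneg mult_pos_pos)
        qed
        finally show ?thesis .
      qed
      then show "u *\<^sub>R x + v *\<^sub>R y \<in> S" by (auto simp: S_def)
    qed
    show "v = 0" if x: "x \<in> S" and D: "l v + 2 *\<^sub>R B x v = 0" for x v
    proof -
      define \<epsilon> where "\<epsilon> w = \<sigma> (inv \<tau> w)" for w
      have sgn: "0 < \<epsilon> w * ratio w p q (icpt \<beta> x)" if "w \<in> W" "side w p q" for w p q
      proof -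
        have "\<tau> (inv \<tau> w) = w" using \<tau>_surj[OF that(1)] by (auto simp: f_inv_into_f)
        moreover have "side (\<tau> (inv \<tau> w)) p q" using calculation that(2) by simp
        then have "0 < \<sigma> (inv \<tau> w) * ratio (\<tau> (inv \<tau> w)) p q (icpt \<beta> x)"
          using x unfolding S_def by blast
        ultimately show ?thesis by (simp only: \<epsilon>_def)
      qed
      \<comment> \<open>Up to the factor 2 this is the derivative of the area of \<open>w\<close> at
        \<open>x\<close> in direction \<open>v\<close>.\<close>
      have zero: "Q w (icpt \<beta> x) (L v) = 0" if w: "w \<in> W" for w
      proof -
        obtain k where k: "\<tau> k = w" using \<tau>_surj[OF w] by blast
        have "(l v + 2 *\<^sub>R B x v) $ k = 0" using D by simp
        then show ?thesis by (simp add: l_def B_def icpt Q_add k)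
      qed
      have bd: "L v s = 0" if "s \<in> boundary_segments R W" "s \<noteq> b0" for s
        using that by (auto simp: L_def range interior_segments_def)
      have "v $ j = 0" for j
      proof -
        have j: "\<beta> j \<in> segments W"
          using range assms(3) by (auto simp: interior_segments_def boundary_segments_def)
        have "L v (\<beta> j) = 0"
          by (rule derivative_injective[where Y = "L v" and X = "icpt \<beta> x" and \<epsilon> = \<epsilon>,
                OF assms(3) bd sgn zero j])
        then show ?thesis using inj by (simp add: L_def)
      qed
      then show ?thesis by (simp add: vec_eq_iff)
    qed
    have "CARD('w) = card W" using bij_betw_same_card[OF assms(6)] by simp
    also have "\<dots> \<le> card (interior_segments R W \<union> {b0})" by (rule card_tiles_le[OF assms(3)])
    also have "\<dots> = CARD('b)" using bij_betw_same_card[OF assms(5)] by simp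
    finally show "CARD('w) \<le> CARD('b)" .
    have oriented: "x \<in> S \<and> area_map R W b0 \<nu> \<beta> \<tau> x = F x" if "x \<in> oriented_tiling_space R W b0 \<nu> \<beta> \<tau> \<sigma>" for x
    proof -
      obtain R' W' f g where e: "equivalent_tiling R W b0 R' W' f g" "has_intercepts \<nu> \<beta> g x"
        "\<And>k. tile_orientation W g (\<tau> k) (f (\<tau> k)) (\<sigma> k)"
        using \<open>x \<in> oriented_tiling_space R W b0 \<nu> \<beta> \<tau> \<sigma>\<close> unfolding oriented_tiling_space_def by blast
      have \<sigma>: "\<sigma> k \<in> {1, -1}" for k using assms(7) by blast
      note X = icpt_equivalent[OF e(1,2) assms(5)]
      have xS: "x \<in> S"
        unfolding S_def using oriented_tile(1)[OF e(1) X \<tau> \<sigma> e(3)] by blast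
      \<comment> \<open>The choice in \<open>area_map\<close> ranges over all equivalent tilings
        with intercepts \<open>x\<close>, including those not known to be oriented by \<sigma>; by
        \<open>tile_unique\<close> their tiles are those of the oriented one.\<close>
      have eq: "(\<chi> k. measure lebesgue (f' (\<tau> k))) = F x"
        if e': "equivalent_tiling R W b0 R'' W'' f' g'" "has_intercepts \<nu> \<beta> g' x" for R'' W'' f' g'
        using tile_unique[OF e'(1) e(1) icpt_equivalent[OF e' assms(5)] X \<tau>]
          oriented_tile(2)[OF e(1) X \<tau> \<sigma> e(3)]
        by (simp add: F_def vec_eq_iff)
      have "area_map R W b0 \<nu> \<beta> \<tau> x = F x"
        unfolding area_map_def
      proof (rule some_equality)
        show "\<exists>R' W' f g. equivalent_tiling R W b0 R' W' f g \<and> has_intercepts \<nu> \<beta> g x \<and>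
            F x = (\<chi> k. measure lebesgue (f (\<tau> k)))"
          using e(1,2) eq[OF e(1,2), symmetric] by blast
      next
        fix A
        assume "\<exists>R' W' f g. equivalent_tiling R W b0 R' W' f g \<and> has_intercepts \<nu> \<beta> g x \<and>
            A = (\<chi> k. measure lebesgue (f (\<tau> k)))"
        then show "A = F x" using eq by metis
      qed
      then show ?thesis using xS by simp
    qed
    show "oriented_tiling_space R W b0 \<nu> \<beta> \<tau> \<sigma> \<subseteq> S" using oriented by blast
    show "area_map R W b0 \<nu> \<beta> \<tau> x = F x" if "x \<in> oriented_tiling_space R W b0 \<nu> \<beta> \<tau> \<sigma>" for x
      using oriented[OF that] by simp
  qed
qed

end
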